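(* Let $d\in\mathbb{N}$ and let $X$ and $Y$ be Banach spaces. Let $\frac1r=\frac1p-\frac1q$ with $p\in[1,2]$, $q\in[2,\infty)$ and $r\in(1,\infty]$. Assume that for all $m\in L^r(\mathbb{R}^d;\mathcal{L}(X,Y))$ the operator $T_m:L^p(\mathbb{R}^d;X)\to L^q(\mathbb{R}^d;Y)$ is bounded. (1) If $Y=\mathbb{C}$ and $q=2$, then $X$ has Fourier type $p$. (2) If $X=\mathbb{C}$ and $p=2$, then $Y$ has Fourier type $q'$. (3) If $Y=X^*$ and $q=p'$, then $X$ has Fourier type $p$.
   Context: Banach spaces are nonzero and over $\mathbb{C}$; $p',q'$ are Hölder conjugates. $\widehat f(\xi)=\mathcal{F}f(\xi)=\int_{\mathbb{R}^d}e^{-2\pi i\xi\cdot t}f(t)\,dt$. A Banach space $X$ has Fourier type $p\in[1,2]$ if $\mathcal{F}$ is bounded from $L^p(\mathbb{R}^d;X)$ to $L^{p'}(\mathbb{R}^d;X)$ for some (equivalently all) $d\in\mathbb{N}$. For $f\in\mathcal{S}(\mathbb{R}^d;X)$ (Schwartz functions), $T_m(f):=\mathcal{F}^{-1}(m\widehat f\,)\in\mathcal{S}'(\mathbb{R}^d;Y)$; "$T_m:L^p(\mathbb{R}^d;X)\to L^q(\mathbb{R}^d;Y)$ is bounded" means there is a constant $C_m$ with $T_m(f)\in L^q(\mathbb{R}^d;Y)$ and $\|T_m(f)\|_{L^q}\le C_m\|f\|_{L^p}$ for all $f\in\mathcal{S}(\mathbb{R}^d;X)$. *)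

theory Defs
  imports "HOL-Analysis.Analysis" "HOL-Probability.Essential_Supremum"
begin

section \<open>Complex Banach spaces and complex-linear operators\<close>

class complex_banach = banach +
  fixes scaleC :: "complex \<Rightarrow> 'a \<Rightarrow> 'a"  (infixr \<open>*\<^sub>C\<close> 75)
  assumes scaleC_add_right: "c *\<^sub>C (x + y) = c *\<^sub>C x + c *\<^sub>C y"
    and scaleC_add_left: "(c + e) *\<^sub>C x = c *\<^sub>C x + e *\<^sub>C x"
    and scaleC_scaleC: "c *\<^sub>C (e *\<^sub>C x) = (c * e) *\<^sub>C x"
    and scaleR_scaleC: "r *\<^sub>R x = complex_of_real r *\<^sub>C x"
    and norm_scaleC: "norm (c *\<^sub>C x) = cmod c * norm x"

instantiation complex :: complex_banach
begin

definition scaleC_complex :: "complex \<Rightarrow> complex \<Rightarrow> complex"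
  where "scaleC_complex c z = c * z"

instance
  by standard (auto simp: scaleC_complex_def algebra_simps scaleR_conv_of_real norm_mult)

end

lemma scaleC_diff_right: "c *\<^sub>C (x - y) = c *\<^sub>C x - c *\<^sub>C (y :: 'a::complex_banach)"
  by (metis add_diff_cancel diff_add_cancel scaleC_add_right)

lemma scaleC_zero_right [simp]: "c *\<^sub>C (0 :: 'a::complex_banach) = 0"
  using scaleC_diff_right[of c 0 0] by simp

lemma scaleC_minus_right: "c *\<^sub>C (- x) = - (c *\<^sub>C (x :: 'a::complex_banach))"
  using scaleC_diff_right[of c 0 x] by simp

lemma scaleC_scaleR_commute: "c *\<^sub>C (r *\<^sub>R x) = r *\<^sub>R (c *\<^sub>C (x :: 'a::complex_banach))"
  by (simp add: scaleR_scaleC scaleC_scaleC mult.commute)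

lemma bounded_linear_scaleC_right: "bounded_linear (\<lambda>x :: 'a::complex_banach. c *\<^sub>C x)"
  by (rule bounded_linear_intro[where K = "cmod c"])
    (simp_all add: scaleC_add_right scaleC_scaleR_commute norm_scaleC mult.commute)

text \<open>
  The space $\mathcal{L}(X,Y)$: the complex-linear elements of the library's space of bounded
  real-linear maps, with the inherited operator norm.
\<close>

typedef (overloaded) ('a, 'b) clinop =
  "{f :: 'a::complex_banach \<Rightarrow>\<^sub>L 'b::complex_banach.
      \<forall>c x. blinfun_apply f (c *\<^sub>C x) = c *\<^sub>C blinfun_apply f x}"
  morphisms blinfun_of_clinop Abs_clinop
  by (rule exI[of _ 0]) simp

type_synonym 'a cdual = "('a, complex) clinop"

setup_lifting type_definition_clinop

lift_definition clinop_apply :: "('a::complex_banach, 'b::complex_banach) clinop \<Rightarrow> 'a \<Rightarrow> 'b"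
  is "blinfun_apply" .

instantiation clinop :: (complex_banach, complex_banach) real_normed_vector
begin

lift_definition norm_clinop :: "('a, 'b) clinop \<Rightarrow> real" is norm .

lift_definition zero_clinop :: "('a, 'b) clinop" is 0 by simp

lift_definition plus_clinop :: "('a, 'b) clinop \<Rightarrow> ('a, 'b) clinop \<Rightarrow> ('a, 'b) clinop"
  is "(+)" by (simp add: blinfun.add_left scaleC_add_right)

lift_definition minus_clinop :: "('a, 'b) clinop \<Rightarrow> ('a, 'b) clinop \<Rightarrow> ('a, 'b) clinop"
  is "(-)" by (simp add: blinfun.diff_left scaleC_diff_right)

lift_definition uminus_clinop :: "('a, 'b) clinop \<Rightarrow> ('a, 'b) clinop"
  is uminus by (simp add: blinfun.minus_left scaleC_minus_right)

lift_definition scaleR_clinop :: "real \<Rightarrow> ('a, 'b) clinop \<Rightarrow> ('a, 'b) clinop"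
  is scaleR by (simp add: blinfun.scaleR_left scaleC_scaleR_commute)

definition dist_clinop :: "('a, 'b) clinop \<Rightarrow> ('a, 'b) clinop \<Rightarrow> real"
  where "dist_clinop f g = norm (f - g)"

definition uniformity_clinop :: "(('a, 'b) clinop \<times> ('a, 'b) clinop) filter"
  where "uniformity_clinop = (INF e\<in>{0 <..}. principal {(x, y). dist x y < e})"

definition open_clinop :: "('a, 'b) clinop set \<Rightarrow> bool"
  where "open_clinop S = (\<forall>x\<in>S. \<forall>\<^sub>F (x', y) in uniformity. x' = x \<longrightarrow> y \<in> S)"

definition sgn_clinop :: "('a, 'b) clinop \<Rightarrow> ('a, 'b) clinop"
  where "sgn_clinop f = scaleR (inverse (norm f)) f"

instance
proof
  fix a b :: real and f g h :: "('a, 'b) clinop"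
  show "f - g = f + - g" by transfer simp
  show "f + g + h = f + (g + h)" by transfer simp
  show "f + g = g + f" by transfer simp
  show "0 + f = f" by transfer simp
  show "- f + f = 0" by transfer simp
  show "a *\<^sub>R (f + g) = a *\<^sub>R f + a *\<^sub>R g" by transfer (simp add: scaleR_add_right)
  show "(a + b) *\<^sub>R f = a *\<^sub>R f + b *\<^sub>R f" by transfer (simp add: scaleR_add_left)
  show "a *\<^sub>R b *\<^sub>R f = (a * b) *\<^sub>R f" by transfer simp
  show "1 *\<^sub>R f = f" by transfer simp
  show "norm f = 0 \<longleftrightarrow> f = 0" by transfer simp
  show "norm (f + g) \<le> norm f + norm g" by transfer (rule norm_triangle_ineq)
  show "norm (a *\<^sub>R f) = \<bar>a\<bar> * norm f" by transfer simp
qed (simp_all only: dist_clinop_def uniformity_clinop_def open_clinop_def sgn_clinop_def)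

end

lemma dist_blinfun_of_clinop: "dist (blinfun_of_clinop f) (blinfun_of_clinop g) = dist f g"
  by (simp add: dist_norm norm_clinop.rep_eq minus_clinop.rep_eq)

instance clinop :: (complex_banach, complex_banach) banach
proof
  fix X :: "nat \<Rightarrow> ('a, 'b) clinop"
  assume "Cauchy X"
  then have "Cauchy (\<lambda>n. blinfun_of_clinop (X n))"
    by (simp add: Cauchy_def dist_blinfun_of_clinop)
  then obtain F where F: "(\<lambda>n. blinfun_of_clinop (X n)) \<longlonglongrightarrow> F"
    using Cauchy_convergent convergent_def by blast
  have ptw: "(\<lambda>n. blinfun_apply (blinfun_of_clinop (X n)) x) \<longlonglongrightarrow> blinfun_apply F x" for x
    by (intro blinfun.tendsto F tendsto_const)
  have "blinfun_apply F (c *\<^sub>C x) = c *\<^sub>C blinfun_apply F x" for c x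
  proof (rule LIMSEQ_unique[OF ptw[of "c *\<^sub>C x"]])
    have "blinfun_apply (blinfun_of_clinop (X n)) (c *\<^sub>C x)
        = c *\<^sub>C blinfun_apply (blinfun_of_clinop (X n)) x" for n
      using blinfun_of_clinop[of "X n"] by simp
    then show "(\<lambda>n. blinfun_apply (blinfun_of_clinop (X n)) (c *\<^sub>C x))
        \<longlonglongrightarrow> c *\<^sub>C blinfun_apply F x"
      using bounded_linear.tendsto[OF bounded_linear_scaleC_right ptw[of x]] by simp
  qed
  then have "blinfun_of_clinop (Abs_clinop F) = F"
    by (simp add: Abs_clinop_inverse)
  then have "X \<longlonglongrightarrow> Abs_clinop F"
    using F by (simp add: LIMSEQ_def dist_blinfun_of_clinop[symmetric])
  then show "convergent X"
    by (auto simp: convergent_def)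
qed

instantiation clinop :: (complex_banach, complex_banach) complex_banach
begin

lift_definition scaleC_clinop :: "complex \<Rightarrow> ('a, 'b) clinop \<Rightarrow> ('a, 'b) clinop"
  is "\<lambda>c f. Blinfun (\<lambda>x. c *\<^sub>C blinfun_apply f x)"
  by (simp add: bounded_linear_Blinfun_apply scaleC_scaleC mult.commute
      bounded_linear_compose[OF bounded_linear_scaleC_right blinfun.bounded_linear_right])

lemma clinop_apply_scaleC: "clinop_apply (c *\<^sub>C f) x = c *\<^sub>C clinop_apply f x"
  by transfer
    (simp add: bounded_linear_Blinfun_apply
      bounded_linear_compose[OF bounded_linear_scaleC_right blinfun.bounded_linear_right])

lemma clinop_eqI: "(\<And>x. clinop_apply f x = clinop_apply g x) \<Longrightarrow> f = g"
  by transfer (auto intro: blinfun_eqI)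

lemma norm_scaleC_clinop:
  fixes f :: "('a, 'b) clinop"
  shows "norm (c *\<^sub>C f) = cmod c * norm f"
proof (cases "c = 0")
  case True
  have "c *\<^sub>C f = 0"
  proof (rule clinop_eqI)
    fix x
    have "norm (clinop_apply (c *\<^sub>C f) x) = 0"
      by (simp add: clinop_apply_scaleC norm_scaleC True)
    then show "clinop_apply (c *\<^sub>C f) x = clinop_apply 0 x"
      by (simp add: clinop_apply.rep_eq zero_clinop.rep_eq)
  qed
  then show ?thesis using True by simp
next
  case False
  have le: "norm (e *\<^sub>C g) \<le> cmod e * norm g" for e and g :: "('a, 'b) clinop"
  proof -
    have "norm (blinfun_apply (blinfun_of_clinop (e *\<^sub>C g)) x) \<le> cmod e * norm g * norm x" for x
      using clinop_apply_scaleC[of e g x] norm_blinfun[of "blinfun_of_clinop g" x]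
      by (simp add: clinop_apply.rep_eq norm_scaleC norm_clinop.rep_eq mult.assoc mult_left_mono)
    then show ?thesis
      unfolding norm_clinop.rep_eq[of "e *\<^sub>C g"] by (intro norm_blinfun_bound) auto
  qed
  have "(1 / c) *\<^sub>C (c *\<^sub>C f) = f"
  proof (rule clinop_eqI)
    fix x
    have "clinop_apply ((1 / c) *\<^sub>C (c *\<^sub>C f)) x = complex_of_real 1 *\<^sub>C clinop_apply f x"
      using False by (simp add: clinop_apply_scaleC scaleC_scaleC)
    then show "clinop_apply ((1 / c) *\<^sub>C (c *\<^sub>C f)) x = clinop_apply f x"
      by (simp only: scaleR_scaleC[symmetric] scaleR_one)
  qed
  then have "norm f \<le> cmod (1 / c) * norm (c *\<^sub>C f)"
    using le[of "1 / c" "c *\<^sub>C f"] by simp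
  then have "cmod c * norm f \<le> norm (c *\<^sub>C f)"
    using False by (simp add: norm_divide field_simps)
  with le[of c f] show ?thesis by simp
qed

instance
proof
  fix c e :: complex and r :: real and f g :: "('a, 'b) clinop"
  have plus: "clinop_apply (f + g) x = clinop_apply f x + clinop_apply g x"
    for f g :: "('a, 'b) clinop" and x
    by (simp add: clinop_apply.rep_eq plus_clinop.rep_eq blinfun.add_left)
  show "c *\<^sub>C (f + g) = c *\<^sub>C f + c *\<^sub>C g"
    by (rule clinop_eqI) (simp add: plus clinop_apply_scaleC scaleC_add_right)
  show "(c + e) *\<^sub>C f = c *\<^sub>C f + e *\<^sub>C f"
    by (rule clinop_eqI) (simp add: plus clinop_apply_scaleC scaleC_add_left)
  show "c *\<^sub>C (e *\<^sub>C f) = (c * e) *\<^sub>C f"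
    by (rule clinop_eqI) (simp add: clinop_apply_scaleC scaleC_scaleC)
  have scaleR: "clinop_apply (r *\<^sub>R f) x = r *\<^sub>R clinop_apply f x" for x
    by (simp add: clinop_apply.rep_eq scaleR_clinop.rep_eq blinfun.scaleR_left)
  show "r *\<^sub>R f = complex_of_real r *\<^sub>C f"
    by (rule clinop_eqI) (simp add: scaleR clinop_apply_scaleC scaleR_scaleC)
  show "norm (c *\<^sub>C f) = cmod c * norm f"
    by (rule norm_scaleC_clinop)
qed

end


section \<open>Bochner integral and Lebesgue--Bochner spaces\<close>

text \<open>
  The library's \<open>has_bochner_integral\<close> is restricted to second countable target spaces. For arbitrary
  Banach spaces, Borel measurability is replaced by strong measurability. Requiring convergence
  everywhere instead of almost everywhere only selects a representative of each class modulo null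
  sets.
\<close>

definition strongly_measurable :: "'v measure \<Rightarrow> ('v \<Rightarrow> 'a::real_normed_vector) \<Rightarrow> bool" where
  "strongly_measurable M f \<longleftrightarrow>
     (\<exists>s. (\<forall>i. simple_function M (s i)) \<and> (\<forall>x\<in>space M. (\<lambda>i. s i x) \<longlonglongrightarrow> f x))"

definition has_strong_integral ::
    "'v measure \<Rightarrow> ('v \<Rightarrow> 'a::real_normed_vector) \<Rightarrow> 'a \<Rightarrow> bool" where
  "has_strong_integral M f I \<longleftrightarrow> strongly_measurable M f \<and>
     (\<exists>s. (\<forall>i. Bochner_Integration.simple_bochner_integrable M (s i)) \<and>
          (\<lambda>i. \<integral>\<^sup>+x. ennreal (norm (f x - s i x)) \<partial>M) \<longlonglongrightarrow> 0 \<and>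
          (\<lambda>i. Bochner_Integration.simple_bochner_integral M (s i)) \<longlonglongrightarrow> I)"

definition strong_integral :: "'v measure \<Rightarrow> ('v \<Rightarrow> 'a::real_normed_vector) \<Rightarrow> 'a" where
  "strong_integral M f =
     (if \<exists>I. has_strong_integral M f I then THE I. has_strong_integral M f I else 0)"

definition Lp_space :: "ereal \<Rightarrow> 'v measure \<Rightarrow> ('v \<Rightarrow> 'a::real_normed_vector) set" where
  "Lp_space p M = {f. strongly_measurable M f \<and>
     (if p = \<infinity> then esssup M (\<lambda>x. ereal (norm (f x))) < \<infinity>
      else integrable M (\<lambda>x. norm (f x) powr real_of_ereal p))}"

definition Lp_norm :: "ereal \<Rightarrow> 'v measure \<Rightarrow> ('v \<Rightarrow> 'a::real_normed_vector) \<Rightarrow> real" where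
  "Lp_norm p M f =
     (if p = \<infinity> then real_of_ereal (esssup M (\<lambda>x. ereal (norm (f x))))
      else (\<integral>x. norm (f x) powr real_of_ereal p \<partial>M) powr (1 / real_of_ereal p))"

text \<open>With \<open>1 / 0 = \<infinity>\<close> and \<open>1 / \<infinity> = 0\<close> in \<^typ>\<open>ereal\<close>, this also covers the exponents \<open>1\<close> and \<open>\<infinity>\<close>.\<close>

definition holder_conjugate :: "ereal \<Rightarrow> ereal" where
  "holder_conjugate p = 1 / (1 - 1 / p)"


section \<open>Schwartz functions, Fourier transform and Fourier multipliers\<close>

definition partial_deriv ::
    "'n::finite \<Rightarrow> (real^'n \<Rightarrow> 'a::real_normed_vector) \<Rightarrow> real^'n \<Rightarrow> 'a" where
  "partial_deriv j f x = frechet_derivative f (at x) (axis j 1)"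

text \<open>
  A list of coordinate indices plays the role of the multi-index. Differentiability of all iterated
  partial derivatives is equivalent to \<open>f\<close> being infinitely differentiable.
\<close>

definition schwartz :: "(real^'n::finite \<Rightarrow> 'a::real_normed_vector) \<Rightarrow> bool" where
  "schwartz f \<longleftrightarrow>
     (\<forall>js x. foldr partial_deriv js f differentiable (at x)) \<and>
     (\<forall>js (k::nat). \<exists>C. \<forall>x. norm x ^ k * norm (foldr partial_deriv js f x) \<le> C)"

definition fourier :: "(real^'n::finite \<Rightarrow> 'a::complex_banach) \<Rightarrow> real^'n \<Rightarrow> 'a" where
  "fourier f \<xi> =
     strong_integral lborel (\<lambda>t. exp (- 2 * of_real pi * \<i> * of_real (\<xi> \<bullet> t)) *\<^sub>C f t)"

definition inverse_fourier :: "(real^'n::finite \<Rightarrow> 'a::complex_banach) \<Rightarrow> real^'n \<Rightarrow> 'a" where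
  "inverse_fourier f x =
     strong_integral lborel (\<lambda>\<xi>. exp (2 * of_real pi * \<i> * of_real (x \<bullet> \<xi>)) *\<^sub>C f \<xi>)"

text \<open>
  Vector-valued tempered distributions are represented by functionals on scalar functions, of which
  only the values on Schwartz functions matter.
\<close>

definition distribution_of ::
    "(real^'n::finite \<Rightarrow> 'a::complex_banach) \<Rightarrow> (real^'n \<Rightarrow> complex) \<Rightarrow> 'a" where
  "distribution_of g \<phi> = strong_integral lborel (\<lambda>x. \<phi> x *\<^sub>C g x)"

definition inverse_fourier_distribution ::
    "((real^'n::finite \<Rightarrow> complex) \<Rightarrow> 'a::complex_banach) \<Rightarrow> (real^'n \<Rightarrow> complex) \<Rightarrow> 'a" where
  "inverse_fourier_distribution u \<phi> = u (inverse_fourier \<phi>)"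

definition fourier_multiplier ::
    "(real^'n::finite \<Rightarrow> ('a::complex_banach, 'b::complex_banach) clinop) \<Rightarrow>
     (real^'n \<Rightarrow> 'a) \<Rightarrow> (real^'n \<Rightarrow> complex) \<Rightarrow> 'b" where
  "fourier_multiplier m f =
     inverse_fourier_distribution (distribution_of (\<lambda>\<xi>. clinop_apply (m \<xi>) (fourier f \<xi>)))"

definition fourier_multiplier_bounded ::
    "ereal \<Rightarrow> ereal \<Rightarrow> (real^'n::finite \<Rightarrow> ('a::complex_banach, 'b::complex_banach) clinop) \<Rightarrow> bool"
  where
  "fourier_multiplier_bounded p q m \<longleftrightarrow>
     (\<exists>C. \<forall>f. schwartz f \<longrightarrow>
        (\<exists>g\<in>Lp_space q lborel.
           (\<forall>\<phi>. schwartz \<phi> \<longrightarrow> fourier_multiplier m f \<phi> = distribution_of g \<phi>) \<and>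
           Lp_norm q lborel g \<le> C * Lp_norm p lborel f))"


section \<open>Fourier type\<close>

text \<open>
  Fourier type is a property of the space alone, with the dimension \<open>d\<close> existentially quantified, so
  here \<open>\<real>\<^sup>d\<close> is the set of (extensional) functions on \<open>{..<d}\<close> with the \<open>d\<close>-fold product of Lebesgue
  measure. Boundedness from \<open>L\<^sup>p\<close> to \<open>L\<^sup>p\<^sup>'\<close> is expressed as an estimate on the dense subspace \<open>L\<^sup>1 \<inter> L\<^sup>p\<close>, on which the
  Fourier transform is given by the integral.
\<close>

definition lebesgue_power :: "nat \<Rightarrow> (nat \<Rightarrow> real) measure" where
  "lebesgue_power d = PiM {..<d} (\<lambda>_. lborel)"

definition fourier_power ::
    "nat \<Rightarrow> ((nat \<Rightarrow> real) \<Rightarrow> 'a::complex_banach) \<Rightarrow> (nat \<Rightarrow> real) \<Rightarrow> 'a" where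
  "fourier_power d f \<xi> =
     strong_integral (lebesgue_power d)
       (\<lambda>t. exp (- 2 * of_real pi * \<i> * of_real (\<Sum>k<d. \<xi> k * t k)) *\<^sub>C f t)"

definition fourier_type :: "'a::complex_banach itself \<Rightarrow> ereal \<Rightarrow> bool" where
  "fourier_type (_ :: 'a itself) p \<longleftrightarrow> 1 \<le> p \<and> p \<le> 2 \<and>
     (\<exists>d\<ge>1. \<exists>C. \<forall>f :: (nat \<Rightarrow> real) \<Rightarrow> 'a.
        f \<in> Lp_space 1 (lebesgue_power d) \<inter> Lp_space p (lebesgue_power d) \<longrightarrow>
        fourier_power d f \<in> Lp_space (holder_conjugate p) (lebesgue_power d) \<and>
        Lp_norm (holder_conjugate p) (lebesgue_power d) (fourier_power d f)
          \<le> C * Lp_norm p (lebesgue_power d) f)"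

end

theory Submission
  imports Defs "HOL-Probability.Characteristic_Functions"
begin

text \<open>
  By uniform boundedness the norm of \<open>T\<^sub>m\<close> is controlled by \<open>\<parallel>m\<parallel>\<^sub>r\<close>, so the trilinear form
  \<open>\<integral> \<langle>m (\<F> f), \<F>\<^sup>-\<^sup>1 \<phi>\<rangle>\<close> is bounded by \<open>C \<parallel>m\<parallel>\<^sub>r \<parallel>f\<parallel>\<^sub>p \<parallel>\<phi>\<parallel>\<^sub>q\<^sub>'\<close>. In part (1) Plancherel makes \<open>\<F>\<^sup>-\<^sup>1 \<phi>\<close>
  an arbitrary element of \<open>L\<^sup>2\<close>, and every \<open>\<eta>\<close> in \<open>L\<^sup>p(X\<^sup>*)\<close> factors as \<open>m \<cdot> \<F>\<^sup>-\<^sup>1 \<phi>\<close>; hence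
  \<open>\<integral> \<langle>\<eta>, \<F> f\<rangle>\<close> is bounded by \<open>C \<parallel>\<eta>\<parallel>\<^sub>p \<parallel>f\<parallel>\<^sub>p\<close> and duality gives Fourier type \<open>p\<close>. Part (2) is the same
  argument with the roles of \<open>f\<close> and \<open>\<phi>\<close> exchanged. In part (3) one takes rank-one multipliers
  \<open>w \<cdot> (F \<otimes> F)\<close> and for \<open>\<phi>\<close> the reflection of \<open>f\<close>, which yields a weighted \<open>L\<^sup>2\<close> estimate for \<open>\<langle>F, \<F> f\<rangle>\<close>, and
  concludes by Cauchy--Schwarz. All estimates are normalised so that the constants do not matter.
\<close>

section \<open>Strong measurability\<close>

text \<open>The hypothesis gives one constant per multiplier and speaks of Schwartz functions;
  Fourier type asks for one constant on all of L^1 and L^p. The span of Gaussians of a fixed width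
  links the two: its members are Schwartz, and transform, inversion and Plancherel are explicit on
  generators. What must be proved is density in both norms at once: closeness in L^1 controls the
  Fourier transform uniformly, so pairings with integrable functions pass to the limit, while a
  bound in L^p keeps the approximants in the ball where the multiplier estimate holds. The exponents
  fit by Hoelder: if 1/r = 1/p - 1/2, then |\<eta>|^(1-p/2) is in L^r for \<eta> in L^p; if 1/r =
  1/p - 1/p', the same holds for |\<eta>|^(2-p). The multipliers so obtained involve negative powers
  of norms and unmeasurable choices of functionals; these are only ever evaluated on simple
  functions. Targets may be nonseparable, so identities between vector integrals are checked after
  applying functionals, which separate points by Hahn-Banach. The endpoint p = 1 is treated apart,
  since every space has Fourier type 1.\<close>

lemma strongly_measurable_simple: "simple_function M f \<Longrightarrow> strongly_measurable M f"
  unfolding strongly_measurable_def by (intro exI[of _ "\<lambda>_. f"]) auto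

lemma strongly_measurable_compose2:
  assumes f: "strongly_measurable M f" and g: "strongly_measurable M g"
    and h: "continuous_on UNIV (\<lambda>z. h (fst z) (snd z))"
  shows "strongly_measurable M (\<lambda>x. h (f x) (g x))"
proof -
  obtain s where s: "\<And>i. simple_function M (s i)" "\<And>x. x \<in> space M \<Longrightarrow> (\<lambda>i. s i x) \<longlonglongrightarrow> f x"
    using f unfolding strongly_measurable_def by blast
  obtain t where t: "\<And>i. simple_function M (t i)" "\<And>x. x \<in> space M \<Longrightarrow> (\<lambda>i. t i x) \<longlonglongrightarrow> g x"
    using g unfolding strongly_measurable_def by blast
  have "(\<lambda>i. h (s i x) (t i x)) \<longlonglongrightarrow> h (f x) (g x)" if "x \<in> space M" for x
    using continuous_on_tendsto_compose[OF h tendsto_Pair[OF s(2)[OF that] t(2)[OF that]]] by simp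
  then show ?thesis
    unfolding strongly_measurable_def
    by (intro exI[of _ "\<lambda>i x. h (s i x) (t i x)"]) (auto intro: simple_function_compose2 s t)
qed

lemma strongly_measurable_compose1:
  assumes f: "strongly_measurable M f" and h: "continuous_on UNIV h"
  shows "strongly_measurable M (\<lambda>x. h (f x))"
  using strongly_measurable_compose2[OF f f, of "\<lambda>a b. h a"] continuous_on_compose2[OF h continuous_on_fst[OF continuous_on_id], of UNIV]
  by simp

lemma strongly_measurable_const: "strongly_measurable M (\<lambda>_. c)"
  by (rule strongly_measurable_simple) simp

lemma strongly_measurable_add:
  "strongly_measurable M f \<Longrightarrow> strongly_measurable M g \<Longrightarrow> strongly_measurable M (\<lambda>x. f x + g x)"
  using strongly_measurable_compose2[of M f g "(+)"] by (simp add: continuous_intros)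

lemma strongly_measurable_diff:
  "strongly_measurable M f \<Longrightarrow> strongly_measurable M g \<Longrightarrow> strongly_measurable M (\<lambda>x. f x - g x)"
  using strongly_measurable_compose2[of M f g "(-)"] by (simp add: continuous_intros)

lemma strongly_measurable_bilinear:
  assumes "bounded_bilinear h" "strongly_measurable M f" "strongly_measurable M g"
  shows "strongly_measurable M (\<lambda>x. h (f x) (g x))"
  by (rule strongly_measurable_compose2[where h = h])
     (intro assms bounded_bilinear.continuous_on[OF assms(1)] continuous_intros)+

lemma borel_measurable_norm_strong:
  assumes "strongly_measurable M f"
  shows "(\<lambda>x. norm (f x)) \<in> borel_measurable M"
proof -
  obtain s where s: "\<And>i. simple_function M (s i)" "\<And>x. x \<in> space M \<Longrightarrow> (\<lambda>i. s i x) \<longlonglongrightarrow> f x"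
    using assms unfolding strongly_measurable_def by blast
  show ?thesis
  proof (rule borel_measurable_LIMSEQ_metric[where f = "\<lambda>i x. norm (s i x)"])
    show "(\<lambda>x. norm (s i x)) \<in> borel_measurable M" for i
      by (rule borel_measurable_simple_function[OF simple_function_compose1[OF s(1)]])
  qed (auto intro!: tendsto_norm s)
qed

text \<open>One half of Pettis' theorem: the values lie in a separable set, the closure of the union
  of the finite ranges of the approximants.\<close>

lemma strongly_measurable_countable_range:
  assumes "strongly_measurable M f"
  obtains Q where "countable Q" "\<And>x. x \<in> space M \<Longrightarrow> f x \<in> closure Q"
proof -
  obtain s where s: "\<And>i. simple_function M (s i)" "\<And>x. x \<in> space M \<Longrightarrow> (\<lambda>i. s i x) \<longlonglongrightarrow> f x"
    using assms unfolding strongly_measurable_def by blast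
  show ?thesis
  proof
    show "countable (\<Union>i. s i ` space M)"
      using s(1) by (auto simp: simple_function_def intro: countable_finite)
    show "f x \<in> closure (\<Union>i. s i ` space M)" if "x \<in> space M" for x
      unfolding closure_sequential using that s(2)[OF that] by (intro exI[of _ "\<lambda>i. s i x"]) auto
  qed
qed

text \<open>The approximating simple functions pick the nearest of finitely many points of \<open>Q\<close>.\<close>

lemma strongly_measurableI_countable:
  fixes f :: "'v \<Rightarrow> 'a::real_normed_vector"
  assumes Q: "countable Q" "\<And>x. x \<in> space M \<Longrightarrow> f x \<in> closure Q"
    and meas: "\<And>y. y \<in> Q \<Longrightarrow> (\<lambda>x. norm (f x - y)) \<in> borel_measurable M"
  shows "strongly_measurable M f"
proof (cases "space M = {}")
  case True
  then show ?thesis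
    by (auto simp: strongly_measurable_def simple_function_def intro!: exI[of _ "\<lambda>_ _. 0"])
next
  case False
  then have "Q \<noteq> {}" using Q(2) by auto
  then obtain y :: "nat \<Rightarrow> 'a" where y: "range y = Q"
    using Q(1) by (metis uncountable_def)
  \<comment> \<open>Taking the least minimiser makes the choice of index measurable; bounding it by
    \<open>i\<close> leaves finitely many values.\<close>
  define near where "near i x = (LEAST j. j \<le> i \<and> (\<forall>k\<le>i. norm (f x - y j) \<le> norm (f x - y k)))" for i x
  have ex: "\<exists>j. j \<le> i \<and> (\<forall>k\<le>i. norm (f x - y j) \<le> norm (f x - y k))" for i x
    using ex_min_if_finite[of "(\<lambda>k. norm (f x - y k)) ` {..i}"] by (fastforce simp: not_less)
  have near: "near i x \<le> i \<and> (\<forall>k\<le>i. norm (f x - y (near i x)) \<le> norm (f x - y k))" for i x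
    unfolding near_def by (rule LeastI_ex[OF ex])
  have [measurable]: "(\<lambda>x. norm (f x - y j)) \<in> borel_measurable M" for j
    using meas y by auto
  have near_meas: "near i \<in> measurable M (count_space UNIV)" for i
    unfolding near_def by measurable
  have simp1: "simple_function M (\<lambda>x. y (near i x))" for i
  proof (rule simple_function_compose1[where f = "near i"])
    have "near i ` space M \<subseteq> {..i}" using near by auto
    then have "finite (near i ` space M)" by (rule finite_subset) simp
    moreover have "near i -` {a} \<inter> space M \<in> sets M" for a
      by (rule measurable_sets[OF near_meas]) simp
    ultimately show "simple_function M (near i)"
      by (auto simp: simple_function_def)
  qed
  have "(\<lambda>i. y (near i x)) \<longlonglongrightarrow> f x" if x: "x \<in> space M" for x
  proof (rule LIMSEQ_I)
    fix e :: real assume "0 < e"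
    then obtain z where "z \<in> Q" "norm (f x - z) < e"
      using Q(2)[OF x] by (metis closure_approachable dist_norm norm_minus_commute)
    then obtain k where k: "norm (f x - y k) < e" using y by auto
    have "norm (y (near n x) - f x) < e" if "k \<le> n" for n
      using near[of n x] that k by (metis le_less_trans norm_minus_commute)
    then show "\<exists>no. \<forall>n\<ge>no. norm (y (near n x) - f x) < e" by blast
  qed
  then show ?thesis
    unfolding strongly_measurable_def using simp1 by (intro exI[of _ "\<lambda>i x. y (near i x)"]) auto
qed

text \<open>Both conditions of \<open>strongly_measurableI_countable\<close> survive the limit:
  countably many countable sets have a countable union, and distances to a fixed point are limits of
  measurable functions.\<close>

lemma strongly_measurable_LIMSEQ:
  assumes f: "\<And>i. strongly_measurable M (f i)" and lim: "\<And>x. x \<in> space M \<Longrightarrow> (\<lambda>i. f i x) \<longlonglongrightarrow> g x"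
  shows "strongly_measurable M g"
proof -
  have "\<exists>Q. countable Q \<and> (\<forall>x\<in>space M. f i x \<in> closure Q)" for i
    using strongly_measurable_countable_range[OF f[of i]] by metis
  then obtain Q where Q: "\<And>i. countable (Q i)" "\<And>i x. x \<in> space M \<Longrightarrow> f i x \<in> closure (Q i)"
    by metis
  show ?thesis
  proof (rule strongly_measurableI_countable[where Q = "\<Union>i. Q i"])
    show "countable (\<Union>i. Q i)" using Q by auto
    fix x assume x: "x \<in> space M"
    have "f i x \<in> closure (\<Union>i. Q i)" for i
      using Q(2)[OF x, of i] closure_mono[of "Q i" "\<Union>i. Q i"] by blast
    then show "g x \<in> closure (\<Union>i. Q i)"
      using closed_sequentially[OF closed_closure _ lim[OF x]] by blast
  next
    fix y
    show "(\<lambda>x. norm (g x - y)) \<in> borel_measurable M"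
    proof (rule borel_measurable_LIMSEQ_metric[where f = "\<lambda>i x. norm (f i x - y)"])
      show "(\<lambda>x. norm (f i x - y)) \<in> borel_measurable M" for i
        by (intro borel_measurable_norm_strong strongly_measurable_diff f strongly_measurable_const)
    qed (auto intro!: tendsto_norm tendsto_diff lim)
  qed
qed

lemma strongly_measurable_iff_borel:
  fixes f :: "'v \<Rightarrow> 'a::{real_normed_vector, second_countable_topology}"
  shows "strongly_measurable M f \<longleftrightarrow> f \<in> borel_measurable M"
proof
  assume "strongly_measurable M f"
  then obtain s where s: "\<And>i. simple_function M (s i)" "\<And>x. x \<in> space M \<Longrightarrow> (\<lambda>i. s i x) \<longlonglongrightarrow> f x"
    unfolding strongly_measurable_def by blast
  from borel_measurable_simple_function[OF s(1)] s(2) show "f \<in> borel_measurable M"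
    by (rule borel_measurable_LIMSEQ_metric)
next
  assume [measurable]: "f \<in> borel_measurable M"
  obtain D :: "'a set" where D: "countable D" "\<And>X. open X \<Longrightarrow> X \<noteq> {} \<Longrightarrow> \<exists>d \<in> D. d \<in> X"
    using countable_dense_exists by blast
  have dense: "x \<in> closure D" for x
  proof (unfold closure_approachable, intro allI impI)
    fix e :: real assume "0 < e"
    then show "\<exists>y\<in>D. dist y x < e"
      using D(2)[of "ball x e"] by (auto simp: dist_commute)
  qed
  show "strongly_measurable M f"
    by (rule strongly_measurableI_countable[OF D(1) dense]) measurable
qed

text \<open>Continuity carries a countable dense set of the domain to a countable dense subset of
  the range, so the range is separable even if the target is not.\<close>

lemma strongly_measurable_continuous:
  fixes f :: "'e::euclidean_space \<Rightarrow> 'a::real_normed_vector"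
  assumes f: "continuous_on UNIV f"
  shows "strongly_measurable lborel f"
proof -
  obtain D :: "'e set" where D: "countable D" "\<And>X. open X \<Longrightarrow> X \<noteq> {} \<Longrightarrow> \<exists>d \<in> D. d \<in> X"
    using countable_dense_exists by blast
  have "x \<in> closure D" for x
    unfolding closure_approachable using D(2)[of "ball x _"] by (auto simp: dist_commute)
  then have "closure D = UNIV" by auto
  then have "f x \<in> closure (f ` D)" for x
    using image_closure_subset[of D f "closure (f ` D)"] f closure_subset
    by (metis UNIV_I closed_closure image_subset_iff)
  moreover have "(\<lambda>x. norm (f x - y)) \<in> borel_measurable borel" for y
    by (intro borel_measurable_continuous_onI continuous_intros f)
  ultimately show ?thesis
    using D(1) by (intro strongly_measurableI_countable[where Q = "f ` D"]) auto
qed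

lemma strongly_measurable_cong:
  "(\<And>x. x \<in> space M \<Longrightarrow> f x = g x) \<Longrightarrow> strongly_measurable M f \<longleftrightarrow> strongly_measurable M g"
  unfolding strongly_measurable_def by auto

lemma strongly_measurable_scaleR:
  "g \<in> borel_measurable M \<Longrightarrow> strongly_measurable M f \<Longrightarrow> strongly_measurable M (\<lambda>x. g x *\<^sub>R f x)"
  by (rule strongly_measurable_bilinear[OF bounded_bilinear_scaleR])
     (auto simp: strongly_measurable_iff_borel)

lemma strongly_measurable_If:
  assumes "strongly_measurable M f" "{x\<in>space M. P x} \<in> sets M"
  shows "strongly_measurable M (\<lambda>x. if P x then f x else 0)"
proof -
  have "strongly_measurable M (\<lambda>x. indicator {x\<in>space M. P x} x *\<^sub>R f x)"
    using assms by (intro strongly_measurable_scaleR) auto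
  then show ?thesis
    by (rule iffD1[OF strongly_measurable_cong, rotated]) (auto simp: indicator_def)
qed

lemma strongly_measurable_compose:
  assumes f: "strongly_measurable N f" and T: "T \<in> measurable M N"
  shows "strongly_measurable M (\<lambda>x. f (T x))"
proof -
  obtain s where s: "\<And>i. simple_function N (s i)" "\<And>x. x \<in> space N \<Longrightarrow> (\<lambda>i. s i x) \<longlonglongrightarrow> f x"
    using f unfolding strongly_measurable_def by blast
  have "simple_function M (\<lambda>x. s i (T x))" for i
    by (rule simple_function_comp[OF T s(1)])
  then show ?thesis
    unfolding strongly_measurable_def using s(2) measurable_space[OF T]
    by (intro exI[of _ "\<lambda>i x. s i (T x)"]) auto
qed

text \<open>Domination by a multiple of \<open>norm (f x)\<close> is what turns pointwise
  approximation into approximation in L^1 and L^p later on.\<close>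

lemma strongly_measurable_approx:
  fixes f :: "'v \<Rightarrow> 'a::real_normed_vector"
  assumes "strongly_measurable M f"
  obtains s where "\<And>i. simple_function M (s i)" "\<And>x. x \<in> space M \<Longrightarrow> (\<lambda>i. s i x) \<longlonglongrightarrow> f x"
    "\<And>i x. x \<in> space M \<Longrightarrow> norm (s i x) \<le> 4 * norm (f x)"
proof -
  obtain s where s: "\<And>i. simple_function M (s i)" "\<And>x. x \<in> space M \<Longrightarrow> (\<lambda>i. s i x) \<longlonglongrightarrow> f x"
    using assms unfolding strongly_measurable_def by blast
  have nf: "(\<lambda>x. norm (f x)) \<in> borel_measurable M" by (rule borel_measurable_norm_strong[OF assms])
  obtain u where u: "\<forall>i. simple_function M (u i)" "\<forall>x\<in>space M. (\<lambda>i. u i x) \<longlonglongrightarrow> norm (f x)"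
     "\<forall>i. \<forall>x\<in>space M. dist (u i x) 0 \<le> 2 * dist (norm (f x)) 0"
    using borel_measurable_implies_sequence_metric[OF nf, of 0] by blast
  \<comment> \<open>The modulus of \<open>u i x\<close> is at most twice \<open>norm (f x)\<close>,
    whence the factor 4. The threshold tends to twice \<open>norm (f x)\<close>, so the cut-off is
    eventually inactive where \<open>f x\<close> is nonzero, and it forces the value 0 where
    \<open>f x = 0\<close>.\<close>
  define s' where "s' i x = (if norm (s i x) \<le> 2 * u i x then s i x else 0)" for i x
  show ?thesis
  proof
    show "simple_function M (s' i)" for i
      unfolding s'_def
      by (rule simple_function_compose2[where h = "\<lambda>a b. if norm a \<le> 2 * b then a else 0"])
        (use s u in auto)
    fix x assume x: "x \<in> space M"
    show "norm (s' i x) \<le> 4 * norm (f x)" for i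
      using u(3)[rule_format, OF x, of i] by (auto simp: s'_def)
    show "(\<lambda>i. s' i x) \<longlonglongrightarrow> f x"
    proof (cases "f x = 0")
      case True
      then have "s' i x = 0" for i
        using u(3)[rule_format, OF x, of i] by (auto simp: s'_def)
      then show ?thesis using True by simp
    next
      case False
      have "(\<lambda>i. 2 * u i x - norm (s i x)) \<longlonglongrightarrow> 2 * norm (f x) - norm (f x)"
        by (intro tendsto_intros s x u(2)[rule_format])
      then have "\<forall>\<^sub>F i in sequentially. 0 < 2 * u i x - norm (s i x)"
        using False by (intro order_tendstoD(1)) auto
      then have "\<forall>\<^sub>F i in sequentially. s i x = s' i x"
        by eventually_elim (auto simp: s'_def)
      then show ?thesis by (rule Lim_transform_eventually[OF s(2)[OF x]])
    qed
  qed
qed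

section \<open>Norming functionals\<close>

text \<open>Partial real-linear functionals are represented by their graphs.\<close>

lemma norm_dominated_extension:
  fixes x0 :: "'a::real_normed_vector"
  shows "\<exists>f. linear f \<and> (\<forall>x. f x \<le> norm x) \<and> f x0 = norm x0"
proof -
  define good where "good G \<longleftrightarrow> subspace G \<and> (\<forall>z\<in>G. snd z \<le> norm (fst z))" for G :: "('a \<times> real) set"
  define A where "A = {G. good G \<and> (x0, norm x0) \<in> G}"
  have "\<exists>G\<in>A. \<forall>H\<in>A. G \<subseteq> H \<longrightarrow> H = G"
  proof (rule subset_Zorn_nonempty)
    have "good (span {(x0, norm x0)})"
      unfolding good_def by (intro conjI subspace_span) (auto simp: span_singleton mult_right_mono)
    then show "A \<noteq> {}"
      using span_base[of "(x0, norm x0)" "{(x0, norm x0)}"] unfolding A_def by blast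
  next
    fix C assume "C \<noteq> {}" and C: "subset.chain A C"
    then have CA: "C \<subseteq> A" and lin: "\<And>G H. G \<in> C \<Longrightarrow> H \<in> C \<Longrightarrow> G \<subseteq> H \<or> H \<subseteq> G"
      by (auto simp: subset_chain_def)
    have sub: "subspace G" if "G \<in> C" for G using that CA by (auto simp: A_def good_def)
    have "subspace (\<Union>C)"
    proof (rule subspaceI)
      show "0 \<in> \<Union>C" using \<open>C \<noteq> {}\<close> sub subspace_0 by blast
      show "x + y \<in> \<Union>C" if "x \<in> \<Union>C" "y \<in> \<Union>C" for x y
      proof -
        obtain G H where "G \<in> C" "x \<in> G" "H \<in> C" "y \<in> H" using \<open>x \<in> \<Union>C\<close> \<open>y \<in> \<Union>C\<close> by blast
        then show ?thesis using lin[of G H] subspace_add[OF sub, of _ x y] by blast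
      qed
      show "c *\<^sub>R x \<in> \<Union>C" if "x \<in> \<Union>C" for c x
        using that sub subspace_scale by blast
    qed
    then show "\<Union>C \<in> A"
      using CA \<open>C \<noteq> {}\<close> by (fastforce simp: A_def good_def)
  qed
  then obtain G where G: "good G" "(x0, norm x0) \<in> G" and max: "\<And>H. H \<in> A \<Longrightarrow> G \<subseteq> H \<Longrightarrow> H = G"
    unfolding A_def by blast
  have sub: "subspace G" and le: "\<And>x a. (x, a) \<in> G \<Longrightarrow> a \<le> norm x"
    using G(1) by (auto simp: good_def)
  have uniq: "a = b" if "(x, a) \<in> G" "(x, b) \<in> G" for x a b
    using subspace_diff[OF sub that] subspace_diff[OF sub that(2,1)] le[of 0 "a - b"] le[of 0 "b - a"]
    by simp
  have total: "\<exists>a. (z, a) \<in> G" for z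
  proof (rule ccontr)
    assume z: "\<nexists>a. (z, a) \<in> G"
    \<comment> \<open>Every lower bound for an admissible value at \<open>z\<close> lies below every
      upper bound: the triangle inequality for x + y = (x - z) + (y + z).\<close>
    have sep: "a - norm (x - z) \<le> norm (y + z) - b" if "(x, a) \<in> G" "(y, b) \<in> G" for x a y b
      using le[of "x + y" "a + b"] subspace_add[OF sub that] norm_triangle_ineq[of "x - z" "y + z"]
      by simp
    have G0: "(0, 0) \<in> G" using subspace_0[OF sub] by (metis zero_prod_def)
    \<comment> \<open>The smallest admissible value of an extension at \<open>z\<close>.\<close>
    define \<alpha> where "\<alpha> = (SUP w\<in>G. snd w - norm (fst w - z))"
    have bdd: "bdd_above ((\<lambda>w. snd w - norm (fst w - z)) ` G)"
      by (rule bdd_aboveI[of _ "norm z"]) (use sep[OF _ G0] in auto)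
    have lower: "a - norm (x - z) \<le> \<alpha>" if "(x, a) \<in> G" for x a
      unfolding \<alpha>_def using cSUP_upper[OF that bdd] by simp
    have upper: "\<alpha> \<le> norm (y + z) - b" if "(y, b) \<in> G" for y b
      unfolding \<alpha>_def by (rule cSUP_least) (use G0 sep[OF _ that] in auto)
    define H where "H = {w + t *\<^sub>R (z, \<alpha>) | w t. w \<in> G}"
    have "subspace H"
    proof (rule subspaceI)
      show "0 \<in> H" unfolding H_def using subspace_0[OF sub] by (intro CollectI exI[of _ 0] exI[of _ "0::real"]) (simp add: zero_prod_def)
      show "u + v \<in> H" if "u \<in> H" "v \<in> H" for u v
      proof -
        obtain w t w' t' where "u = w + t *\<^sub>R (z, \<alpha>)" "w \<in> G" "v = w' + t' *\<^sub>R (z, \<alpha>)" "w' \<in> G"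
          using \<open>u \<in> H\<close> \<open>v \<in> H\<close> unfolding H_def by auto
        then have "u + v = (w + w') + (t + t') *\<^sub>R (z, \<alpha>)" "w + w' \<in> G"
          by (auto simp: scaleR_add_left algebra_simps intro: subspace_add[OF sub])
        then show ?thesis unfolding H_def by blast
      qed
      show "c *\<^sub>R u \<in> H" if "u \<in> H" for c u
      proof -
        obtain w t where "u = w + t *\<^sub>R (z, \<alpha>)" "w \<in> G"
          using \<open>u \<in> H\<close> unfolding H_def by auto
        then have "c *\<^sub>R u = c *\<^sub>R w + (c * t) *\<^sub>R (z, \<alpha>)" "c *\<^sub>R w \<in> G"
          by (auto simp: scaleR_add_right intro: subspace_scale[OF sub])
        then show ?thesis unfolding H_def by blast
      qed
    qed
    moreover have "a + t * \<alpha> \<le> norm (x + t *\<^sub>R z)" if xa: "(x, a) \<in> G" for x a t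
    \<comment> \<open>Dividing by the modulus of \<open>t\<close> reduces to the coefficients 1 and
      -1, which are covered by \<open>upper\<close> and \<open>lower\<close>.\<close>
    proof (cases t "0 :: real" rule: linorder_cases)
      case equal then show ?thesis using le[OF xa] by simp
    next
      case greater
      have "(inverse t *\<^sub>R x, inverse t * a) \<in> G" using subspace_scale[OF sub xa, of "inverse t"] by simp
      from mult_left_mono[OF upper[OF this], of t] greater
      have "t * \<alpha> \<le> norm (t *\<^sub>R (inverse t *\<^sub>R x + z)) - a"
        by (simp add: right_diff_distrib mult.assoc[symmetric])
      also have "t *\<^sub>R (inverse t *\<^sub>R x + z) = x + t *\<^sub>R z" using greater by (simp add: scaleR_add_right)
      finally show ?thesis by simp
    next
      case less
      have "(inverse (- t) *\<^sub>R x, inverse (- t) * a) \<in> G"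
        using subspace_scale[OF sub xa, of "inverse (- t)"] by (simp only: scaleR_Pair real_scaleR_def)
      from mult_left_mono[OF lower[OF this], of "- t"] less
      have "a - norm ((- t) *\<^sub>R (inverse (- t) *\<^sub>R x - z)) \<le> - t * \<alpha>"
        unfolding norm_scaleR by (simp add: right_diff_distrib mult.assoc[symmetric])
      also have "(- t) *\<^sub>R (inverse (- t) *\<^sub>R x - z) = x + t *\<^sub>R z" using less by (simp add: scaleR_diff_right)
      finally show ?thesis by simp
    qed
    ultimately have "good H" unfolding good_def H_def by auto
    moreover have GH: "G \<subseteq> H"
    proof
      fix w assume "w \<in> G"
      then show "w \<in> H" unfolding H_def by (intro CollectI exI[of _ w] exI[of _ 0]) (simp add: zero_prod_def)
    qed
    ultimately have "H = G" using max[of H] G(2) by (auto simp: A_def)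
    moreover have "(z, \<alpha>) \<in> H"
      unfolding H_def using G0 by (intro CollectI exI[of _ "(0, 0)"] exI[of _ 1]) simp
    ultimately show False using z by blast
  qed
  define f where "f x = (THE a. (x, a) \<in> G)" for x
  have f: "(x, f x) \<in> G" for x
    unfolding f_def using total[of x] uniq by (auto intro: theI2)
  have "linear f"
  proof (rule linearI)
    show "f (x + y) = f x + f y" for x y
      using uniq[OF f subspace_add[OF sub f f, unfolded add_Pair]] .
    show "f (c *\<^sub>R x) = c *\<^sub>R f x" for c x
      using uniq[OF f subspace_scale[OF sub f, unfolded scaleR_Pair]] .
  qed
  moreover have "f x0 = norm x0" using uniq[OF f G(2)] .
  ultimately show ?thesis using le[OF f] by blast
qed

section \<open>Complex-linear operators and complex norming functionals\<close>

lemma clinop_apply_simps: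
  "clinop_apply (f + g) x = clinop_apply f x + clinop_apply g x"
  "clinop_apply (r *\<^sub>R f) x = r *\<^sub>R clinop_apply f x"
  "clinop_apply (c *\<^sub>C f) x = c *\<^sub>C clinop_apply f x"
  "clinop_apply 0 x = 0"
  "clinop_apply f (x + y) = clinop_apply f x + clinop_apply f y"
  "clinop_apply f (r *\<^sub>R x) = r *\<^sub>R clinop_apply f x"
  "clinop_apply f 0 = 0"
  by (rule clinop_apply_scaleC
      | simp add: clinop_apply.rep_eq plus_clinop.rep_eq scaleR_clinop.rep_eq zero_clinop.rep_eq
        blinfun.bilinear_simps)+

lemma clinop_apply_scaleC_right: "clinop_apply f (c *\<^sub>C x) = c *\<^sub>C clinop_apply f x"
  using blinfun_of_clinop[of f] by (simp add: clinop_apply.rep_eq)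

lemma norm_clinop_apply_le: "norm (clinop_apply f x) \<le> norm f * norm x"
  by (simp add: clinop_apply.rep_eq norm_clinop.rep_eq norm_blinfun)

lemma bounded_bilinear_clinop_apply: "bounded_bilinear clinop_apply"
  by (rule bounded_bilinear.intro)
     (auto simp: clinop_apply_simps intro!: exI[of _ 1] order_trans[OF norm_clinop_apply_le])

lemma bounded_linear_clinop_apply: "bounded_linear (clinop_apply f)"
  by (rule bounded_bilinear.bounded_linear_right[OF bounded_bilinear_clinop_apply])

lemma scaleC_1 [simp]: "1 *\<^sub>C x = (x :: 'a::complex_banach)"
  using scaleR_scaleC[of 1 x] by simp

lemma scaleC_0_left [simp]: "0 *\<^sub>C x = (0 :: 'a::complex_banach)"
  using scaleR_scaleC[of 0 x] by simp

lemma bounded_bilinear_scaleC: "bounded_bilinear (*\<^sub>C)"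
  by (rule bounded_bilinear.intro)
     (auto simp: scaleC_add_left scaleC_add_right scaleC_scaleR_commute norm_scaleC
       scaleR_scaleC scaleC_scaleC scaleR_conv_of_real scaleC_complex_def mult.commute intro!: exI[of _ 1])

lemma clinop_make:
  assumes add: "\<And>x y. f (x + y) = f x + f y" and scale: "\<And>c x. f (c *\<^sub>C x) = c *\<^sub>C f x"
    and bound: "\<And>x. norm (f x) \<le> K * norm x" and K: "0 \<le> K"
  obtains F where "\<And>x. clinop_apply F x = f x" "norm F \<le> K"
proof -
  have bl: "bounded_linear f"
    by (rule bounded_linear_intro[where K = K]) (use assms in \<open>auto simp: scaleR_scaleC mult.commute\<close>)
  define F where "F = Abs_clinop (Blinfun f)"
  have F: "blinfun_of_clinop F = Blinfun f"
    unfolding F_def by (rule Abs_clinop_inverse) (simp add: bounded_linear_Blinfun_apply[OF bl] scale)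
  show ?thesis
  proof
    show "clinop_apply F x = f x" for x
      by (simp add: clinop_apply.rep_eq F bounded_linear_Blinfun_apply[OF bl])
    show "norm F \<le> K"
      unfolding norm_clinop.rep_eq F
      by (intro norm_blinfun_bound) (simp_all add: K bound bounded_linear_Blinfun_apply[OF bl])
  qed
qed

text \<open>A complex functional is determined by its real part f through f(x) - i f(ix). Rotating x
  by a phase makes the value real, so the real bound passes to the modulus.\<close>

theorem norming_functional:
  fixes x0 :: "'a::complex_banach"
  obtains F :: "'a cdual" where "norm F \<le> 1" "clinop_apply F x0 = of_real (norm x0)"
proof -
  obtain f where lin: "linear f" and le: "\<And>x. f x \<le> norm x" and x0: "f x0 = norm x0"
    using norm_dominated_extension[of x0] by blast
  define g where "g x = Complex (f x) (- f (\<i> *\<^sub>C x))" for x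
  have f_scale: "f (c *\<^sub>C x) = Re c * f x + Im c * f (\<i> *\<^sub>C x)" for c x
  proof -
    have "c *\<^sub>C x = Re c *\<^sub>R x + Im c *\<^sub>R (\<i> *\<^sub>C x)"
      by (simp add: scaleR_scaleC scaleC_scaleC scaleC_add_left[symmetric] complex_eq[symmetric] mult.commute[of _ \<i>])
    then show ?thesis by (simp add: linear_add[OF lin] linear_scale[OF lin])
  qed
  have g_scale: "g (c *\<^sub>C x) = c *\<^sub>C g x" for c x
    using f_scale[of c x] f_scale[of "\<i> * c" x]
    by (simp add: g_def scaleC_scaleC scaleC_complex_def complex_eq_iff algebra_simps)
  have bound: "norm (g x) \<le> 1 * norm x" for x
  proof (cases "g x = 0")
    case False
    \<comment> \<open>The unimodular factor that rotates \<open>g x\<close> onto the positive axis,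
      where \<open>g\<close> agrees with \<open>f\<close>.\<close>
    define c where "c = cnj (g x) / norm (g x)"
    have "g (c *\<^sub>C x) = of_real (norm (g x))"
      using False
      by (simp add: g_scale c_def scaleC_complex_def mult.commute complex_norm_square[symmetric] power2_eq_square)
    then have "norm (g x) = f (c *\<^sub>C x)" by (simp add: g_def complex_eq_iff)
    also have "\<dots> \<le> norm x"
      using le[of "c *\<^sub>C x"] False by (simp add: norm_scaleC c_def norm_divide)
    finally show ?thesis by simp
  qed simp
  have "g (x + y) = g x + g y" for x y
    by (simp add: g_def scaleC_add_right linear_add[OF lin] complex_eq_iff)
  from clinop_make[OF this g_scale bound] obtain F where
    F: "\<And>x. clinop_apply F x = g x" "norm F \<le> 1" by auto
  \<comment> \<open>The real part already exhausts the modulus allowed by \<open>bound\<close>, so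
    the imaginary part vanishes.\<close>
  have "Re (g x0) = norm x0" by (simp add: g_def x0)
  moreover have "norm (g x0) \<le> norm x0" using bound by simp
  ultimately have "g x0 = of_real (norm x0)"
    using abs_Re_le_cmod[of "g x0"] cmod_power2[of "g x0"]
    by (auto simp: complex_eq_iff)
  then show ?thesis using F by (intro that[of F]) auto
qed

section \<open>The strong integral\<close>

text \<open>Dominated approximants converge in L^1, hence their integrals form a Cauchy sequence,
  and the target is complete.\<close>

lemma simple_bochner_integral_tendsto:
  fixes f :: "'v \<Rightarrow> 'a::banach"
  assumes f: "strongly_measurable M f" "integrable M (\<lambda>x. norm (f x))"
  shows "\<exists>s I. (\<forall>i. Bochner_Integration.simple_bochner_integrable M (s i)) \<and>
          (\<lambda>i. \<integral>\<^sup>+x. ennreal (norm (f x - s i x)) \<partial>M) \<longlonglongrightarrow> 0 \<and>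
          (\<lambda>i. Bochner_Integration.simple_bochner_integral M (s i)) \<longlonglongrightarrow> I"
proof -
  obtain s where s: "\<And>i. simple_function M (s i)" "\<And>x. x \<in> space M \<Longrightarrow> (\<lambda>i. s i x) \<longlonglongrightarrow> f x"
    and bd: "\<And>i x. x \<in> space M \<Longrightarrow> norm (s i x) \<le> 4 * norm (f x)"
    using strongly_measurable_approx[OF f(1)] by metis
  have sm: "strongly_measurable M (s i)" for i by (rule strongly_measurable_simple[OF s(1)])
  have [measurable]: "(\<lambda>x. norm (f x - s i x)) \<in> borel_measurable M"
    "(\<lambda>x. norm (s i x - s j x)) \<in> borel_measurable M" "(\<lambda>x. norm (s i x)) \<in> borel_measurable M" for i j
    by (intro borel_measurable_norm_strong strongly_measurable_diff f sm)+
  have bd': "norm (f x - s i x) \<le> 5 * norm (f x)" if "x \<in> space M" for i x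
    using norm_triangle_ineq4[of "f x" "s i x"] bd[OF that, of i] by simp
  have int5: "integrable M (\<lambda>x. 5 * norm (f x))" using f(2) by simp
  have int_d: "integrable M (\<lambda>x. norm (f x - s i x))" for i
    by (rule Bochner_Integration.integrable_bound[OF int5]) (use bd' in auto)
  have int_s: "integrable M (\<lambda>x. norm (s i x))" for i
    by (rule Bochner_Integration.integrable_bound[OF int5]) (use bd in \<open>auto intro!: AE_I2 order_trans[OF bd]\<close>)
  have lim: "(\<lambda>i. \<integral>x. norm (f x - s i x) \<partial>M) \<longlonglongrightarrow> (\<integral>x. 0 \<partial>M)"
  proof (rule integral_dominated_convergence[OF _ _ int5])
    show "AE x in M. (\<lambda>i. norm (f x - s i x)) \<longlonglongrightarrow> 0"
    proof (rule AE_I2)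
      fix x assume "x \<in> space M"
      from tendsto_norm[OF tendsto_diff[OF tendsto_const s(2)[OF this], of "f x"]]
      show "(\<lambda>i. norm (f x - s i x)) \<longlonglongrightarrow> 0" by simp
    qed
  qed (use bd' in auto)
  have lim': "(\<lambda>i. \<integral>\<^sup>+x. ennreal (norm (f x - s i x)) \<partial>M) \<longlonglongrightarrow> 0"
    using tendsto_ennrealI[OF lim] by (subst nn_integral_eq_integral[OF int_d]) auto
  have sbi: "Bochner_Integration.simple_bochner_integrable M (s i)" for i
    using int_s[of i] by (intro simple_bochner_integrableI_bounded s) (simp add: integrable_iff_bounded)
  have "Cauchy (\<lambda>i. Bochner_Integration.simple_bochner_integral M (s i))"
  proof (rule metric_CauchyI)
    fix e :: real assume "0 < e"
    then obtain N where N: "\<And>n. n \<ge> N \<Longrightarrow> (\<integral>x. norm (f x - s n x) \<partial>M) < e / 2"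
      using order_tendstoD(2)[OF lim, of "e / 2"] by (auto simp: eventually_sequentially)
    show "\<exists>N. \<forall>m\<ge>N. \<forall>n\<ge>N. dist (Bochner_Integration.simple_bochner_integral M (s m))
            (Bochner_Integration.simple_bochner_integral M (s n)) < e"
    proof (intro exI[of _ N] allI impI)
      fix m n assume mn: "m \<ge> N" "n \<ge> N"
      have sd: "Bochner_Integration.simple_bochner_integrable M (\<lambda>x. s m x - s n x)"
        by (rule simple_bochner_integrable_compose2[OF _ sbi sbi]) simp
      have sd': "Bochner_Integration.simple_bochner_integrable M (\<lambda>x. norm (s m x - s n x))"
        by (rule simple_bochner_integrable_compose2[OF _ sbi sbi]) simp
      have "dist (Bochner_Integration.simple_bochner_integral M (s m))
            (Bochner_Integration.simple_bochner_integral M (s n))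
          \<le> Bochner_Integration.simple_bochner_integral M (\<lambda>x. norm (s m x - s n x))"
        unfolding dist_norm simple_bochner_integral_diff[OF sbi sbi, symmetric]
        by (rule simple_bochner_integral_norm_bound[OF sd])
      also have "\<dots> = (\<integral>x. norm (s m x - s n x) \<partial>M)"
        using has_bochner_integral_simple_bochner_integrable[OF sd'] by (simp add: has_bochner_integral_integral_eq)
      also have "\<dots> \<le> (\<integral>x. norm (f x - s m x) + norm (f x - s n x) \<partial>M)"
      proof (rule integral_mono)
        show "integrable M (\<lambda>x. norm (s m x - s n x))"
          using has_bochner_integral_simple_bochner_integrable[OF sd'] by (auto simp: integrable.simps)
        show "norm (s m x - s n x) \<le> norm (f x - s m x) + norm (f x - s n x)" for x
          by (metis add.commute norm_diff_triangle_ineq norm_minus_commute order_refl norm_diff_triangle_le)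
      qed (intro Bochner_Integration.integrable_add int_d)
      also have "\<dots> < e"
        using N[OF mn(1)] N[OF mn(2)] by (simp add: int_d)
      finally show "dist (Bochner_Integration.simple_bochner_integral M (s m))
            (Bochner_Integration.simple_bochner_integral M (s n)) < e" .
    qed
  qed
  then obtain I where "(\<lambda>i. Bochner_Integration.simple_bochner_integral M (s i)) \<longlonglongrightarrow> I"
    using Cauchy_convergent convergent_def by blast
  then show ?thesis using sbi lim' by blast
qed

text \<open>Guarantees that \<open>strong_integral\<close> is a genuine integral and not its default
  value 0.\<close>

definition strongly_integrable :: "'v measure \<Rightarrow> ('v \<Rightarrow> 'a::real_normed_vector) \<Rightarrow> bool" where
  "strongly_integrable M f \<longleftrightarrow> strongly_measurable M f \<and> integrable M (\<lambda>x. norm (f x))"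

lemma has_strong_integral_complex_iff:
  "has_strong_integral M f (I :: complex) \<longleftrightarrow> has_bochner_integral M f I"
  unfolding has_strong_integral_def has_bochner_integral.simps strongly_measurable_iff_borel by blast

lemma strongly_integrable_complex_iff:
  "strongly_integrable M (f :: _ \<Rightarrow> complex) \<longleftrightarrow> integrable M f"
  unfolding strongly_integrable_def strongly_measurable_iff_borel
  by (metis borel_measurable_integrable integrable_norm integrable_norm_cancel)

lemma has_strong_integral_bounded_linear:
  assumes T: "bounded_linear T" and f: "has_strong_integral M f I"
  shows "has_strong_integral M (\<lambda>x. T (f x)) (T I)"
proof -
  interpret T: bounded_linear T by fact
  obtain s where fm: "strongly_measurable M f"
    and s: "\<And>i. Bochner_Integration.simple_bochner_integrable M (s i)"
    and f_s: "(\<lambda>i. \<integral>\<^sup>+x. ennreal (norm (f x - s i x)) \<partial>M) \<longlonglongrightarrow> 0"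
    and I: "(\<lambda>i. Bochner_Integration.simple_bochner_integral M (s i)) \<longlonglongrightarrow> I"
    using f unfolding has_strong_integral_def by blast
  have sm: "strongly_measurable M (s i)" for i
    using s[of i] by (auto intro: strongly_measurable_simple elim: simple_bochner_integrable.cases)
  have [measurable]: "(\<lambda>x. norm (f x - s i x)) \<in> borel_measurable M" for i
    by (intro borel_measurable_norm_strong strongly_measurable_diff fm sm)
  obtain K where K: "K > 0" "\<And>x i. norm (T (f x) - T (s i x)) \<le> norm (f x - s i x) * K"
    using T.pos_bounded by (auto simp: T.diff[symmetric])
  have "(\<lambda>i. \<integral>\<^sup>+x. ennreal (norm (T (f x) - T (s i x))) \<partial>M) \<longlonglongrightarrow> 0"
  proof (rule tendsto_sandwich[where f = "\<lambda>_. 0"])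
    show "eventually (\<lambda>i. (\<integral>\<^sup>+x. ennreal (norm (T (f x) - T (s i x))) \<partial>M)
        \<le> K * (\<integral>\<^sup>+ x. norm (f x - s i x) \<partial>M)) sequentially"
    proof (intro always_eventually allI)
      fix i
      have "(\<integral>\<^sup>+x. ennreal (norm (T (f x) - T (s i x))) \<partial>M) \<le> (\<integral>\<^sup>+ x. ennreal K * norm (f x - s i x) \<partial>M)"
        using K by (intro nn_integral_mono) (auto simp: ac_simps ennreal_mult[symmetric])
      also have "\<dots> = K * (\<integral>\<^sup>+ x. norm (f x - s i x) \<partial>M)"
        using K by (intro nn_integral_cmult) auto
      finally show "(\<integral>\<^sup>+x. ennreal (norm (T (f x) - T (s i x))) \<partial>M)
        \<le> K * (\<integral>\<^sup>+ x. norm (f x - s i x) \<partial>M)" .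
    qed
    show "(\<lambda>i. K * (\<integral>\<^sup>+ x. norm (f x - s i x) \<partial>M)) \<longlonglongrightarrow> 0"
      using ennreal_tendsto_cmult[OF _ f_s] by simp
  qed auto
  moreover have "Bochner_Integration.simple_bochner_integrable M (\<lambda>x. T (s i x))" for i
    using simple_bochner_integrable_compose2[of "\<lambda>a b. T a" M "s i" "s i"] s T.zero by simp
  moreover have "(\<lambda>i. Bochner_Integration.simple_bochner_integral M (\<lambda>x. T (s i x))) \<longlonglongrightarrow> T I"
    using T.tendsto[OF I] s by (simp add: simple_bochner_integral_linear T.linear_axioms)
  moreover have "strongly_measurable M (\<lambda>x. T (f x))"
    by (rule strongly_measurable_compose1[OF fm T.continuous_on[OF continuous_on_id]])
  ultimately show ?thesis
    unfolding has_strong_integral_def by (intro conjI exI[of _ "\<lambda>i x. T (s i x)"]) auto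
qed

text \<open>The device by which identities between vector integrals become identities between scalar
  ones: under a functional, \<open>strong_integral\<close> turns into the ordinary integral of a
  complex function.\<close>

lemma cdual_eqI:
  fixes x y :: "'a::complex_banach"
  assumes "\<And>F :: 'a cdual. clinop_apply F x = clinop_apply F y"
  shows "x = y"
proof -
  obtain F :: "'a cdual" where "clinop_apply F (x - y) = of_real (norm (x - y))"
    using norming_functional by blast
  then show ?thesis
    using assms[of F] bounded_linear.linear[OF bounded_linear_clinop_apply, of F]
    by (simp add: linear_diff)
qed

text \<open>Gives the definite description in \<open>strong_integral\<close> its meaning. Every
  functional maps a strong integral to the scalar Bochner integral, which is unique.\<close>

lemma has_strong_integral_unique:
  fixes I J :: "'a::complex_banach"
  assumes "has_strong_integral M f I" "has_strong_integral M f J"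
  shows "I = J"
proof (rule cdual_eqI)
  fix F :: "'a cdual"
  show "clinop_apply F I = clinop_apply F J"
    using assms[THEN has_strong_integral_bounded_linear[OF bounded_linear_clinop_apply, of _ _ _ F]]
    by (auto simp: has_strong_integral_complex_iff intro: has_bochner_integral_eq)
qed

lemma strong_integral_eqI:
  fixes I :: "'a::complex_banach"
  assumes "has_strong_integral M f I"
  shows "strong_integral M f = I"
  unfolding strong_integral_def using assms has_strong_integral_unique by (metis the_equality)

lemma has_strong_integral_strong_integral:
  fixes f :: "'v \<Rightarrow> 'a::complex_banach"
  assumes "strongly_integrable M f"
  shows "has_strong_integral M f (strong_integral M f)"
proof -
  have "\<exists>I. has_strong_integral M f I"
    using assms simple_bochner_integral_tendsto[of M f]
    unfolding has_strong_integral_def strongly_integrable_def by blast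
  then show ?thesis using strong_integral_eqI by metis
qed

lemma strong_integral_complex:
  assumes "integrable M (f :: _ \<Rightarrow> complex)"
  shows "strong_integral M f = (\<integral>x. f x \<partial>M)"
  by (rule strong_integral_eqI)
     (simp add: has_strong_integral_complex_iff has_bochner_integral_integrable assms)

lemma strongly_integrable_bounded_linear:
  assumes T: "bounded_linear T" and f: "strongly_integrable M f"
  shows "strongly_integrable M (\<lambda>x. T (f x))"
proof -
  have sm: "strongly_measurable M (\<lambda>x. T (f x))"
    using f strongly_measurable_compose1 bounded_linear.continuous_on[OF T continuous_on_id]
    unfolding strongly_integrable_def by blast
  obtain K where K: "\<And>x. norm (T x) \<le> norm x * K" "K > 0"
    using bounded_linear.pos_bounded[OF T] by blast
  have "integrable M (\<lambda>x. norm (T (f x)))"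
    by (rule Bochner_Integration.integrable_bound[where f = "\<lambda>x. norm (f x) * K"])
      (use f K in \<open>auto simp: strongly_integrable_def intro!: borel_measurable_norm_strong sm order_trans[OF K(1)]\<close>)
  with sm show ?thesis by (simp add: strongly_integrable_def)
qed

lemma strong_integral_bounded_linear:
  fixes f :: "'v \<Rightarrow> 'a::complex_banach" and T :: "'a \<Rightarrow> 'b::complex_banach"
  assumes T: "bounded_linear T" and f: "strongly_integrable M f"
  shows "T (strong_integral M f) = strong_integral M (\<lambda>x. T (f x))"
  using strong_integral_eqI[OF has_strong_integral_bounded_linear[OF T has_strong_integral_strong_integral[OF f]]]
  by simp

lemma integrable_clinop_apply:
  assumes "strongly_integrable M f"
  shows "integrable M (\<lambda>x. clinop_apply (F :: 'a::complex_banach cdual) (f x))"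
  using strongly_integrable_bounded_linear[OF bounded_linear_clinop_apply assms, of F]
  by (simp add: strongly_integrable_complex_iff)

lemma clinop_apply_strong_integral:
  assumes f: "strongly_integrable M f"
  shows "clinop_apply (F :: 'a::complex_banach cdual) (strong_integral M f) = (\<integral>x. clinop_apply F (f x) \<partial>M)"
  using strong_integral_bounded_linear[OF bounded_linear_clinop_apply f, of F] integrable_clinop_apply[OF f, of F]
  by (simp add: strong_integral_complex)

text \<open>A functional norming the integral reduces the claim to the scalar inequality.\<close>

lemma norm_strong_integral_le:
  fixes f :: "'v \<Rightarrow> 'a::complex_banach"
  assumes f: "strongly_integrable M f"
  shows "norm (strong_integral M f) \<le> (\<integral>x. norm (f x) \<partial>M)"
proof -
  obtain F :: "'a cdual" where F: "norm F \<le> 1"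
    "clinop_apply F (strong_integral M f) = of_real (norm (strong_integral M f))"
    using norming_functional by blast
  have "norm (strong_integral M f) = norm (\<integral>x. clinop_apply F (f x) \<partial>M)"
    using F(2) clinop_apply_strong_integral[OF f, of F] by (metis norm_of_real abs_norm_cancel)
  also have "\<dots> \<le> (\<integral>x. norm (clinop_apply F (f x)) \<partial>M)"
    by (rule integral_norm_bound)
  also have "\<dots> \<le> (\<integral>x. norm (f x) \<partial>M)"
  proof (rule integral_mono)
    show "integrable M (\<lambda>x. norm (clinop_apply F (f x)))"
      using integrable_clinop_apply[OF f] by (rule integrable_norm)
    show "integrable M (\<lambda>x. norm (f x))" using f by (simp add: strongly_integrable_def)
    show "norm (clinop_apply F (f x)) \<le> norm (f x)" for x
      using norm_clinop_apply_le[of F "f x"] mult_right_mono[OF F(1), of "norm (f x)"] by simp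
  qed
  finally show ?thesis .
qed

lemma strongly_integrable_add:
  assumes f: "strongly_integrable M f" and g: "strongly_integrable M g"
  shows "strongly_integrable M (\<lambda>x. f x + g x)"
proof -
  have sm: "strongly_measurable M (\<lambda>x. f x + g x)"
    using f g by (auto simp: strongly_integrable_def intro: strongly_measurable_add)
  have "integrable M (\<lambda>x. norm (f x) + norm (g x))"
    using f g by (auto simp: strongly_integrable_def)
  then have "integrable M (\<lambda>x. norm (f x + g x))"
    by (rule Bochner_Integration.integrable_bound)
       (auto intro!: borel_measurable_norm_strong sm norm_triangle_ineq AE_I2 simp: abs_of_nonneg)
  with sm show ?thesis by (simp add: strongly_integrable_def)
qed

lemma strongly_integrable_bound:
  assumes "strongly_measurable M f" "integrable M g" "\<And>x. x \<in> space M \<Longrightarrow> norm (f x) \<le> g x"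
  shows "strongly_integrable M f"
  unfolding strongly_integrable_def
proof
  show "integrable M (\<lambda>x. norm (f x))"
    by (rule Bochner_Integration.integrable_bound[OF assms(2) borel_measurable_norm_strong[OF assms(1)]], rule AE_I2)
       (use assms(3) in \<open>force intro: order_trans[OF _ abs_ge_self]\<close>)
qed fact

lemma strong_integral_add:
  fixes f g :: "'v \<Rightarrow> 'a::complex_banach"
  assumes f: "strongly_integrable M f" and g: "strongly_integrable M g"
  shows "strong_integral M (\<lambda>x. f x + g x) = strong_integral M f + strong_integral M g"
proof (rule cdual_eqI)
  fix F :: "'a cdual"
  show "clinop_apply F (strong_integral M (\<lambda>x. f x + g x)) = clinop_apply F (strong_integral M f + strong_integral M g)"
    by (simp add: clinop_apply_strong_integral strongly_integrable_add f g clinop_apply_simps integrable_clinop_apply)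
qed

section \<open>The Fourier transform of integrable functions\<close>

lemma exp_eq_cis:
  "exp (- 2 * of_real pi * \<i> * of_real s) = cis (- (2 * pi * s))"
  "exp (2 * of_real pi * \<i> * of_real s) = cis (2 * pi * s)"
  by (simp_all add: cis_conv_exp mult_ac)

lemma fourier_eq: "fourier f \<xi> = strong_integral lborel (\<lambda>t. cis (- (2 * pi * (\<xi> \<bullet> t))) *\<^sub>C f t)"
  unfolding fourier_def exp_eq_cis ..

lemma inverse_fourier_eq: "inverse_fourier f \<xi> = fourier f (- \<xi>)"
  unfolding inverse_fourier_def fourier_eq exp_eq_cis by simp

lemma strongly_measurable_scaleC:
  "g \<in> borel_measurable M \<Longrightarrow> strongly_measurable M f \<Longrightarrow> strongly_measurable M (\<lambda>x. g x *\<^sub>C f x)"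
  by (rule strongly_measurable_bilinear[OF bounded_bilinear_scaleC])
     (auto simp: strongly_measurable_iff_borel)

lemma cis_measurable [measurable]: "cis \<in> borel_measurable borel"
  by (intro borel_measurable_continuous_onI continuous_intros)

lemma strongly_integrable_character:
  assumes "strongly_integrable lborel f"
  shows "strongly_integrable lborel (\<lambda>t. cis (- (2 * pi * (\<xi> \<bullet> t))) *\<^sub>C f t)"
  using assms unfolding strongly_integrable_def
  by (auto intro!: strongly_measurable_scaleC simp: norm_scaleC)

lemma fourier_add:
  assumes "strongly_integrable lborel f" "strongly_integrable lborel g"
  shows "fourier (\<lambda>t. f t + g t) \<xi> = fourier f \<xi> + fourier g \<xi>"
  unfolding fourier_eq scaleC_add_right
  by (rule strong_integral_add[OF assms[THEN strongly_integrable_character]])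

lemma fourier_bounded_linear:
  fixes T :: "'a::complex_banach \<Rightarrow> 'b::complex_banach"
  assumes T: "bounded_linear T" "\<And>c x. T (c *\<^sub>C x) = c *\<^sub>C T x" and f: "strongly_integrable lborel f"
  shows "fourier (\<lambda>t. T (f t)) \<xi> = T (fourier f \<xi>)"
  unfolding fourier_eq T(2)[symmetric]
  by (rule strong_integral_bounded_linear[OF T(1) strongly_integrable_character[OF f], symmetric])

lemma norm_fourier_le:
  assumes "strongly_integrable lborel f"
  shows "norm (fourier f \<xi>) \<le> (LBINT t. norm (f t))"
  unfolding fourier_eq
  using norm_strong_integral_le[OF strongly_integrable_character[OF assms]] by (simp add: norm_scaleC)

lemma strongly_integrable_scaleR:
  assumes "strongly_integrable M f" shows "strongly_integrable M (\<lambda>x. c *\<^sub>R f x)"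
  by (rule strongly_integrable_bounded_linear[OF bounded_linear_scaleR_right assms])

lemma strongly_integrable_scaleC:
  assumes "strongly_integrable M f" shows "strongly_integrable M (\<lambda>x. c *\<^sub>C f x)"
  by (rule strongly_integrable_bounded_linear[OF bounded_linear_scaleC_right assms])

lemma strongly_integrable_diff:
  assumes "strongly_integrable M f" "strongly_integrable M g"
  shows "strongly_integrable M (\<lambda>x. f x - g x)"
  using strongly_integrable_add[OF assms(1) strongly_integrable_scaleR[OF assms(2), of "-1"]] by simp

lemma fourier_scaleC:
  assumes "strongly_integrable lborel f"
  shows "fourier (\<lambda>t. c *\<^sub>C f t) \<xi> = c *\<^sub>C fourier f \<xi>"
  by (rule fourier_bounded_linear[OF bounded_linear_scaleC_right _ assms])
     (simp add: scaleC_scaleC mult.commute)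

lemma fourier_diff:
  assumes "strongly_integrable lborel f" "strongly_integrable lborel g"
  shows "fourier (\<lambda>t. f t - g t) \<xi> = fourier f \<xi> - fourier g \<xi>"
proof -
  have [simp]: "(-1) *\<^sub>C x = - x" for x :: 'b using scaleR_scaleC[of "-1" x] by simp
  show ?thesis
    using fourier_add[OF assms(1) strongly_integrable_scaleC[OF assms(2), of "-1"], of \<xi>]
      fourier_scaleC[OF assms(2), of "-1" \<xi>] by simp
qed

text \<open>Serves to make the transform strongly measurable in an arbitrary target, through
  \<open>strongly_measurable_continuous\<close>.\<close>

lemma continuous_on_fourier:
  fixes f :: "real^'n::finite \<Rightarrow> 'a::complex_banach"
  assumes f: "strongly_integrable lborel f"
  shows "continuous_on UNIV (fourier f)"
proof (rule continuous_on_sequentiallyI)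
  fix u :: "nat \<Rightarrow> real^'n" and a
  assume u: "u \<longlonglongrightarrow> a"
  let ?e = "\<lambda>\<xi> t. cis (- (2 * pi * (\<xi> \<bullet> t)))"
  have nf: "integrable lborel (\<lambda>t. norm (f t))" using f by (simp add: strongly_integrable_def)
  then have [measurable]: "(\<lambda>t. norm (f t)) \<in> borel_measurable lborel" by auto
  have bd: "cmod (?e (u n) t - ?e a t) * norm (f t) \<le> 2 * norm (f t)" for n t
    using norm_triangle_ineq4[of "?e (u n) t" "?e a t"] by (intro mult_right_mono) auto
  have int: "integrable lborel (\<lambda>t. cmod (?e (u n) t - ?e a t) * norm (f t))" for n
    by (rule Bochner_Integration.integrable_bound[of _ "\<lambda>t. 2 * norm (f t)"]) (use bd nf in auto)
  have "(\<lambda>n. LBINT t. cmod (?e (u n) t - ?e a t) * norm (f t)) \<longlonglongrightarrow> (\<integral>t. 0 \<partial>(lborel :: (real^'n) measure))"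
  proof (rule integral_dominated_convergence[where w = "\<lambda>t. 2 * norm (f t)"])
    show "AE t in lborel. (\<lambda>n. cmod (?e (u n) t - ?e a t) * norm (f t)) \<longlonglongrightarrow> 0"
    proof (rule AE_I2)
      fix t
      have "(\<lambda>n. ?e (u n) t) \<longlonglongrightarrow> ?e a t"
        by (intro tendsto_intros u)
      from tendsto_mult[OF tendsto_norm[OF tendsto_diff[OF this tendsto_const[of "?e a t"]]] tendsto_const[of "norm (f t)"]]
      show "(\<lambda>n. cmod (?e (u n) t - ?e a t) * norm (f t)) \<longlonglongrightarrow> 0" by simp
    qed
  qed (use bd nf in auto)
  moreover have "norm (fourier f (u n) - fourier f a) \<le> (LBINT t. cmod (?e (u n) t - ?e a t) * norm (f t))" for n
  proof -
    let ?g = "\<lambda>t. (?e (u n) t - ?e a t) *\<^sub>C f t"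
    have g: "strongly_integrable lborel ?g"
      using int[of n] f by (auto simp: strongly_integrable_def norm_scaleC intro!: strongly_measurable_scaleC)
    have "fourier f (u n) = strong_integral lborel (\<lambda>t. ?g t + ?e a t *\<^sub>C f t)"
      unfolding fourier_eq scaleC_add_left[symmetric] by simp
    also have "\<dots> = strong_integral lborel ?g + fourier f a"
      unfolding fourier_eq by (rule strong_integral_add[OF g strongly_integrable_character[OF f]])
    finally show ?thesis using norm_strong_integral_le[OF g] by (simp add: norm_scaleC)
  qed
  ultimately have "(\<lambda>n. norm (fourier f (u n) - fourier f a)) \<longlonglongrightarrow> 0"
    by (intro tendsto_sandwich[where f = "\<lambda>_. 0" and g = "\<lambda>n. norm (fourier f (u n) - fourier f a)"]) auto
  then show "(\<lambda>n. fourier f (u n)) \<longlonglongrightarrow> fourier f a"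
    by (simp add: Lim_null[of _ "fourier f a"] tendsto_norm_zero_iff)
qed

lemma strongly_measurable_fourier:
  "strongly_integrable lborel f \<Longrightarrow> strongly_measurable lborel (fourier f)"
  by (rule strongly_measurable_continuous[OF continuous_on_fourier])

lemma strongly_measurable_Pair_bilinear:
  assumes B: "bounded_bilinear B" and f: "strongly_measurable M f" and g: "strongly_measurable N g"
  shows "strongly_measurable (M \<Otimes>\<^sub>M N) (\<lambda>z. B (f (fst z)) (g (snd z)))"
  by (rule strongly_measurable_bilinear[OF B strongly_measurable_compose[OF f measurable_fst]
        strongly_measurable_compose[OF g measurable_snd]])

text \<open>Fubini, after \<open>B\<close> has turned the integrand into a scalar; the kernel is
  symmetric and passes through both arguments of \<open>B\<close> by complex bilinearity.
  Multiplication as \<open>B\<close> leads to Plancherel, application of functionals moves the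
  transform between test function and vector function.\<close>

lemma integral_fourier_swap:
  fixes B :: "'a::complex_banach \<Rightarrow> 'b::complex_banach \<Rightarrow> complex"
  assumes B: "bounded_bilinear B" "\<And>c x y. B (c *\<^sub>C x) y = c * B x y" "\<And>c x y. B x (c *\<^sub>C y) = c * B x y"
    and f: "strongly_integrable lborel (f :: real^'n::finite \<Rightarrow> 'a)" and g: "strongly_integrable lborel (g :: real^'n \<Rightarrow> 'b)"
  shows "(LBINT \<xi>. B (f \<xi>) (fourier g \<xi>)) = (LBINT t. B (fourier f t) (g t))"
proof -
  interpret bounded_bilinear B by fact
  let ?e = "\<lambda>\<xi> t. cis (- (2 * pi * (\<xi> \<bullet> t)))"
  have 1: "B (f \<xi>) (fourier g \<xi>) = (LBINT t. ?e \<xi> t * B (f \<xi>) (g t))" for \<xi>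
    unfolding fourier_eq
    using strong_integral_bounded_linear[OF bounded_linear_right[of "f \<xi>"] strongly_integrable_character[OF g, of \<xi>]]
      strongly_integrable_bounded_linear[OF bounded_linear_right[of "f \<xi>"] strongly_integrable_character[OF g, of \<xi>]]
    by (simp add: B strongly_integrable_complex_iff strong_integral_complex)
  have 2: "B (fourier f t) (g t) = (LBINT \<xi>. ?e \<xi> t * B (f \<xi>) (g t))" for t
    unfolding fourier_eq
    using strong_integral_bounded_linear[OF bounded_linear_left[of "g t"] strongly_integrable_character[OF f, of t]]
      strongly_integrable_bounded_linear[OF bounded_linear_left[of "g t"] strongly_integrable_character[OF f, of t]]
    by (simp add: B strongly_integrable_complex_iff strong_integral_complex inner_commute)
  obtain K where K: "\<And>x y. norm (B x y) \<le> norm x * norm y * K" "0 < K" using pos_bounded by blast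
  have fm: "strongly_measurable lborel f" "integrable lborel (\<lambda>x. norm (f x))"
    and gm: "strongly_measurable lborel g" "integrable lborel (\<lambda>x. norm (g x))"
    using f g by (auto simp: strongly_integrable_def)
  have meas: "(\<lambda>z. B (f (fst z)) (g (snd z))) \<in> borel_measurable (lborel \<Otimes>\<^sub>M lborel)"
    using strongly_measurable_Pair_bilinear[OF B(1) fm(1) gm(1)] by (simp add: strongly_measurable_iff_borel)
  have "integrable (lborel \<Otimes>\<^sub>M lborel) (\<lambda>z. norm (f (fst z)) * (norm (g (snd z)) * K))"
  proof (intro lborel_pair.Fubini_integrable)
    show "(\<lambda>z. norm (f (fst z)) * (norm (g (snd z)) * K)) \<in> borel_measurable (lborel \<Otimes>\<^sub>M lborel)"
      using borel_measurable_norm_strong[OF fm(1)] borel_measurable_norm_strong[OF gm(1)] by measurable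
  qed (use fm(2) gm(2) in \<open>auto simp: abs_mult\<close>)
  then have "integrable (lborel \<Otimes>\<^sub>M lborel) (\<lambda>z. ?e (fst z) (snd z) * B (f (fst z)) (g (snd z)))"
    by (rule Bochner_Integration.integrable_bound)
       (use meas K in \<open>auto simp: norm_mult mult.assoc abs_mult intro!: AE_I2\<close>)
  then have "(LBINT \<xi>. LBINT t. ?e \<xi> t * B (f \<xi>) (g t)) = (LBINT t. LBINT \<xi>. ?e \<xi> t * B (f \<xi>) (g t))"
    using lborel_pair.Fubini_integral[of "\<lambda>\<xi> t. ?e \<xi> t * B (f \<xi>) (g t)"] by (simp add: case_prod_unfold)
  then show ?thesis by (simp add: 1 2)
qed

section \<open>Gaussians\<close>

lemma integral_prod_Basis:
  fixes h :: "'e::euclidean_space \<Rightarrow> real \<Rightarrow> complex"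
  assumes h: "\<And>b. b \<in> Basis \<Longrightarrow> integrable lborel (h b)"
  shows "integrable lborel (\<lambda>x::'e. \<Prod>b\<in>Basis. h b (x \<bullet> b))"
    and "(LBINT x. (\<Prod>b\<in>Basis. h b (x \<bullet> b))) = (\<Prod>b\<in>Basis. LBINT s. h b s)"
proof -
  interpret product_sigma_finite "\<lambda>_::'e. lborel :: real measure" ..
  have meas: "(\<lambda>f. \<Sum>b\<in>Basis. f b *\<^sub>R b) \<in> measurable (PiM Basis (\<lambda>_. lborel :: real measure)) (borel :: 'e measure)"
    by measurable
  have eq: "(\<Prod>b\<in>Basis. h b ((\<Sum>b\<in>Basis. f b *\<^sub>R b) \<bullet> b)) = (\<Prod>b\<in>Basis. h b (f b))" for f :: "'e \<Rightarrow> real"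
    by (intro prod.cong) auto
  have [measurable]: "b \<in> Basis \<Longrightarrow> h b \<in> borel_measurable borel" for b using h[of b] by auto
  have pm: "(\<lambda>x::'e. \<Prod>b\<in>Basis. h b (x \<bullet> b)) \<in> borel_measurable borel" by measurable
  have "integrable (\<Pi>\<^sub>M b\<in>Basis. lborel) (\<lambda>f. \<Prod>b\<in>Basis. h b (f b))"
    by (rule product_integrable_prod) (use h in auto)
  then show "integrable lborel (\<lambda>x::'e. \<Prod>b\<in>Basis. h b (x \<bullet> b))"
    using integrable_distr_eq[OF meas pm] by (simp add: lborel_eq[symmetric, where 'a = 'e] eq)
  have "(LBINT x. (\<Prod>b\<in>Basis. h b (x \<bullet> b))) = (\<integral>f. (\<Prod>b\<in>Basis. h b (f b)) \<partial>(\<Pi>\<^sub>M b\<in>Basis. lborel))"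
    using integral_distr[OF meas pm] by (simp add: lborel_eq[symmetric, where 'a = 'e] eq)
  also have "\<dots> = (\<Prod>b\<in>Basis. LBINT s. h b s)"
    by (rule product_integral_prod) (use h in auto)
  finally show "(LBINT x. (\<Prod>b\<in>Basis. h b (x \<bullet> b))) = (\<Prod>b\<in>Basis. LBINT s. h b s)" .
qed

lemma gaussian_character_real:
  "has_bochner_integral lborel (\<lambda>t. exp (of_real (- pi * t\<^sup>2) + \<i> * of_real (2 * pi * s * t))) (of_real (exp (- pi * s\<^sup>2)))"
proof -
  \<comment> \<open>The substitution x = a t turns the standard normal density into exp(-pi t^2), up
    to the factor a, and the frequency a s into 2 pi s.\<close>
  define a where "a = sqrt (2 * pi)"
  have a: "a > 0" "a\<^sup>2 = 2 * pi" by (auto simp: a_def)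
  define f where "f x = complex_of_real (std_normal_density x) * iexp (a * s * x)" for x
  have "f \<in> borel_measurable borel"
    unfolding f_def normal_density_def by (intro borel_measurable_continuous_onI continuous_intros) auto
  then have int: "integrable lborel f"
    by (intro Bochner_Integration.integrable_bound[OF integrable_normal_density[OF zero_less_one, of 0]])
       (auto simp: f_def norm_mult)
  have "char std_normal_distribution (a * s) = (LBINT x. f x)"
    unfolding char_def f_def
    by (subst integral_density) (auto simp: scaleR_conv_of_real)
  moreover have "char std_normal_distribution (a * s) = of_real (exp (- pi * s\<^sup>2))"
    using a(2) by (simp add: char_std_normal_distribution power_mult_distrib)
  ultimately have "has_bochner_integral lborel f (of_real (exp (- pi * s\<^sup>2)))"
    using int by (simp add: has_bochner_integral_iff)
  then have "has_bochner_integral lborel (\<lambda>x. f (0 + a * x)) (of_real (exp (- pi * s\<^sup>2)) /\<^sub>R \<bar>a\<bar>)"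
    using a by (subst (asm) lborel_has_bochner_integral_real_affine_iff[where c = a and t = 0]) auto
  then have "has_bochner_integral lborel (\<lambda>x. a *\<^sub>R f (0 + a * x)) (a *\<^sub>R (of_real (exp (- pi * s\<^sup>2)) /\<^sub>R \<bar>a\<bar>))"
    by (rule has_bochner_integral_scaleR_right)
  moreover have "a *\<^sub>R f (0 + a * x) = exp (of_real (- pi * x\<^sup>2) + \<i> * of_real (2 * pi * s * x))" for x
  proof -
    have e: "(a * x)\<^sup>2 / 2 = pi * x\<^sup>2" "a * s * (a * x) = 2 * pi * s * x"
      using a(2) by (auto simp: power_mult_distrib power2_eq_square algebra_simps)
    have "a *\<^sub>R f (0 + a * x) = of_real (exp (- ((a * x)\<^sup>2 / 2))) * iexp (a * s * (a * x))"
      unfolding f_def std_normal_density_def using a(1) by (simp add: a_def[symmetric] scaleR_conv_of_real)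
    also have "\<dots> = exp (of_real (- pi * x\<^sup>2) + \<i> * of_real (2 * pi * s * x))"
      unfolding e exp_add exp_of_real by simp
    finally show ?thesis .
  qed
  ultimately show ?thesis using a(1) by simp
qed

text \<open>The self-dual Gaussian exp(-pi |t|^2), translated by \<open>b\<close> and then modulated
  by the frequency \<open>c\<close>. The Fourier transform sends the parameters (b, c) to (c, -b),
  up to a phase.\<close>

definition gauss :: "'e::euclidean_space \<Rightarrow> 'e \<Rightarrow> 'e \<Rightarrow> complex" where
  "gauss b c t = exp (of_real (- pi * ((t - b) \<bullet> (t - b))) + \<i> * of_real (2 * pi * (c \<bullet> t)))"

lemma norm_gauss: "cmod (gauss b c t) = exp (- pi * (norm (t - b))\<^sup>2)"
  by (simp add: gauss_def power2_norm_eq_inner)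

lemma continuous_on_gauss: "continuous_on UNIV (gauss b c)"
  unfolding gauss_def by (intro continuous_intros)

lemma gauss_uminus: "gauss b c (- t) = gauss (- b) (- c) t"
  by (simp add: gauss_def inner_diff_left inner_diff_right inner_add_left inner_add_right algebra_simps)

lemma gauss_character: "cis (2 * pi * (e \<bullet> t)) * gauss b c t = gauss b (c + e) t"
  by (simp add: gauss_def cis_conv_exp exp_add[symmetric] inner_add_left algebra_simps)

lemma has_bochner_integral_gauss0:
  "has_bochner_integral lborel (gauss 0 c) (of_real (exp (- pi * (c \<bullet> c))))"
proof -
  define h where "h b s = exp (of_real (- pi * s\<^sup>2) + \<i> * of_real (2 * pi * (c \<bullet> b) * s))" for b s
  have h: "has_bochner_integral lborel (h b) (of_real (exp (- pi * (c \<bullet> b)\<^sup>2)))" for b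
    unfolding h_def by (rule gaussian_character_real)
  have eq: "gauss 0 c t = (\<Prod>b\<in>Basis. h b (t \<bullet> b))" for t
    unfolding h_def exp_sum[symmetric, OF finite_Basis] gauss_def
    by (rule arg_cong[where f = exp])
       (simp add: sum.distrib sum_subtractf sum_negf sum_distrib_left power2_eq_square euclidean_inner[of t t] euclidean_inner[of c t] mult_ac)
  have "(\<Prod>b\<in>Basis. LBINT s. h b s) = (\<Prod>b\<in>Basis. of_real (exp (- pi * (c \<bullet> b)\<^sup>2)))"
    using h by (simp add: has_bochner_integral_iff)
  also have "\<dots> = of_real (exp (- pi * (c \<bullet> c)))"
    by (simp add: of_real_prod[symmetric] exp_sum[symmetric] euclidean_inner[of c c] sum_distrib_left power2_eq_square)
  finally show ?thesis
    using integral_prod_Basis[of h] h by (simp add: has_bochner_integral_iff eq[abs_def])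
qed

lemma has_bochner_integral_gauss:
  "has_bochner_integral lborel (gauss b c) (cis (2 * pi * (c \<bullet> b)) * of_real (exp (- pi * (c \<bullet> c))))"
proof -
  have "has_bochner_integral lborel (\<lambda>t. cis (2 * pi * (c \<bullet> b)) * gauss 0 c (- b + t)) (cis (2 * pi * (c \<bullet> b)) * of_real (exp (- pi * (c \<bullet> c))))"
  proof (rule has_bochner_integral_mult_right)
    have "has_bochner_integral (distr lborel borel ((+) (- b))) (gauss 0 c) (of_real (exp (- pi * (c \<bullet> c))))"
      unfolding lborel_distr_plus by (rule has_bochner_integral_gauss0)
    then show "has_bochner_integral lborel (\<lambda>t. gauss 0 c (- b + t)) (of_real (exp (- pi * (c \<bullet> c))))"
      using has_bochner_integral_gauss0[of c, THEN borel_measurable_has_bochner_integral]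
      by (simp add: has_bochner_integral_iff integrable_distr_eq integral_distr)
  qed
  moreover have "cis (2 * pi * (c \<bullet> b)) * gauss 0 c (- b + t) = gauss b c t" for t
    by (simp add: gauss_def cis_conv_exp exp_add[symmetric] inner_diff_right algebra_simps)
  ultimately show ?thesis by simp
qed

lemma integrable_gauss: "integrable lborel (gauss b c)"
  using has_bochner_integral_gauss by (auto simp: has_bochner_integral_iff)

lemma fourier_gauss: "fourier (gauss b c) \<xi> = cis (2 * pi * (c \<bullet> b)) * gauss c (- b) (\<xi> :: real^'n::finite)"
proof -
  have eq: "cis (- (2 * pi * (\<xi> \<bullet> t))) *\<^sub>C gauss b c t = gauss b (c - \<xi>) t" for t
    using gauss_character[of "- \<xi>" t b c] by (simp add: scaleC_complex_def)
  have "fourier (gauss b c) \<xi> = (LBINT t. gauss b (c - \<xi>) t)"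
    unfolding fourier_eq eq by (rule strong_integral_complex[OF integrable_gauss])
  also have "\<dots> = cis (2 * pi * ((c - \<xi>) \<bullet> b)) * of_real (exp (- pi * ((c - \<xi>) \<bullet> (c - \<xi>))))"
    using has_bochner_integral_gauss by (rule has_bochner_integral_integral_eq)
  also have "\<dots> = cis (2 * pi * (c \<bullet> b)) * gauss c (- b) \<xi>"
    by (simp add: gauss_def cis_conv_exp exp_add[symmetric] exp_of_real[symmetric] inner_diff_left inner_diff_right
         inner_commute algebra_simps)
  finally show ?thesis .
qed

text \<open>All Gaussians have the same width, so that this space is invariant under the Fourier transform. It replaces the Schwartz
  space in all that follows.\<close>

inductive_set gspan :: "(real^'n::finite \<Rightarrow> 'a::complex_banach) set" where
  zero: "(\<lambda>_. 0) \<in> gspan"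
| add_gauss: "f \<in> gspan \<Longrightarrow> (\<lambda>t. f t + gauss b c t *\<^sub>C x) \<in> gspan"

section \<open>Invariance of the span of Gaussians, Fourier inversion, Plancherel\<close>

lemma gspan_gauss: "(\<lambda>t. gauss b c t *\<^sub>C x) \<in> gspan"
  using gspan.add_gauss[OF gspan.zero] by simp

lemma gspan_add: "f \<in> gspan \<Longrightarrow> g \<in> gspan \<Longrightarrow> (\<lambda>t. f t + g t) \<in> gspan"
proof (induction rule: gspan.induct)
  case (add_gauss f b c x)
  have "(\<lambda>t. (f t + g t) + gauss b c t *\<^sub>C x) \<in> gspan"
    by (rule gspan.add_gauss) (use add_gauss in simp)
  then show ?case by (simp add: add_ac)
qed simp

text \<open>One induction for all operations on the span: linear maps of the values, reflection,
  modulation and the Fourier transform differ only in their effect on a single Gaussian.\<close>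

lemma gspan_transfer:
  fixes T :: "(real^'n::finite \<Rightarrow> 'a::complex_banach) \<Rightarrow> (real^'n \<Rightarrow> 'b::complex_banach)"
  assumes f: "f \<in> gspan" and zero: "T (\<lambda>_. 0) \<in> gspan"
    and gauss: "\<And>b c x. T (\<lambda>t. gauss b c t *\<^sub>C x) \<in> gspan"
    and add: "\<And>f g. f \<in> gspan \<Longrightarrow> g \<in> gspan \<Longrightarrow> T (\<lambda>t. f t + g t) = (\<lambda>t. T f t + T g t)"
  shows "T f \<in> gspan"
  using f by induction (auto simp: zero gauss add gspan_gauss intro: gspan_add)

lemma gspan_linear:
  fixes T :: "'a::complex_banach \<Rightarrow> 'b::complex_banach"
  assumes f: "f \<in> gspan" and "\<And>x y. T (x + y) = T x + T y" "\<And>c x. T (c *\<^sub>C x) = c *\<^sub>C T x"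
  shows "(\<lambda>t. T (f t)) \<in> gspan"
proof -
  have "T 0 = 0" using assms(2)[of 0 0] by simp
  then show ?thesis
    by (intro gspan_transfer[OF f, of "\<lambda>f t. T (f t)"]) (auto simp: assms gspan_gauss gspan.zero)
qed

lemma gspan_scaleC_left:
  fixes x :: "'a::complex_banach"
  assumes "f \<in> gspan" shows "(\<lambda>t. f t *\<^sub>C x) \<in> gspan"
  by (rule gspan_linear[OF assms, of "\<lambda>c. c *\<^sub>C x"])
     (auto simp: scaleC_add_left scaleC_scaleC scaleC_complex_def)

lemma gspan_scaleC: "f \<in> gspan \<Longrightarrow> (\<lambda>t. c *\<^sub>C f t) \<in> gspan"
  by (rule gspan_linear) (auto simp: scaleC_add_right scaleC_scaleC mult.commute)

lemma gspan_reflect: "f \<in> gspan \<Longrightarrow> (\<lambda>t. f (- t)) \<in> gspan"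
  by (rule gspan_transfer[of f "\<lambda>f t. f (- t)"]) (auto simp: gauss_uminus gspan_gauss gspan.zero)

lemma gspan_character: "f \<in> gspan \<Longrightarrow> (\<lambda>t. cis (2 * pi * (e \<bullet> t)) *\<^sub>C f t) \<in> gspan"
  by (rule gspan_transfer[of f "\<lambda>f t. cis (2 * pi * (e \<bullet> t)) *\<^sub>C f t"])
     (auto simp: scaleC_add_right scaleC_scaleC gauss_character gspan_gauss gspan.zero)

lemma strongly_integrable_gauss: "strongly_integrable lborel (\<lambda>t. gauss b c t *\<^sub>C x)"
  using integrable_gauss[of b c]
  by (auto simp: strongly_integrable_def norm_scaleC strongly_measurable_const intro!: strongly_measurable_scaleC integrable_norm)

lemma gspan_integrable: "f \<in> gspan \<Longrightarrow> strongly_integrable lborel f"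
proof (induction rule: gspan.induct)
  case zero then show ?case by (simp add: strongly_integrable_def strongly_measurable_const)
next
  case add_gauss then show ?case by (intro strongly_integrable_add strongly_integrable_gauss)
qed

lemma gspan_bounded:
  assumes "f \<in> gspan" obtains K where "\<And>t. norm (f t) \<le> K"
proof -
  have "\<exists>K. \<forall>t. norm (f t) \<le> K"
    using assms
  proof induction
    case (add_gauss f b c x)
    then obtain K where K: "\<And>t. norm (f t) \<le> K" by blast
    have "norm (f t + gauss b c t *\<^sub>C x) \<le> K + 1 * norm x" for t
      by (intro order_trans[OF norm_triangle_ineq] add_mono K)
         (auto simp: norm_scaleC norm_gauss mult_left_le_one_le)
    then show ?case by blast
  qed auto
  then show ?thesis using that by blast
qed

lemma gspan_square_integrable:
  fixes f :: "real^'n::finite \<Rightarrow> complex"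
  assumes f: "f \<in> gspan" shows "integrable lborel (\<lambda>t. (cmod (f t))\<^sup>2)"
proof -
  obtain K where K: "\<And>t. cmod (f t) \<le> K" using gspan_bounded[OF f] by blast
  have fi: "integrable lborel (\<lambda>t. cmod (f t))" using gspan_integrable[OF f] by (simp add: strongly_integrable_def)
  show ?thesis
  proof (rule Bochner_Integration.integrable_bound[where f = "\<lambda>t. K * cmod (f t)"])
    show "integrable lborel (\<lambda>t. K * cmod (f t))" using fi by simp
    show "(\<lambda>t. (cmod (f t))\<^sup>2) \<in> borel_measurable lborel" using fi by measurable
    show "AE t in lborel. norm ((cmod (f t))\<^sup>2) \<le> norm (K * cmod (f t))"
    proof (rule AE_I2)
      fix t
      have "(cmod (f t))\<^sup>2 \<le> K * cmod (f t)"
        unfolding power2_eq_square by (rule mult_right_mono[OF K norm_ge_zero])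
      then show "norm ((cmod (f t))\<^sup>2) \<le> norm (K * cmod (f t))" by simp
    qed
  qed
qed

lemma fourier_gauss_scaleC:
  "fourier (\<lambda>t. gauss b c t *\<^sub>C x) \<xi> = gauss c (- b) \<xi> *\<^sub>C (cis (2 * pi * (c \<bullet> b)) *\<^sub>C x)"
proof -
  have "fourier (\<lambda>t. gauss b c t *\<^sub>C x) \<xi> = fourier (gauss b c) \<xi> *\<^sub>C x"
    by (rule fourier_bounded_linear[OF bounded_bilinear.bounded_linear_left[OF bounded_bilinear_scaleC]])
       (auto simp: scaleC_scaleC scaleC_complex_def strongly_integrable_complex_iff integrable_gauss)
  then show ?thesis by (simp add: fourier_gauss scaleC_scaleC mult.commute)
qed

lemma fourier_zero: "fourier (\<lambda>_. 0) \<xi> = 0"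
  using fourier_diff[of "\<lambda>_. 0" "\<lambda>_. 0" \<xi>] by (simp add: strongly_integrable_def strongly_measurable_const)

lemma fourier_gspan: "f \<in> gspan \<Longrightarrow> fourier f \<in> gspan"
  by (rule gspan_transfer[of f fourier])
     (auto simp: fun_eq_iff fourier_zero[abs_def] fourier_gauss_scaleC[abs_def] gspan_gauss gspan.zero
        intro!: fourier_add gspan_integrable)

lemma inverse_fourier_gspan: "f \<in> gspan \<Longrightarrow> inverse_fourier f \<in> gspan"
  using gspan_reflect[OF fourier_gspan] by (simp add: inverse_fourier_eq[abs_def])

text \<open>Inversion is computed on generators: the two transforms restore the parameters and
  contribute opposite phases.\<close>

lemma fourier_inverse_fourier_gspan: "f \<in> gspan \<Longrightarrow> fourier (inverse_fourier f) = f"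
proof (induction rule: gspan.induct)
  case zero
  then show ?case by (simp add: fun_eq_iff inverse_fourier_eq[abs_def] fourier_zero)
next
  case (add_gauss f b c x)
  have g: "inverse_fourier (\<lambda>t. gauss b c t *\<^sub>C x) = (\<lambda>\<xi>. gauss (- c) b \<xi> *\<^sub>C (cis (2 * pi * (c \<bullet> b)) *\<^sub>C x))"
    by (simp add: fun_eq_iff inverse_fourier_eq fourier_gauss_scaleC gauss_uminus)
  have "inverse_fourier (\<lambda>t. f t + gauss b c t *\<^sub>C x) = (\<lambda>t. inverse_fourier f t + inverse_fourier (\<lambda>t. gauss b c t *\<^sub>C x) t)"
    by (simp add: fun_eq_iff inverse_fourier_eq fourier_add gspan_integrable add_gauss.hyps gspan_gauss)
  then have "fourier (inverse_fourier (\<lambda>t. f t + gauss b c t *\<^sub>C x)) \<xi>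
      = f \<xi> + fourier (\<lambda>\<xi>. gauss (- c) b \<xi> *\<^sub>C (cis (2 * pi * (c \<bullet> b)) *\<^sub>C x)) \<xi>" for \<xi>
    using add_gauss unfolding g
    by (simp add: fourier_add gspan_integrable inverse_fourier_gspan gspan_gauss)
  then show ?case
    unfolding fourier_gauss_scaleC by (simp add: fun_eq_iff scaleC_scaleC mult.assoc cis_mult inner_commute)
qed

text \<open>Conjugating the kernel inverts the transform, so the conjugate of
  \<open>inverse_fourier f\<close> is the transform of the conjugate of \<open>f\<close>. Then
  \<open>integral_fourier_swap\<close> moves the transform from one factor to the other.\<close>

lemma plancherel_gspan:
  fixes f :: "real^'n::finite \<Rightarrow> complex"
  assumes f: "f \<in> gspan"
  shows "(LBINT t. (cmod (f t))\<^sup>2) = (LBINT t. (cmod (inverse_fourier f t))\<^sup>2)"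
proof -
  define g where "g = inverse_fourier f"
  have g: "g \<in> gspan" "fourier g = f"
    using f by (simp_all add: g_def inverse_fourier_gspan fourier_inverse_fourier_gspan)
  have int: "strongly_integrable lborel f" "strongly_integrable lborel g" by (simp_all add: gspan_integrable f g)
  have intc: "strongly_integrable lborel (\<lambda>t. cnj (f t))"
    using int(1) by (simp add: strongly_integrable_complex_iff)
  have "fourier (\<lambda>t. cnj (f t)) \<xi> = cnj (g \<xi>)" for \<xi>
  proof -
    have 1: "integrable lborel (\<lambda>t. cis (- (2 * pi * (- \<xi> \<bullet> t))) * f t)"
      using strongly_integrable_character[OF int(1), of "- \<xi>"] by (simp add: strongly_integrable_complex_iff scaleC_complex_def)
    have 2: "integrable lborel (\<lambda>t. cis (- (2 * pi * (\<xi> \<bullet> t))) * cnj (f t))"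
      using strongly_integrable_character[OF intc, of \<xi>] by (simp add: strongly_integrable_complex_iff scaleC_complex_def)
    show ?thesis
      unfolding g_def inverse_fourier_eq fourier_eq scaleC_complex_def strong_integral_complex[OF 1]
        strong_integral_complex[OF 2] Bochner_Integration.integral_cnj[symmetric]
      by (rule Bochner_Integration.integral_cong) (simp_all add: cis_cnj)
  qed
  then have eq: "(LBINT \<xi>. cnj (f \<xi>) * fourier g \<xi>) = (LBINT t. cnj (g t) * g t)"
    using integral_fourier_swap[OF bounded_bilinear_mult _ _ intc int(2)]
    by (simp add: scaleC_complex_def mult.assoc mult.left_commute)
  have *: "cnj z * z = of_real ((cmod z)\<^sup>2)" for z by (simp add: complex_norm_square mult.commute del: of_real_power)
  show ?thesis
    using eq unfolding g(2) * integral_complex_of_real of_real_eq_iff unfolding g_def .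
qed

section \<open>Gaussians are Schwartz functions\<close>

lemma partial_deriv_eqI: "(f has_derivative D) (at x) \<Longrightarrow> partial_deriv j f x = D (axis j 1)"
  unfolding partial_deriv_def by (simp add: frechet_derivative_at[symmetric])

lemma partial_deriv_bilinear:
  assumes B: "bounded_bilinear B" and f: "f differentiable (at x)" and g: "g differentiable (at x)"
  shows "(\<lambda>x. B (f x) (g x)) differentiable (at x)"
    and "partial_deriv j (\<lambda>x. B (f x) (g x)) x = B (f x) (partial_deriv j g x) + B (partial_deriv j f x) (g x)"
proof -
  have D: "((\<lambda>x. B (f x) (g x)) has_derivative
      (\<lambda>h. B (f x) (frechet_derivative g (at x) h) + B (frechet_derivative f (at x) h) (g x))) (at x)"
    using bounded_bilinear.FDERIV[OF B f[unfolded frechet_derivative_works] g[unfolded frechet_derivative_works]] .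
  then show "(\<lambda>x. B (f x) (g x)) differentiable (at x)" by (rule differentiableI)
  show "partial_deriv j (\<lambda>x. B (f x) (g x)) x = B (f x) (partial_deriv j g x) + B (partial_deriv j f x) (g x)"
    using partial_deriv_eqI[OF D, of j] by (simp add: partial_deriv_def)
qed

lemma partial_deriv_add:
  assumes f: "f differentiable (at x)" and g: "g differentiable (at x)"
  shows "partial_deriv j (\<lambda>x. f x + g x) x = partial_deriv j f x + partial_deriv j g x"
  using partial_deriv_eqI[OF has_derivative_add[OF f[unfolded frechet_derivative_works] g[unfolded frechet_derivative_works]]]
  by (simp add: partial_deriv_def)

text \<open>Contains the factors that iterated partial derivatives put in front of a Gaussian, and
  is itself closed under partial derivatives.\<close>

inductive_set polyfun :: "(real^'n::finite \<Rightarrow> complex) set" where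
  const: "(\<lambda>_. c) \<in> polyfun"
| coord: "(\<lambda>t. of_real (t $ j)) \<in> polyfun"
| add: "f \<in> polyfun \<Longrightarrow> g \<in> polyfun \<Longrightarrow> (\<lambda>t. f t + g t) \<in> polyfun"
| mult: "f \<in> polyfun \<Longrightarrow> g \<in> polyfun \<Longrightarrow> (\<lambda>t. f t * g t) \<in> polyfun"

lemma polyfun_deriv:
  fixes q :: "real^'n::finite \<Rightarrow> complex"
  shows "q \<in> polyfun \<Longrightarrow> (\<forall>x. q differentiable (at x)) \<and> partial_deriv j q \<in> polyfun"
proof (induction rule: polyfun.induct)
  case (const c)
  then show ?case by (simp add: partial_deriv_def[abs_def] polyfun.const)
next
  case (coord i)
  have D: "((\<lambda>t. complex_of_real (t $ i)) has_derivative (\<lambda>h. of_real (h $ i))) (at x)" for x :: "real^'n"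
    by (intro bounded_linear.has_derivative[OF bounded_linear_of_real]
          bounded_linear.has_derivative[OF bounded_linear_vec_nth] has_derivative_ident)
  then show ?case
    by (auto simp: partial_deriv_eqI[OF D, abs_def] polyfun.const intro: differentiableI)
next
  case (add f g)
  then have "partial_deriv j (\<lambda>t. f t + g t) = (\<lambda>x. partial_deriv j f x + partial_deriv j g x)"
    by (simp add: fun_eq_iff partial_deriv_add)
  then show ?case
    using add by (auto intro!: polyfun.add)
next
  case (mult f g)
  then have "partial_deriv j (\<lambda>t. f t * g t) = (\<lambda>x. f x * partial_deriv j g x + partial_deriv j f x * g x)"
    using partial_deriv_bilinear(2)[OF bounded_bilinear_mult, of f _ g j] by (auto simp: fun_eq_iff)
  then show ?case
    using mult partial_deriv_bilinear(1)[OF bounded_bilinear_mult, of f _ g]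
    by (auto intro!: polyfun.add polyfun.mult)
qed

lemma gauss_deriv:
  "(gauss b c) differentiable (at x)"
  "partial_deriv j (gauss b c) x = (of_real (- 2 * pi * (x $ j - b $ j)) + \<i> * of_real (2 * pi * c $ j)) * gauss b c x"
proof -
  have E: "((\<lambda>t. complex_of_real (- pi * ((t - b) \<bullet> (t - b))) + \<i> * of_real (2 * pi * (c \<bullet> t))) has_derivative
     (\<lambda>h. of_real (- pi * ((x - b) \<bullet> h + h \<bullet> (x - b))) + \<i> * of_real (2 * pi * (c \<bullet> h)))) (at x)"
    by (intro has_derivative_add has_derivative_mult_right has_derivative_of_real has_derivative_inner_right has_derivative_ident)
       (rule derivative_eq_intros refl | simp)+
  have gd: "gauss b c = (\<lambda>t. exp (of_real (- pi * ((t - b) \<bullet> (t - b))) + \<i> * of_real (2 * pi * (c \<bullet> t))))"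
    by (simp add: gauss_def fun_eq_iff)
  have D: "(gauss b c has_derivative
     (\<lambda>h. (of_real (- pi * ((x - b) \<bullet> h + h \<bullet> (x - b))) + \<i> * of_real (2 * pi * (c \<bullet> h))) * gauss b c x)) (at x)"
    using has_derivative_compose[OF E DERIV_exp[unfolded has_field_derivative_def]]
    unfolding gd by (simp only: mult.commute)
  then show "(gauss b c) differentiable (at x)" by (rule differentiableI)
  show "partial_deriv j (gauss b c) x = (of_real (- 2 * pi * (x $ j - b $ j)) + \<i> * of_real (2 * pi * c $ j)) * gauss b c x"
    unfolding partial_deriv_eqI[OF D] by (simp add: inner_axis inner_axis' algebra_simps)
qed

definition pgauss :: "(real^'n::finite \<Rightarrow> complex) \<Rightarrow> real^'n \<Rightarrow> real^'n \<Rightarrow> 'a::complex_banach \<Rightarrow> real^'n \<Rightarrow> 'a" where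
  "pgauss q b c x t = (q t * gauss b c t) *\<^sub>C x"

lemma foldr_partial_deriv_pgauss:
  fixes q :: "real^'n::finite \<Rightarrow> complex"
  shows "q \<in> polyfun \<Longrightarrow> \<exists>q'\<in>polyfun. foldr partial_deriv js (pgauss q b c x) = pgauss q' b c x"
proof (induction js)
  case (Cons j js)
  then obtain q' where q': "q' \<in> polyfun" "foldr partial_deriv js (pgauss q b c x) = pgauss q' b c x" by blast
  \<comment> \<open>The logarithmic derivative of the Gaussian in direction \<open>j\<close>, a
    polynomial of degree one.\<close>
  define l where "l t = of_real (- 2 * pi * (t $ j - b $ j)) + \<i> * of_real (2 * pi * c $ j)" for t :: "real^'n"
  have l: "l \<in> polyfun"
  proof -
    have "(\<lambda>t. (of_real (- 2 * pi) * of_real (t $ j)) + (of_real (2 * pi * b $ j) + \<i> * of_real (2 * pi * c $ j))) \<in> polyfun"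
      by (intro polyfun.intros)
    then show ?thesis by (simp add: l_def[abs_def] algebra_simps)
  qed
  have qd: "q' differentiable (at t)" for t using polyfun_deriv[OF q'(1)] by blast
  have "partial_deriv j (pgauss q' b c x) t = pgauss (\<lambda>t. q' t * l t + partial_deriv j q' t) b c x t" for t
  proof -
    have 1: "(\<lambda>t. q' t * gauss b c t) differentiable (at t)"
      "partial_deriv j (\<lambda>t. q' t * gauss b c t) t = q' t * partial_deriv j (gauss b c) t + partial_deriv j q' t * gauss b c t"
      by (rule partial_deriv_bilinear[OF bounded_bilinear_mult qd gauss_deriv(1)])+
    have "partial_deriv j (\<lambda>t. (q' t * gauss b c t) *\<^sub>C x) t = partial_deriv j (\<lambda>t. q' t * gauss b c t) t *\<^sub>C x"
      using partial_deriv_bilinear(2)[OF bounded_bilinear_scaleC 1(1) differentiable_const, of j x]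
      by (simp add: partial_deriv_def[of j "\<lambda>_. x"])
    then show ?thesis
      unfolding pgauss_def 1(2) gauss_deriv(2) l_def by (simp add: algebra_simps)
  qed
  moreover have "(\<lambda>t. q' t * l t + partial_deriv j q' t) \<in> polyfun"
    using polyfun_deriv[OF q'(1), of j] q' l by (intro polyfun.intros) auto
  ultimately show ?case using q'(2) by (intro bexI[of _ "\<lambda>t. q' t * l t + partial_deriv j q' t"]) auto
qed auto

lemma polyfun_growth: "q \<in> polyfun \<Longrightarrow> \<exists>A N. 0 \<le> A \<and> (\<forall>t. cmod (q t) \<le> A * (1 + norm t) ^ N)"
proof (induction rule: polyfun.induct)
  case (const c)
  then show ?case by (intro exI[of _ "cmod c"] exI[of _ 0]) auto
next
  case (coord j)
  show ?case
    by (rule exI[of _ 1], rule exI[of _ 1]) (auto intro: order_trans[OF component_le_norm_cart])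
next
  case (add f g)
  then obtain A N B M where *: "0 \<le> A" "\<And>t. cmod (f t) \<le> A * (1 + norm t) ^ N" "0 \<le> B" "\<And>t. cmod (g t) \<le> B * (1 + norm t) ^ M"
    by blast
  have "cmod (f t + g t) \<le> (A + B) * (1 + norm t) ^ (N + M)" for t
  proof -
    have "A * (1 + norm t) ^ N \<le> A * (1 + norm t) ^ (N + M)" "B * (1 + norm t) ^ M \<le> B * (1 + norm t) ^ (N + M)"
      using * by (auto intro!: mult_left_mono power_increasing)
    then show ?thesis
      using norm_triangle_ineq[of "f t" "g t"] *(2)[of t] *(4)[of t] by (simp add: distrib_right)
  qed
  then show ?case using * by (intro exI[of _ "A + B"] exI[of _ "N + M"]) auto
next
  case (mult f g)
  then obtain A N B M where *: "0 \<le> A" "\<And>t. cmod (f t) \<le> A * (1 + norm t) ^ N" "0 \<le> B" "\<And>t. cmod (g t) \<le> B * (1 + norm t) ^ M"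
    by blast
  have "cmod (f t * g t) \<le> (A * B) * (1 + norm t) ^ (N + M)" for t
    using mult_mono[OF *(2)[of t] *(4)[of t]] * by (simp add: norm_mult power_add mult_ac)
  then show ?case using * by (intro exI[of _ "A * B"] exI[of _ "N + M"]) auto
qed

lemma power_le_fact_exp: "0 \<le> x \<Longrightarrow> x ^ n \<le> fact n * exp (x::real)"
proof -
  assume x: "0 \<le> x"
  have "(\<Sum>k\<in>{n}. x ^ k /\<^sub>R fact k) \<le> (\<Sum>k. x ^ k /\<^sub>R fact k)"
    using x by (intro sum_le_suminf summable_exp_generic) auto
  then show ?thesis by (simp add: exp_def divide_simps mult.commute)
qed

text \<open>The weight is recentred at \<open>b\<close> by 1 + |t| \<le> (1 + |b|)(1 + |t - b|); a
  power of 1 + s is then bounded by an exponential, which the quadratic exponent of the Gaussian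
  absorbs.\<close>

lemma gauss_decay: "\<exists>K. \<forall>t. (1 + norm t) ^ m * cmod (gauss b c t) \<le> K"
proof (intro exI allI)
  fix t :: 'a
  define s where "s = norm (t - b)"
  have s: "0 \<le> s" by (simp add: s_def)
  have "(1 + norm t) ^ m \<le> ((1 + norm b) * (1 + s)) ^ m"
  proof (rule power_mono)
    have "norm t \<le> norm b + s" unfolding s_def using norm_triangle_sub[of t b] by simp
    also have "\<dots> \<le> norm b + s + norm b * s" using s by simp
    finally show "1 + norm t \<le> (1 + norm b) * (1 + s)" by (simp add: algebra_simps)
  qed simp
  also have "\<dots> = (1 + norm b) ^ m * (1 + s) ^ m" by (rule power_mult_distrib)
  also have "(1 + s) ^ m \<le> fact m * exp (1 + s)" using s by (intro power_le_fact_exp) simp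
  finally have 1: "(1 + norm t) ^ m \<le> (1 + norm b) ^ m * (fact m * exp (1 + s))" by (simp add: mult_left_mono)
  \<comment> \<open>From pi \<ge> 1 and s \<le> 1 + s^2; it yields the exponent bound 1 + s - pi s^2
    \<le> 2 used next.\<close>
  have "s - pi * s\<^sup>2 \<le> 1"
  proof -
    have "s\<^sup>2 \<le> pi * s\<^sup>2" using pi_gt3 by (simp add: mult_le_cancel_right1)
    moreover have "s \<le> 1 + s\<^sup>2" using sum_squares_ge_zero[of "s - 1/2" 0] by (simp add: power2_eq_square algebra_simps)
    ultimately show ?thesis by simp
  qed
  then have 2: "exp (1 + s) * cmod (gauss b c t) \<le> exp 2"
    unfolding norm_gauss s_def[symmetric] exp_add[symmetric] by simp
  have "(1 + norm t) ^ m * cmod (gauss b c t) \<le> (1 + norm b) ^ m * (fact m * exp (1 + s)) * cmod (gauss b c t)"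
    by (intro mult_right_mono 1) simp
  also have "\<dots> = (1 + norm b) ^ m * fact m * (exp (1 + s) * cmod (gauss b c t))" by simp
  also have "\<dots> \<le> (1 + norm b) ^ m * fact m * exp 2"
    by (intro mult_left_mono 2) simp
  finally show "(1 + norm t) ^ m * cmod (gauss b c t) \<le> (1 + norm b) ^ m * fact m * exp 2" .
qed

lemma schwartz_pgauss:
  fixes q :: "real^'n::finite \<Rightarrow> complex"
  assumes q: "q \<in> polyfun" shows "schwartz (pgauss q b c x)"
  unfolding schwartz_def
proof (intro conjI allI)
  fix js :: "'n list" and t and k :: nat
  obtain q' where q': "q' \<in> polyfun" "foldr partial_deriv js (pgauss q b c x) = pgauss q' b c x"
    using foldr_partial_deriv_pgauss[OF q] by blast
  have "(\<lambda>t. (q' t * gauss b c t) *\<^sub>C x) differentiable (at t)"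
    by (intro partial_deriv_bilinear[OF bounded_bilinear_scaleC] partial_deriv_bilinear[OF bounded_bilinear_mult]
       gauss_deriv differentiable_const) (use polyfun_deriv[OF q'(1)] in blast)
  then show "foldr partial_deriv js (pgauss q b c x) differentiable (at t)"
    unfolding q'(2) by (simp add: pgauss_def[abs_def])
  obtain A N where A: "0 \<le> A" "\<And>t. cmod (q' t) \<le> A * (1 + norm t) ^ N" using polyfun_growth[OF q'(1)] by blast
  obtain K where K: "\<And>t. (1 + norm t) ^ (k + N) * cmod (gauss b c t) \<le> K" using gauss_decay by blast
  have "norm t ^ k * norm (pgauss q' b c x t) \<le> A * K * norm x" for t
  proof -
    have "norm t ^ k * norm (pgauss q' b c x t) = norm t ^ k * cmod (q' t) * cmod (gauss b c t) * norm x"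
      by (simp add: pgauss_def norm_scaleC norm_mult)
    also have "\<dots> \<le> (1 + norm t) ^ k * (A * (1 + norm t) ^ N) * cmod (gauss b c t) * norm x"
      by (intro mult_right_mono mult_mono A power_mono) auto
    also have "\<dots> = A * ((1 + norm t) ^ (k + N) * cmod (gauss b c t)) * norm x" by (simp add: power_add mult_ac)
    also have "\<dots> \<le> A * K * norm x" by (intro mult_right_mono mult_left_mono K A) auto
    finally show ?thesis .
  qed
  then show "\<exists>C. \<forall>t. norm t ^ k * norm (foldr partial_deriv js (pgauss q b c x) t) \<le> C"
    unfolding q'(2) by blast
qed

lemma foldr_partial_deriv_add:
  assumes "schwartz f" "schwartz g"
  shows "foldr partial_deriv js (\<lambda>t. f t + g t) = (\<lambda>t. foldr partial_deriv js f t + foldr partial_deriv js g t)"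
  by (induction js) (use assms in \<open>auto simp: schwartz_def partial_deriv_add\<close>)

lemma schwartz_add:
  assumes f: "schwartz (f :: real^'n::finite \<Rightarrow> _)" and g: "schwartz g" shows "schwartz (\<lambda>t. f t + g t)"
  unfolding schwartz_def foldr_partial_deriv_add[OF f g]
proof (intro conjI allI)
  fix js :: "'n list" and k :: nat
  show "(\<lambda>t. foldr partial_deriv js f t + foldr partial_deriv js g t) differentiable (at x)" for x
    using f g by (intro differentiable_add) (auto simp: schwartz_def)
  obtain C1 C2 where C: "\<And>x. norm x ^ k * norm (foldr partial_deriv js f x) \<le> C1" "\<And>x. norm x ^ k * norm (foldr partial_deriv js g x) \<le> C2"
    using f g unfolding schwartz_def by metis
  have "norm x ^ k * norm (foldr partial_deriv js f x + foldr partial_deriv js g x) \<le> C1 + C2" for x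
  proof -
    have "norm x ^ k * norm (foldr partial_deriv js f x + foldr partial_deriv js g x)
      \<le> norm x ^ k * (norm (foldr partial_deriv js f x) + norm (foldr partial_deriv js g x))"
      by (intro mult_left_mono norm_triangle_ineq) simp
    also have "\<dots> \<le> C1 + C2" using C[of x] by (simp add: distrib_left)
    finally show ?thesis .
  qed
  then show "\<exists>C. \<forall>x. norm x ^ k * norm (foldr partial_deriv js f x + foldr partial_deriv js g x) \<le> C" by blast
qed

lemma schwartz_gspan: "f \<in> gspan \<Longrightarrow> schwartz f"
proof (induction rule: gspan.induct)
  case zero
  show ?case using schwartz_pgauss[OF polyfun.const[of 0]] by (simp add: pgauss_def[abs_def])
next
  case (add_gauss f b c x)
  show ?case
    by (rule schwartz_add[OF add_gauss.IH]) (use schwartz_pgauss[OF polyfun.const[of 1], of b c x] in \<open>simp add: pgauss_def[abs_def]\<close>)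
qed

section \<open>Density of the span of Gaussians\<close>

text \<open>The factor 4 is 2^2, an upper bound for 2^p uniform in the exponents that occur. All
  later factors 4 and 16 descend from such bounds.\<close>

lemma powr_add_le:
  assumes "0 \<le> (a::real)" "0 \<le> b" "1 \<le> p" "p \<le> 2"
  shows "(a + b) powr p \<le> 4 * (a powr p + b powr p)"
proof -
  have "(a + b) powr p \<le> (2 * max a b) powr p"
    using assms by (intro powr_mono2) auto
  also have "\<dots> = 2 powr p * max a b powr p" using assms by (simp add: powr_mult)
  also have "2 powr p \<le> 2 powr (2::real)" using assms by (intro powr_mono) auto
  also have "2 powr (2::real) * max a b powr p \<le> 4 * (a powr p + b powr p)"
    by (auto simp: max_def)
  finally show ?thesis by (simp add: mult_right_mono)
qed

text \<open>The error budget of two approximations of size e/8 under the factor 4 of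
  \<open>nn_integral_dev_add\<close>.\<close>

lemma ennreal_eighths: "0 < e \<Longrightarrow> 4 * (ennreal (e / 8) + ennreal (e / 8)) = ennreal e"
  by (simp add: ennreal_plus[symmetric] ennreal_numeral[symmetric] ennreal_mult[symmetric]
      del: ennreal_plus ennreal_numeral)

text \<open>Sum of the L^1 and the L^p density of a deviation: one small integral gives closeness in
  L^1, which controls Fourier transforms uniformly, and in L^p, which keeps approximants in a fixed
  ball.\<close>

definition dev :: "real \<Rightarrow> 'a::real_normed_vector \<Rightarrow> real" where
  "dev p x = norm x + norm x powr p"

lemma dev_nonneg [simp]: "0 \<le> dev p x"
  by (simp add: dev_def)

lemma dev_add: 
  assumes p: "1 \<le> p" "p \<le> 2" shows "dev p (x + y) \<le> 4 * (dev p x + dev p y)"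
proof -
  have "norm (x + y) powr p \<le> (norm x + norm y) powr p"
    using p by (intro powr_mono2 norm_triangle_ineq) auto
  also have "\<dots> \<le> 4 * (norm x powr p + norm y powr p)" using p by (intro powr_add_le) auto
  finally show ?thesis using norm_triangle_ineq[of x y] norm_ge_zero[of x] norm_ge_zero[of y]
    unfolding dev_def distrib_left by linarith
qed

lemma dev_measurable [measurable]:
  "strongly_measurable M f \<Longrightarrow> (\<lambda>x. dev p (f x)) \<in> borel_measurable M"
  using borel_measurable_norm_strong[of M f] unfolding dev_def by measurable

text \<open>Membership in the closure of the span for the L^1 and L^p distances together.\<close>

definition approximable :: "real \<Rightarrow> (real^'n::finite \<Rightarrow> 'a::complex_banach) \<Rightarrow> bool" where
  "approximable p f \<longleftrightarrow> strongly_measurable lborel f \<and>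
     (\<forall>e>0. \<exists>g\<in>gspan. (\<integral>\<^sup>+x. ennreal (dev p (f x - g x)) \<partial>lborel) \<le> ennreal e)"

lemma gspan_strongly_measurable: "g \<in> gspan \<Longrightarrow> strongly_measurable lborel g"
  using gspan_integrable by (auto simp: strongly_integrable_def)

context
  fixes p :: real
  assumes p: "1 \<le> p" "p \<le> 2"
begin

lemma nn_integral_dev_add:
  assumes f: "strongly_measurable M f" and g: "strongly_measurable M g"
  shows "(\<integral>\<^sup>+x. ennreal (dev p (f x + g x)) \<partial>M)
    \<le> 4 * ((\<integral>\<^sup>+x. ennreal (dev p (f x)) \<partial>M) + (\<integral>\<^sup>+x. ennreal (dev p (g x)) \<partial>M))"
proof -
  have [measurable]: "(\<lambda>x. dev p (f x)) \<in> borel_measurable M" "(\<lambda>x. dev p (g x)) \<in> borel_measurable M"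
    using f g by (auto intro: dev_measurable)
  have "(\<integral>\<^sup>+x. ennreal (dev p (f x + g x)) \<partial>M) \<le> (\<integral>\<^sup>+x. ennreal (4 * (dev p (f x) + dev p (g x))) \<partial>M)"
    by (intro nn_integral_mono ennreal_leI dev_add p)
  also have "\<dots> = (\<integral>\<^sup>+x. 4 * (ennreal (dev p (f x)) + ennreal (dev p (g x))) \<partial>M)"
    by (simp add: ennreal_mult)
  also have "\<dots> = 4 * (\<integral>\<^sup>+x. (ennreal (dev p (f x)) + ennreal (dev p (g x))) \<partial>M)"
    by (rule nn_integral_cmult) measurable
  also have "\<dots> = 4 * ((\<integral>\<^sup>+x. ennreal (dev p (f x)) \<partial>M) + (\<integral>\<^sup>+x. ennreal (dev p (g x)) \<partial>M))"
    by (subst nn_integral_add) auto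
  finally show ?thesis .
qed

lemma approximable_closed:
  assumes f: "strongly_measurable lborel f"
    and ex: "\<And>e. 0 < e \<Longrightarrow> \<exists>g. approximable p g \<and> (\<integral>\<^sup>+x. ennreal (dev p (f x - g x)) \<partial>lborel) \<le> ennreal e"
  shows "approximable p f"
  unfolding approximable_def
proof (intro conjI allI impI f)
  fix e :: real assume e: "0 < e"
  then obtain g where g: "approximable p g" "(\<integral>\<^sup>+x. ennreal (dev p (f x - g x)) \<partial>lborel) \<le> ennreal (e / 8)"
    using ex[of "e / 8"] by auto
  then obtain h where h: "h \<in> gspan" "(\<integral>\<^sup>+x. ennreal (dev p (g x - h x)) \<partial>lborel) \<le> ennreal (e / 8)"
    using e unfolding approximable_def by (meson divide_pos_pos zero_less_numeral)
  have gm: "strongly_measurable lborel g" using g by (simp add: approximable_def)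
  have "(\<integral>\<^sup>+x. ennreal (dev p (f x - h x)) \<partial>lborel) = (\<integral>\<^sup>+x. ennreal (dev p ((f x - g x) + (g x - h x))) \<partial>lborel)"
    by simp
  also have "\<dots> \<le> 4 * ((\<integral>\<^sup>+x. ennreal (dev p (f x - g x)) \<partial>lborel) + (\<integral>\<^sup>+x. ennreal (dev p (g x - h x)) \<partial>lborel))"
    by (intro nn_integral_dev_add strongly_measurable_diff f gm gspan_strongly_measurable h)
  also have "\<dots> \<le> 4 * (ennreal (e / 8) + ennreal (e / 8))"
    by (intro mult_left_mono add_mono g h) auto
  also have "\<dots> = ennreal e" using e by (rule ennreal_eighths)
  finally show "\<exists>g\<in>gspan. (\<integral>\<^sup>+x. ennreal (dev p (f x - g x)) \<partial>lborel) \<le> ennreal e"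
    using h(1) by auto
qed

lemma approximable_gspan: "f \<in> gspan \<Longrightarrow> approximable p f"
  unfolding approximable_def
  by (auto simp: gspan_strongly_measurable dev_def intro!: bexI[of _ f])

text \<open>Dominated convergence for both densities at once; every limit step of the density proof
  is an instance.\<close>

lemma approximable_dominated:
  assumes f: "\<And>i. approximable p (f i)" and lim: "\<And>x. (\<lambda>i. f i x) \<longlonglongrightarrow> g x"
    and bound: "\<And>i x. norm (f i x) \<le> w x" and w: "integrable lborel w" "integrable lborel (\<lambda>x. w x powr p)"
  shows "approximable p g"
proof (rule approximable_closed)
  have fm: "strongly_measurable lborel (f i)" for i using f by (simp add: approximable_def)
  show gm: "strongly_measurable lborel g" by (rule strongly_measurable_LIMSEQ[OF fm lim])
  have w0: "0 \<le> w x" for x using bound[of 0 x] norm_ge_zero order_trans by blast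
  have gb: "norm (g x) \<le> w x" for x
    by (rule LIMSEQ_le_const2[OF tendsto_norm[OF lim]]) (use bound in auto)
  have le: "dev p (g x - f i x) \<le> 2 * w x + 4 * w x powr p" for i x
  proof -
    have n: "norm (g x - f i x) \<le> 2 * w x" using norm_triangle_ineq4[of "g x" "f i x"] gb[of x] bound[of i x] by simp
    then have "norm (g x - f i x) powr p \<le> (2 * w x) powr p" using p by (intro powr_mono2) auto
    also have "\<dots> = 2 powr p * w x powr p" using w0 by (simp add: powr_mult)
    also have "\<dots> \<le> 2 powr 2 * w x powr p" using p by (intro mult_right_mono powr_mono) auto
    finally show ?thesis using n by (simp add: dev_def)
  qed
  have int: "integrable lborel (\<lambda>x. 2 * w x + 4 * w x powr p)" using w by auto
  have "(\<lambda>i. \<integral>\<^sup>+x. ennreal (dev p (g x - f i x)) \<partial>lborel) \<longlonglongrightarrow> (\<integral>\<^sup>+x. 0 \<partial>(lborel :: (real^'a) measure))"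
  proof (rule nn_integral_dominated_convergence[where w = "\<lambda>x. ennreal (2 * w x + 4 * w x powr p)"])
    show "(\<lambda>x. ennreal (dev p (g x - f i x))) \<in> borel_measurable lborel" for i
      by (intro measurable_compose[OF dev_measurable measurable_ennreal] strongly_measurable_diff gm fm)
    show "AE x in lborel. (\<lambda>i. ennreal (dev p (g x - f i x))) \<longlonglongrightarrow> 0"
    proof (rule AE_I2)
      fix x
      have 1: "(\<lambda>i. norm (g x - f i x)) \<longlonglongrightarrow> 0"
        using tendsto_norm[OF tendsto_diff[OF tendsto_const lim[of x], of "g x"]] by simp
      have "(\<lambda>i. norm (g x - f i x) powr p) \<longlonglongrightarrow> 0"
        using tendsto_powr2[OF 1 tendsto_const[of p]] p by (simp add: always_eventually)
      then have "(\<lambda>i. dev p (g x - f i x)) \<longlonglongrightarrow> 0 + 0"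
        unfolding dev_def by (intro tendsto_add 1)
      then show "(\<lambda>i. ennreal (dev p (g x - f i x))) \<longlonglongrightarrow> 0"
        using tendsto_ennrealI by fastforce
    qed
    show "AE x in lborel. ennreal (dev p (g x - f i x)) \<le> ennreal (2 * w x + 4 * w x powr p)" for i
      by (intro AE_I2 ennreal_leI le)
    show "(\<integral>\<^sup>+x. ennreal (2 * w x + 4 * w x powr p) \<partial>lborel) < \<infinity>"
      using int w0 by (subst nn_integral_eq_integral) auto
  qed (use int in auto)
  then have lim0: "(\<lambda>i. \<integral>\<^sup>+x. ennreal (dev p (g x - f i x)) \<partial>lborel) \<longlonglongrightarrow> 0" by simp
  fix e :: real assume "0 < e"
  then obtain i where "(\<integral>\<^sup>+x. ennreal (dev p (g x - f i x)) \<partial>lborel) < ennreal e"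
    using order_tendstoD(2)[OF lim0, of "ennreal e"] by (auto simp: eventually_sequentially)
  then show "\<exists>h. approximable p h \<and> (\<integral>\<^sup>+x. ennreal (dev p (g x - h x)) \<partial>lborel) \<le> ennreal e"
    using f by (intro exI[of _ "f i"]) auto
qed

lemma approximable_add:
  assumes f: "approximable p f" and g: "approximable p g"
  shows "approximable p (\<lambda>x. f x + g x)"
  unfolding approximable_def
proof (intro conjI allI impI)
  have m: "strongly_measurable lborel f" "strongly_measurable lborel g" using f g by (auto simp: approximable_def)
  then show "strongly_measurable lborel (\<lambda>x. f x + g x)" by (rule strongly_measurable_add)
  fix e :: real assume e: "0 < e"
  then obtain f' where f': "f' \<in> gspan" "(\<integral>\<^sup>+x. ennreal (dev p (f x - f' x)) \<partial>lborel) \<le> ennreal (e / 8)"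
    using f unfolding approximable_def by (meson divide_pos_pos zero_less_numeral)
  obtain g' where g': "g' \<in> gspan" "(\<integral>\<^sup>+x. ennreal (dev p (g x - g' x)) \<partial>lborel) \<le> ennreal (e / 8)"
    using g e unfolding approximable_def by (meson divide_pos_pos zero_less_numeral)
  have "(\<integral>\<^sup>+x. ennreal (dev p (f x + g x - (f' x + g' x))) \<partial>lborel) = (\<integral>\<^sup>+x. ennreal (dev p ((f x - f' x) + (g x - g' x))) \<partial>lborel)"
    by (simp add: algebra_simps)
  also have "\<dots> \<le> 4 * ((\<integral>\<^sup>+x. ennreal (dev p (f x - f' x)) \<partial>lborel) + (\<integral>\<^sup>+x. ennreal (dev p (g x - g' x)) \<partial>lborel))"
    by (intro nn_integral_dev_add strongly_measurable_diff m gspan_strongly_measurable f' g')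
  also have "\<dots> \<le> 4 * (ennreal (e / 8) + ennreal (e / 8))"
    by (intro mult_left_mono add_mono f' g') auto
  also have "\<dots> = ennreal e" using e by (rule ennreal_eighths)
  finally show "\<exists>h\<in>gspan. (\<integral>\<^sup>+x. ennreal (dev p (f x + g x - h x)) \<partial>lborel) \<le> ennreal e"
    using gspan_add[OF f'(1) g'(1)] by auto
qed

lemma approximable_scaleC_left:
  fixes x :: "'a::complex_banach"
  assumes f: "approximable p f"
  shows "approximable p (\<lambda>t. f t *\<^sub>C x)"
  unfolding approximable_def
proof (intro conjI allI impI)
  have m: "strongly_measurable lborel f" using f by (auto simp: approximable_def)
  then have fb: "f \<in> borel_measurable lborel" by (simp add: strongly_measurable_iff_borel)
  then show "strongly_measurable lborel (\<lambda>t. f t *\<^sub>C x)" by (intro strongly_measurable_scaleC strongly_measurable_const)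
  fix e :: real assume e: "0 < e"
  \<comment> \<open>The summand 1 keeps \<open>K\<close> positive for x = 0, so that e / K is a
    legitimate tolerance.\<close>
  define K where "K = 1 + norm x + norm x powr p"
  have K: "0 < K" "norm x \<le> K" "norm x powr p \<le> K" by (auto simp: K_def add_pos_nonneg)
  then have "0 < e / K" using e by simp
  then obtain g where g: "g \<in> gspan" "(\<integral>\<^sup>+t. ennreal (dev p (f t - g t)) \<partial>lborel) \<le> ennreal (e / K)"
    using f unfolding approximable_def by meson
  have [measurable]: "(\<lambda>t. dev p (f t - g t)) \<in> borel_measurable lborel"
    by (intro dev_measurable strongly_measurable_diff m gspan_strongly_measurable g)
  have "dev p (f t *\<^sub>C x - g t *\<^sub>C x) \<le> K * dev p (f t - g t)" for t
  proof -
    have "f t *\<^sub>C x - g t *\<^sub>C x = (f t - g t) *\<^sub>C x"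
      by (simp add: bounded_bilinear.diff_left[OF bounded_bilinear_scaleC])
    then have "dev p (f t *\<^sub>C x - g t *\<^sub>C x) = cmod (f t - g t) * norm x + cmod (f t - g t) powr p * norm x powr p"
      by (simp add: dev_def norm_scaleC powr_mult)
    also have "\<dots> \<le> cmod (f t - g t) * K + cmod (f t - g t) powr p * K"
      by (intro add_mono mult_left_mono K) auto
    finally show ?thesis by (simp add: dev_def algebra_simps)
  qed
  then have "(\<integral>\<^sup>+t. ennreal (dev p (f t *\<^sub>C x - g t *\<^sub>C x)) \<partial>lborel) \<le> (\<integral>\<^sup>+t. ennreal K * ennreal (dev p (f t - g t)) \<partial>lborel)"
    using K by (intro nn_integral_mono) (simp add: ennreal_mult[symmetric])
  also have "\<dots> = ennreal K * (\<integral>\<^sup>+t. ennreal (dev p (f t - g t)) \<partial>lborel)"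
    by (rule nn_integral_cmult) measurable
  also have "\<dots> \<le> ennreal K * ennreal (e / K)" by (intro mult_left_mono g) auto
  also have "\<dots> = ennreal e" using K e by (simp add: ennreal_mult[symmetric])
  finally show "\<exists>h\<in>gspan. (\<integral>\<^sup>+t. ennreal (dev p (f t *\<^sub>C x - h t)) \<partial>lborel) \<le> ennreal e"
    using gspan_scaleC_left[OF g(1), of x] by (intro bexI[of _ "\<lambda>t. g t *\<^sub>C x"])
qed

lemma approximable_sum:
  "finite I \<Longrightarrow> (\<And>i. i \<in> I \<Longrightarrow> approximable p (f i)) \<Longrightarrow> approximable p (\<lambda>x. \<Sum>i\<in>I. f i x)"
  by (induction rule: finite_induct) (auto intro: approximable_add approximable_gspan gspan.zero)

lemma approximable_diff:
  fixes f g :: "real^'n::finite \<Rightarrow> complex"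
  assumes "approximable p f" "approximable p g" shows "approximable p (\<lambda>x. f x - g x)"
  using approximable_add[OF assms(1) approximable_scaleC_left[OF assms(2), of "-1"]]
  by (simp add: scaleC_complex_def)

end

text \<open>Let \<open>G\<close> be the standard Gaussian. The bounded functions \<open>h\<close> for which \<open>h G\<close> is approximable form a vector space
  closed under bounded pointwise limits. It contains the trigonometric polynomials, hence the indicators
  of \<open>L\<close>-periodic boxes, hence (as \<open>L \<rightarrow> \<infinity>\<close>) of boxes, hence of all Borel sets.\<close>

definition gspan_multiplier :: "(real^'n::finite \<Rightarrow> complex) \<Rightarrow> bool" where
  "gspan_multiplier h \<longleftrightarrow> (\<forall>g\<in>gspan. (\<lambda>t. h t * g t) \<in> gspan)"

lemma gspan_multiplier_const: "gspan_multiplier (\<lambda>_. c)"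
  unfolding gspan_multiplier_def using gspan_scaleC[where c = c and 'b = complex] by (auto simp: scaleC_complex_def)

lemma gspan_multiplier_add:
  "gspan_multiplier f \<Longrightarrow> gspan_multiplier g \<Longrightarrow> gspan_multiplier (\<lambda>t. f t + g t)"
  unfolding gspan_multiplier_def by (auto simp: distrib_right intro: gspan_add)

lemma gspan_multiplier_mult:
  "gspan_multiplier f \<Longrightarrow> gspan_multiplier g \<Longrightarrow> gspan_multiplier (\<lambda>t. f t * g t)"
  unfolding gspan_multiplier_def by (simp add: mult.assoc)

lemma gspan_multiplier_prod:
  "finite I \<Longrightarrow> (\<And>i. i \<in> I \<Longrightarrow> gspan_multiplier (f i)) \<Longrightarrow> gspan_multiplier (\<lambda>t. \<Prod>i\<in>I. f i t)"
  by (induction rule: finite_induct) (auto intro: gspan_multiplier_const gspan_multiplier_mult)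

lemma gspan_multiplier_cis: "gspan_multiplier (\<lambda>t. cis (2 * pi * (e \<bullet> t)))"
  unfolding gspan_multiplier_def using gspan_character[where e = e and 'b = complex] by (auto simp: scaleC_complex_def)

lemma gspan_multiplier_cos: "gspan_multiplier (\<lambda>t. of_real (cos (2 * pi * (e \<bullet> t) + s)))"
proof -
  have "gspan_multiplier (\<lambda>t. cis s / 2 * cis (2 * pi * (e \<bullet> t)) + cis (- s) / 2 * cis (2 * pi * ((- e) \<bullet> t)))"
    by (intro gspan_multiplier_add gspan_multiplier_mult gspan_multiplier_const gspan_multiplier_cis)
  moreover have "cis s / 2 * cis (2 * pi * (e \<bullet> t)) + cis (- s) / 2 * cis (2 * pi * ((- e) \<bullet> t))
      = of_real (cos (2 * pi * (e \<bullet> t) + s))" for t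
    by (simp add: complex_eq_iff cos_add sin_add field_simps)
  ultimately show ?thesis by simp
qed

lemma gspan_multiplier_polynomial:
  assumes q: "real_polynomial_function (q :: real \<Rightarrow> real)" and f: "gspan_multiplier (\<lambda>t. of_real (f t))"
  shows "gspan_multiplier (\<lambda>t. of_real (q (f t)))"
  using q
proof (induction q rule: real_polynomial_function.induct)
  case (linear l)
  \<comment> \<open>A linear map of the real line is multiplication by its value at 1, hence again a
    scalar multiple of \<open>f\<close>.\<close>
  have "l x = x * l 1" for x
    using linear_scale[OF bounded_linear.linear[OF linear], of x 1] by simp
  then have "(\<lambda>t. complex_of_real (l (f t))) = (\<lambda>t. of_real (f t) * of_real (l 1))"
    by (metis of_real_mult)
  then show ?case by (simp only:) (intro gspan_multiplier_mult f gspan_multiplier_const)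
qed (auto intro: gspan_multiplier_const gspan_multiplier_add gspan_multiplier_mult)

text \<open>Continuous ramps converge to the step boundedly and pointwise; the Weierstrass theorem
  replaces the n-th ramp by a polynomial with error below 1/(n+1), which also explains the bound
  2.\<close>

lemma polynomial_step_approximation:
  obtains q :: "nat \<Rightarrow> real \<Rightarrow> real" where "\<And>n. real_polynomial_function (q n)"
    "\<And>n x. x \<in> {-1..1} \<Longrightarrow> \<bar>q n x\<bar> \<le> 2"
    "\<And>x. x \<in> {-1..1} \<Longrightarrow> (\<lambda>n. q n x) \<longlonglongrightarrow> (if \<alpha> < x then 1 else 0)"
proof -
  \<comment> \<open>The ramp vanishes up to and including \<alpha>, matching the strict inequality
    in the step, and rises with slope n.\<close>
  define \<phi> where "\<phi> n x = min 1 (max 0 (real n * (x - \<alpha>)))" for n x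
  have "\<exists>q. real_polynomial_function q \<and> (\<forall>x\<in>{-1..1}. \<bar>\<phi> n x - q x\<bar> < 1 / Suc n)" for n
  proof -
    have "continuous_on {-1..1} (\<phi> n)" unfolding \<phi>_def by (intro continuous_intros)
    then show ?thesis
      using Stone_Weierstrass_real_polynomial_function[of "{-1..1::real}" "\<phi> n" "1 / Suc n"]
      by (metis compact_Icc divide_pos_pos of_nat_0_less_iff zero_less_Suc zero_less_one)
  qed
  then obtain q where q: "\<And>n. real_polynomial_function (q n)" "\<And>n x. x \<in> {-1..1} \<Longrightarrow> \<bar>\<phi> n x - q n x\<bar> < 1 / Suc n"
    by metis
  show ?thesis
  proof (rule that[OF q(1)])
    fix x :: real assume x: "x \<in> {-1..1}"
    have "1 / real (Suc n) \<le> 1" for n by simp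
    moreover have "\<bar>\<phi> n x\<bar> \<le> 1" for n by (auto simp: \<phi>_def)
    ultimately show "\<bar>q n x\<bar> \<le> 2" for n using q(2)[OF x, of n] by (smt (verit))
    have "(\<lambda>n. \<phi> n x) \<longlonglongrightarrow> (if \<alpha> < x then 1 else 0)"
    proof (cases "\<alpha> < x")
      case True
      then obtain N where N: "1 / (x - \<alpha>) < real N" using reals_Archimedean2 by blast
      have "\<phi> n x = 1" if "n \<ge> N" for n
      proof -
        have "1 / (x - \<alpha>) \<le> real n" using N that by linarith
        then have "1 \<le> real n * (x - \<alpha>)" using True by (simp add: divide_le_eq)
        then show ?thesis by (simp add: \<phi>_def)
      qed
      then show ?thesis using True by (intro tendsto_eventually) (auto simp: eventually_sequentially)
    next
      case False
      then have "real n * (x - \<alpha>) \<le> 0" for n by (simp add: mult_nonneg_nonpos)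
      then have "\<phi> n x = 0" for n by (simp add: \<phi>_def max.absorb1)
      then show ?thesis using False by simp
    qed
    moreover have "(\<lambda>n. q n x - \<phi> n x) \<longlonglongrightarrow> 0"
    proof (rule Lim_null_comparison)
      show "\<forall>\<^sub>F n in sequentially. norm (q n x - \<phi> n x) \<le> 1 / real (Suc n)"
        using q(2)[OF x] by (intro always_eventually allI) (metis abs_minus_commute less_imp_le real_norm_def)
      show "(\<lambda>n. 1 / real (Suc n)) \<longlonglongrightarrow> 0" using LIMSEQ_inverse_real_of_nat by (simp add: inverse_eq_divide)
    qed
    ultimately show "(\<lambda>n. q n x) \<longlonglongrightarrow> (if \<alpha> < x then 1 else 0)"
      using tendsto_add by fastforce
  qed
qed


text \<open>The Gaussian supplies the majorant: it is integrable, and since it is at most 1 its p-th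
  power is integrable too.\<close>

lemma approximable_multiplier_gauss:
  assumes p: "1 \<le> p" "p \<le> 2" and h: "\<And>n. approximable p (\<lambda>t. h n t * gauss 0 0 t)"
    and lim: "\<And>t. (\<lambda>n. h n t) \<longlonglongrightarrow> k t" and bound: "\<And>n t. cmod (h n t) \<le> M"
  shows "approximable p (\<lambda>t. k t * gauss 0 0 t)"
proof (rule approximable_dominated[OF p h])
  have M: "0 \<le> M" using bound[of 0 0] norm_ge_zero order_trans by blast
  have G: "integrable lborel (\<lambda>t::real^'a. cmod (gauss 0 0 t))" by (intro integrable_norm integrable_gauss)
  show "integrable lborel (\<lambda>t::real^'a. M * cmod (gauss 0 0 t))" using G by simp
  show "integrable lborel (\<lambda>t::real^'a. (M * cmod (gauss 0 0 t)) powr p)"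
  proof (rule Bochner_Integration.integrable_bound[where f = "\<lambda>t::real^'a. M powr p * cmod (gauss 0 0 t)"])
    show "AE t::real^'a in lborel. norm ((M * cmod (gauss 0 0 t)) powr p) \<le> norm (M powr p * cmod (gauss 0 0 t))"
    proof (rule AE_I2)
      fix t :: "real^'a"
      have "cmod (gauss 0 0 t) powr p \<le> cmod (gauss 0 0 t) powr 1"
        using p by (intro powr_mono') (auto simp: norm_gauss)
      then show "norm ((M * cmod (gauss 0 0 t)) powr p) \<le> norm (M powr p * cmod (gauss 0 0 t))"
        using M by (simp add: powr_mult mult_left_mono)
    qed
  qed (use G in auto)
  show "(\<lambda>n. h n t * gauss 0 0 t) \<longlonglongrightarrow> k t * gauss 0 0 t" for t
    by (intro tendsto_mult lim tendsto_const)
  show "cmod (h n t * gauss 0 0 t) \<le> M * cmod (gauss 0 0 t)" for n t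
    unfolding norm_mult by (intro mult_right_mono bound) simp
qed

text \<open>A threshold on cos(2 pi (t_j - s_j) / L) selects a periodic family of intervals, and a
  step function of the cosine is a bounded limit of polynomials in it, that is, of trigonometric
  polynomials.\<close>

lemma approximable_periodic_box:
  fixes s :: "real^'n::finite"
  assumes p: "1 \<le> p" "p \<le> 2"
  shows "approximable p (\<lambda>t. (\<Prod>j\<in>UNIV. if \<alpha> j < cos (2 * pi * (t $ j - s $ j) / L) then 1 else 0) * gauss 0 0 t)"
proof -
  have "\<exists>q. (\<forall>n. real_polynomial_function (q n)) \<and> (\<forall>n. \<forall>x\<in>{-1..1}. \<bar>q n x\<bar> \<le> 2) \<and>
      (\<forall>x\<in>{-1..1}. (\<lambda>n. q n x) \<longlonglongrightarrow> (if \<alpha> j < x then 1 else 0))" for j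
    using polynomial_step_approximation[of "\<alpha> j"] by metis
  then obtain q where q: "\<And>j n. real_polynomial_function (q j n)" "\<And>j n x. x \<in> {-1..1} \<Longrightarrow> \<bar>q j n x\<bar> \<le> 2"
     "\<And>j x. x \<in> {-1..1} \<Longrightarrow> (\<lambda>n. q j n x) \<longlonglongrightarrow> (if \<alpha> j < x then 1 else 0)"
    by metis
  define c where "c j t = cos (2 * pi * (t $ j - s $ j) / L)" for j and t :: "real^'n"
  have c: "c j t \<in> {-1..1}" for j t by (simp add: c_def)
  have mult: "gspan_multiplier (\<lambda>t. complex_of_real (c j t))" for j
  proof -
    have "2 * pi * ((inverse L *\<^sub>R axis j 1) \<bullet> t) + (- 2 * pi * s $ j / L) = 2 * pi * (t $ j - s $ j) / L" for t :: "real^'n"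
      by (simp add: inner_axis' divide_inverse algebra_simps)
    then show ?thesis
      using gspan_multiplier_cos[of "inverse L *\<^sub>R axis j 1" "- 2 * pi * s $ j / L"] by (simp add: c_def)
  qed
  show ?thesis
  proof (rule approximable_multiplier_gauss[OF p, where h = "\<lambda>n t. \<Prod>j\<in>UNIV. of_real (q j n (c j t))" and M = "2 ^ CARD('n)"])
    show "approximable p (\<lambda>t. (\<Prod>j\<in>UNIV. of_real (q j n (c j t))) * gauss 0 0 t)" for n
    proof (rule approximable_gspan[OF p])
      have "gspan_multiplier (\<lambda>t. \<Prod>j\<in>UNIV. complex_of_real (q j n (c j t)))"
        by (rule gspan_multiplier_prod[OF finite gspan_multiplier_polynomial[OF q(1) mult]])
      moreover have "gauss 0 0 \<in> gspan" using gspan_gauss[of 0 0 "1::complex"] by (simp add: scaleC_complex_def)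
      ultimately show "(\<lambda>t. (\<Prod>j\<in>UNIV. of_real (q j n (c j t))) * gauss 0 0 t) \<in> gspan"
        unfolding gspan_multiplier_def by blast
    qed
    show "(\<lambda>n. \<Prod>j\<in>UNIV. complex_of_real (q j n (c j t))) \<longlonglongrightarrow>
        (\<Prod>j\<in>UNIV. if \<alpha> j < cos (2 * pi * (t $ j - s $ j) / L) then 1 else 0)" for t
    proof (rule tendsto_prod)
      fix j
      show "(\<lambda>n. complex_of_real (q j n (c j t))) \<longlonglongrightarrow> (if \<alpha> j < cos (2 * pi * (t $ j - s $ j) / L) then 1 else 0)"
      proof -
        have "(\<lambda>n. complex_of_real (q j n (c j t))) \<longlonglongrightarrow> of_real (if \<alpha> j < c j t then 1 else 0)"
          by (rule tendsto_of_real[OF q(3)[OF c]])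
        then show ?thesis by (cases "\<alpha> j < c j t") (simp_all add: c_def)
      qed
    qed
    show "cmod (\<Prod>j\<in>UNIV. of_real (q j n (c j t))) \<le> 2 ^ CARD('n)" for n t
    proof -
      have "cmod (\<Prod>j\<in>UNIV. of_real (q j n (c j t))) = (\<Prod>j\<in>UNIV. \<bar>q j n (c j t)\<bar>)"
        by (simp add: prod_norm[symmetric])
      also have "\<dots> \<le> (\<Prod>j\<in>(UNIV::'n set). 2)"
        by (intro prod_mono) (use q(2)[OF c] in auto)
      finally show ?thesis by simp
    qed
  qed
qed

text \<open>Cosine decreases on [0, pi], so within half a period comparing cosines is comparing
  distances to the centre. At a given point, the other periodic copies of the box have moved away
  once the period is large.\<close>

lemma approximable_box:
  fixes a b :: "real^'n::finite"
  assumes p: "1 \<le> p" "p \<le> 2"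
  shows "approximable p (\<lambda>t. of_bool (t \<in> box a b) * gauss 0 0 t)"
proof (cases "box a b = {}")
  case True
  then show ?thesis by (simp add: approximable_gspan[OF p] gspan.zero)
next
  case False
  then have ab: "a $ j < b $ j" for j by (metis all_not_in_conv less_trans mem_box_cart(1))
  define s where "s = (1/2) *\<^sub>R (a + b)"
  define w where "w j = (b $ j - a $ j) / 2" for j
  have w: "0 < w j" for j using ab by (simp add: w_def)
  have inbox: "t \<in> box a b \<longleftrightarrow> (\<forall>j. \<bar>t $ j - s $ j\<bar> < w j)" for t
    unfolding mem_box_cart by (rule iff_allI) (auto simp: s_def w_def abs_less_iff field_simps)
  show ?thesis
  proof (rule approximable_multiplier_gauss[OF p, where M = 1 and
      h = "\<lambda>n t. \<Prod>j\<in>UNIV. if cos (2 * pi * w j / real n) < cos (2 * pi * (t $ j - s $ j) / real n) then 1 else 0"])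
    show "approximable p (\<lambda>t. (\<Prod>j\<in>UNIV. if cos (2 * pi * w j / real n) < cos (2 * pi * (t $ j - s $ j) / real n) then 1 else 0) * gauss 0 0 t)" for n
      by (rule approximable_periodic_box[OF p])
    show "(\<lambda>n. (\<Prod>j\<in>UNIV. if cos (2 * pi * w j / real n) < cos (2 * pi * (t $ j - s $ j) / real n) then 1 else 0)) \<longlonglongrightarrow> (of_bool (t \<in> box a b) :: complex)" for t
    proof (rule tendsto_eventually)
      \<comment> \<open>Puts each \<open>w j\<close> and each distance to the centre below half the
        period. At n = 0 division by zero makes the product 0, which does not affect the
        limit.\<close>
      obtain N :: nat where N: "2 * (\<Sum>j\<in>UNIV. w j + \<bar>t $ j - s $ j\<bar>) < real N" using reals_Archimedean2 by blast
      have le: "w j + \<bar>t $ j - s $ j\<bar> \<le> (\<Sum>j\<in>UNIV. w j + \<bar>t $ j - s $ j\<bar>)" for j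
        using w by (intro member_le_sum) (auto simp: less_imp_le add_nonneg_nonneg)
      have iff: "cos (2 * pi * w j / real n) < cos (2 * pi * (t $ j - s $ j) / real n) \<longleftrightarrow> \<bar>t $ j - s $ j\<bar> < w j" if n: "N \<le> n" for j n
      proof -
        have n0: "2 * w j + 2 * \<bar>t $ j - s $ j\<bar> < real n" using N le[of j] n by simp
        have npos: "0 < real n"
          by (rule less_trans[OF _ n0]) (simp add: add_pos_nonneg w)
        have "cos (2 * pi * (t $ j - s $ j) / real n) = cos \<bar>2 * pi * (t $ j - s $ j) / real n\<bar>" by (rule cos_abs_real[symmetric])
        also have "\<bar>2 * pi * (t $ j - s $ j) / real n\<bar> = 2 * pi * \<bar>t $ j - s $ j\<bar> / real n"
          by (simp add: abs_mult)
        finally have e: "cos (2 * pi * (t $ j - s $ j) / real n) = cos (2 * pi * \<bar>t $ j - s $ j\<bar> / real n)" .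
        have bd: "2 * pi * x / real n \<le> pi" if "2 * x \<le> real n" for x
          using mult_left_mono[OF that, of pi] npos by (simp add: divide_le_eq mult_ac)
        have "cos (2 * pi * w j / real n) < cos (2 * pi * \<bar>t $ j - s $ j\<bar> / real n)
            \<longleftrightarrow> 2 * pi * \<bar>t $ j - s $ j\<bar> / real n < 2 * pi * w j / real n"
        proof (intro cos_mono_less_eq bd)
          show "2 * w j \<le> real n" by (rule order_trans[OF _ less_imp_le[OF n0]]) simp
          show "2 * \<bar>t $ j - s $ j\<bar> \<le> real n"
            by (rule order_trans[OF _ less_imp_le[OF n0]]) (use w[of j] in simp)
        qed (use w[of j] in auto)
        also have "\<dots> \<longleftrightarrow> \<bar>t $ j - s $ j\<bar> < w j" using npos by (simp add: divide_less_cancel)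
        finally show ?thesis unfolding e .
      qed
      have "(\<Prod>j\<in>UNIV. if cos (2 * pi * w j / real n) < cos (2 * pi * (t $ j - s $ j) / real n) then 1 else 0) = (of_bool (t \<in> box a b) :: complex)"
        if "N \<le> n" for n
        unfolding inbox iff[OF that] by (auto simp: prod_zero_iff)
      then show "\<forall>\<^sub>F n in sequentially. (\<Prod>j\<in>UNIV. if cos (2 * pi * w j / real n) < cos (2 * pi * (t $ j - s $ j) / real n) then 1 else 0) = (of_bool (t \<in> box a b) :: complex)"
        unfolding eventually_sequentially by blast
    qed
    show "cmod (\<Prod>j\<in>UNIV. if cos (2 * pi * w j / real n) < cos (2 * pi * (t $ j - s $ j) / real n) then 1 else 0) \<le> 1" for n t
      unfolding prod_norm[symmetric] by (intro prod_le_1) auto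
  qed
qed

text \<open>Dynkin's theorem: boxes are stable under intersection, a complement is the Gaussian
  minus an approximable function, and a disjoint union is a bounded pointwise limit of finite
  sums.\<close>

lemma approximable_borel:
  fixes A :: "(real^'n::finite) set"
  assumes p: "1 \<le> p" "p \<le> 2" and A: "A \<in> sets borel"
  shows "approximable p (\<lambda>t. of_bool (t \<in> A) * gauss 0 0 t)"
proof -
  let ?E = "range (\<lambda>(a, b). box a b :: (real^'n) set)"
  have mem: "A \<in> sigma_sets UNIV ?E"
    using A unfolding borel_eq_box by simp
  have "Int_stable ?E"
    unfolding Int_stable_def by (auto simp: box_Int_box)
  from this subset_UNIV[of ?E, folded Pow_UNIV] mem show ?thesis
  proof (induction rule: sigma_sets_induct_disjoint)
    case empty then show ?case by (simp add: approximable_gspan[OF p] gspan.zero)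
  next
    case (basic A) then show ?case using approximable_box[OF p] by auto
  next
    case (compl A)
    have "gauss 0 0 \<in> gspan" using gspan_gauss[of 0 0 "1::complex"] by (simp add: scaleC_complex_def)
    from approximable_diff[OF p approximable_gspan[OF p this] compl(2)]
    show ?case by (rule back_subst[of "approximable p"]) auto
  next
    case (union A)
    show ?case
    proof (rule approximable_multiplier_gauss[OF p, where M = 1 and h = "\<lambda>n t. \<Sum>i<n. of_bool (t \<in> A i)"])
      show "approximable p (\<lambda>t. (\<Sum>i<n. of_bool (t \<in> A i)) * gauss 0 0 t)" for n
        unfolding sum_distrib_right by (intro approximable_sum[OF p] union) auto
      have eq: "(\<Sum>i<n. of_bool (t \<in> A i)) = (of_bool (t \<in> (\<Union>i<n. A i)) :: complex)" for n t
      proof (induction n)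
        case (Suc n)
        have "\<not> (t \<in> A n \<and> t \<in> (\<Union>i<n. A i))"
          using union(1) by (auto simp: disjoint_family_on_def dest!: bspec) (metis IntI empty_iff less_irrefl)
        then show ?case unfolding sum.lessThan_Suc Suc by (auto simp: lessThan_Suc)
      qed simp
      show "cmod (\<Sum>i<n. of_bool (t \<in> A i)) \<le> 1" for n t
        unfolding eq by simp
      show "(\<lambda>n. \<Sum>i<n. of_bool (t \<in> A i)) \<longlonglongrightarrow> (of_bool (t \<in> \<Union> (range A)) :: complex)" for t
        unfolding eq
      proof (rule tendsto_eventually)
        show "\<forall>\<^sub>F n in sequentially. of_bool (t \<in> (\<Union>i<n. A i)) = (of_bool (t \<in> \<Union> (range A)) :: complex)"
        proof (cases "\<exists>i. t \<in> A i")
          case True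
          then obtain i where i: "t \<in> A i" by blast
          show ?thesis unfolding eventually_sequentially
            using i by (intro exI[of _ "Suc i"]) (auto intro!: bexI[of _ i])
        qed auto
      qed
    qed
  qed
qed

lemma approximable_bounded_gauss:
  fixes h :: "real^'n::finite \<Rightarrow> complex"
  assumes p: "1 \<le> p" "p \<le> 2" and h: "h \<in> borel_measurable borel" "\<And>t. cmod (h t) \<le> M"
  shows "approximable p (\<lambda>t. h t * gauss 0 0 t)"
proof -
  obtain s where s: "\<And>i. simple_function lborel (s i)" "\<And>x. (\<lambda>i. s i x) \<longlonglongrightarrow> h x"
    "\<And>i x. cmod (s i x) \<le> 4 * cmod (h x)"
    using strongly_measurable_approx[of lborel h] h(1) by (auto simp: strongly_measurable_iff_borel)
  show ?thesis
  proof (rule approximable_multiplier_gauss[OF p, where h = s and M = "4 * M"])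
    show "cmod (s i t) \<le> 4 * M" for i t using s(3)[of i t] h(2)[of t] by simp
    fix i
    have fin: "finite (range (s i))" using s(1)[of i] by (simp add: simple_function_def)
    have decomp: "s i t = (\<Sum>y\<in>range (s i). of_bool (t \<in> s i -` {y}) * y)" for t
    proof -
      have "(\<Sum>y\<in>range (s i). of_bool (t \<in> s i -` {y}) * y) = (\<Sum>y\<in>range (s i). if y = s i t then y else 0)"
        by (intro sum.cong) auto
      also have "\<dots> = s i t" using fin by (simp add: sum.delta)
      finally show ?thesis by simp
    qed
    have "s i t * gauss 0 0 t = (\<Sum>y\<in>range (s i). (of_bool (t \<in> s i -` {y}) * gauss 0 0 t) *\<^sub>C y)" for t
    proof -
      have "s i t * gauss 0 0 t = (\<Sum>y\<in>range (s i). of_bool (t \<in> s i -` {y}) * y) * gauss 0 0 t"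
        by (rule arg_cong[OF decomp])
      also have "\<dots> = (\<Sum>y\<in>range (s i). (of_bool (t \<in> s i -` {y}) * gauss 0 0 t) *\<^sub>C y)"
        unfolding sum_distrib_right scaleC_complex_def by (intro sum.cong) (simp_all add: mult_ac)
      finally show ?thesis .
    qed
    moreover have "approximable p (\<lambda>t. \<Sum>y\<in>range (s i). (of_bool (t \<in> s i -` {y}) * gauss 0 0 t) *\<^sub>C y)"
      using simple_functionD(2)[OF s(1)[of i]]
      by (intro approximable_sum[OF p fin] approximable_scaleC_left[OF p] approximable_borel[OF p]) auto
    ultimately show "approximable p (\<lambda>t. s i t * gauss 0 0 t)" by simp
  qed (rule s(2))
qed

text \<open>On a ball the reciprocal of the Gaussian is bounded, so the truncated indicator is a
  bounded function times the Gaussian. The truncation is removed with the indicator of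
  \<open>A\<close> as majorant, which is where finite measure enters.\<close>

lemma approximable_indicator:
  fixes A :: "(real^'n::finite) set"
  assumes p: "1 \<le> p" "p \<le> 2" and A: "A \<in> sets borel" "emeasure lborel A < \<infinity>"
  shows "approximable p (\<lambda>t. of_bool (t \<in> A) :: complex)"
proof (rule approximable_dominated[OF p, where w = "indicator A"])
  fix n :: nat
  define B where "B = A \<inter> cball 0 (real n)"
  have "approximable p (\<lambda>t. (of_bool (t \<in> B) / gauss 0 0 t) * gauss 0 0 t)"
  proof (rule approximable_bounded_gauss[OF p])
    have [measurable]: "gauss 0 0 \<in> borel_measurable (borel :: (real^'n) measure)"
      by (intro borel_measurable_continuous_onI continuous_on_gauss)
    have [measurable]: "B \<in> sets borel" unfolding B_def using A by auto
    show "(\<lambda>t. of_bool (t \<in> B) / gauss 0 0 t) \<in> borel_measurable borel"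
      by measurable
    show "cmod (of_bool (t \<in> B) / gauss 0 0 t) \<le> exp (pi * (real n)\<^sup>2)" for t
    proof (cases "t \<in> B")
      case True
      then have "(norm t)\<^sup>2 \<le> (real n)\<^sup>2" unfolding B_def by (intro power_mono) auto
      then show ?thesis using True by (simp add: norm_divide norm_gauss exp_minus inverse_eq_divide)
    qed simp
  qed
  moreover have "gauss 0 0 t \<noteq> 0" for t :: "real^'n" by (simp add: gauss_def)
  ultimately show "approximable p (\<lambda>t. of_bool (t \<in> A \<inter> cball 0 (real n)) :: complex)" by (simp add: B_def)
  show "norm (of_bool (t \<in> A \<inter> cball 0 (real n)) :: complex) \<le> indicator A t" for t
    by (auto simp: indicator_def)
next
  fix t :: "real^'n"
  obtain N :: nat where "norm t \<le> real N" using real_arch_simple by blast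
  then have "\<forall>n\<ge>N. of_bool (t \<in> A \<inter> cball 0 (real n)) = (of_bool (t \<in> A) :: complex)" by auto
  then show "(\<lambda>n. of_bool (t \<in> A \<inter> cball 0 (real n))) \<longlonglongrightarrow> (of_bool (t \<in> A) :: complex)"
    by (intro tendsto_eventually) (unfold eventually_sequentially, blast)
next
  show "integrable lborel (indicator A :: _ \<Rightarrow> real)" using A by (simp add: integrable_indicator_iff)
  moreover have "indicator A t powr p = (indicator A t :: real)" for t using p by (simp add: indicator_def)
  ultimately show "integrable lborel (\<lambda>t. indicator A t powr p :: real)" by simp
qed

theorem approximable_Lp:
  fixes f :: "real^'n::finite \<Rightarrow> 'a::complex_banach"
  assumes p: "1 \<le> p" "p \<le> 2" and f: "strongly_integrable lborel f" "integrable lborel (\<lambda>t. norm (f t) powr p)"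
  shows "approximable p f"
proof -
  obtain s where s: "\<And>i. simple_function lborel (s i)" "\<And>x. (\<lambda>i. s i x) \<longlonglongrightarrow> f x"
    "\<And>i x. norm (s i x) \<le> 4 * norm (f x)"
    using strongly_measurable_approx[of lborel f] f(1) by (auto simp: strongly_integrable_def)
  have fi: "integrable lborel (\<lambda>t. norm (f t))" using f by (simp add: strongly_integrable_def)
  show ?thesis
  proof (rule approximable_dominated[OF p _ s(2) s(3)])
    show "integrable lborel (\<lambda>t. 4 * norm (f t))" using fi by simp
    show "integrable lborel (\<lambda>t. (4 * norm (f t)) powr p)" using f by (simp add: powr_mult)
    fix i
    have fin: "finite (range (s i))" using s(1)[of i] by (simp add: simple_function_def)
    \<comment> \<open>The value 0 is left out because its level set may have infinite
      measure.\<close>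
    have "s i t = (\<Sum>y\<in>range (s i) - {0}. of_bool (t \<in> s i -` {y}) *\<^sub>C y)" for t
    proof -
      have "(\<Sum>y\<in>range (s i) - {0}. of_bool (t \<in> s i -` {y}) *\<^sub>C y) = (\<Sum>y\<in>range (s i) - {0}. if y = s i t then y else 0)"
        by (intro sum.cong) auto
      also have "\<dots> = s i t" using fin by (simp add: sum.delta)
      finally show ?thesis by simp
    qed
    moreover have "approximable p (\<lambda>t. \<Sum>y\<in>range (s i) - {0}. of_bool (t \<in> s i -` {y}) *\<^sub>C y)"
    proof (intro approximable_sum[OF p] approximable_scaleC_left[OF p] approximable_indicator[OF p])
      fix y assume y: "y \<in> range (s i) - {0}"
      show m: "s i -` {y} \<in> sets borel" using simple_functionD(2)[OF s(1)[of i], of "{y}"] by simp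
      \<comment> \<open>Chebyshev: where \<open>s i t = y\<close>, the domination gives norm y \<le>
        4 norm (f t).\<close>
      have "integrable lborel (indicator (s i -` {y}) :: _ \<Rightarrow> real)"
      proof (rule Bochner_Integration.integrable_bound[where f = "\<lambda>t. 4 / norm y * norm (f t)"])
        show "AE t in lborel. norm (indicator (s i -` {y}) t :: real) \<le> norm (4 / norm y * norm (f t))"
        proof (rule AE_I2)
          fix t
          show "norm (indicator (s i -` {y}) t :: real) \<le> norm (4 / norm y * norm (f t))"
            using y s(3)[of i t] by (cases "s i t = y") (auto simp: field_simps)
        qed
      qed (use fi m in auto)
      then show "emeasure lborel (s i -` {y}) < \<infinity>" using m by (simp add: integrable_indicator_iff)
    qed (use fin in auto)
    ultimately show "approximable p (s i)" by simp
  qed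
qed

text \<open>The form in which density is used: closeness is kept in L^1 only, while for L^p a bound
  on the approximant suffices.\<close>

lemma gspan_approximation:
  fixes f :: "real^'n::finite \<Rightarrow> 'a::complex_banach"
  assumes p: "1 \<le> p" "p \<le> 2" and f: "strongly_integrable lborel f" "integrable lborel (\<lambda>t. norm (f t) powr p)"
    and e: "0 < e"
  obtains g where "g \<in> gspan" "(LBINT t. norm (f t - g t)) \<le> e"
    "integrable lborel (\<lambda>t. norm (g t) powr p)"
    "(LBINT t. norm (g t) powr p) \<le> 4 * ((LBINT t. norm (f t) powr p) + e)"
proof -
  obtain g where g: "g \<in> gspan" and ge: "(\<integral>\<^sup>+t. ennreal (dev p (f t - g t)) \<partial>lborel) \<le> ennreal e"
    using approximable_Lp[OF p f] e unfolding approximable_def by blast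
  have gi: "strongly_integrable lborel g" by (rule gspan_integrable[OF g])
  have d: "strongly_integrable lborel (\<lambda>t. f t - g t)" by (rule strongly_integrable_diff[OF f(1) gi])
  have dm: "(\<lambda>t. dev p (f t - g t)) \<in> borel_measurable lborel" "(\<lambda>t. norm (f t - g t)) \<in> borel_measurable lborel"
      "(\<lambda>t. norm (g t)) \<in> borel_measurable lborel"
    using d gi by (auto simp: strongly_integrable_def intro: dev_measurable)
  have di: "integrable lborel (\<lambda>t. dev p (f t - g t))"
    using ge dm by (intro integrableI_bounded) (auto intro: le_less_trans)
  have de: "(LBINT t. dev p (f t - g t)) \<le> e"
    using ge e di by (subst (asm) nn_integral_eq_integral) auto
  have dp: "integrable lborel (\<lambda>t. norm (f t - g t) powr p)"
    by (rule Bochner_Integration.integrable_bound[OF di]) (use dm in \<open>auto simp: dev_def\<close>)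
  have 1: "(LBINT t. norm (f t - g t)) \<le> e"
    using d by (intro order_trans[OF integral_mono de] di) (auto simp: strongly_integrable_def dev_def)
  have 2: "(LBINT t. norm (f t - g t) powr p) \<le> e"
    by (intro order_trans[OF integral_mono de] di dp) (auto simp: dev_def)
  have le: "norm (g t) powr p \<le> 4 * (norm (f t) powr p + norm (f t - g t) powr p)" for t
  proof -
    have "norm (g t) powr p \<le> (norm (f t) + norm (f t - g t)) powr p"
      using p norm_triangle_ineq4[of "f t" "f t - g t"] by (intro powr_mono2) auto
    also have "\<dots> \<le> 4 * (norm (f t) powr p + norm (f t - g t) powr p)" by (intro powr_add_le p) auto
    finally show ?thesis .
  qed
  have int: "integrable lborel (\<lambda>t. 4 * (norm (f t) powr p + norm (f t - g t) powr p))" using f dp by auto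
  have 3: "integrable lborel (\<lambda>t. norm (g t) powr p)"
    by (rule Bochner_Integration.integrable_bound[OF int]) (use dm le in auto)
  have "(LBINT t. norm (g t) powr p) \<le> (LBINT t. 4 * (norm (f t) powr p + norm (f t - g t) powr p))"
    by (rule integral_mono[OF 3 int le])
  also have "\<dots> \<le> 4 * ((LBINT t. norm (f t) powr p) + e)"
    using 2 f dp by simp
  finally show ?thesis using that[OF g 1 3] by blast
qed

section \<open>Duality\<close>

text \<open>A bare pointwise choice, not claimed to be measurable; below it is composed with simple
  functions only.\<close>

lemma norming_map:
  obtains \<phi> :: "'a::complex_banach \<Rightarrow> 'a cdual" where "\<And>y. norm (\<phi> y) \<le> 1" "\<And>y. clinop_apply (\<phi> y) y = of_real (norm y)"
  using norming_functional by metis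

lemma clinop_apply_measurable:
  assumes "strongly_measurable M f" "strongly_measurable M (g :: _ \<Rightarrow> 'a::complex_banach)"
  shows "(\<lambda>x. clinop_apply (f x :: 'a cdual) (g x)) \<in> borel_measurable M"
  using strongly_measurable_bilinear[OF bounded_bilinear_clinop_apply assms] by (simp add: strongly_measurable_iff_borel)

lemma clinop_apply_integrable:
  fixes g :: "_ \<Rightarrow> 'a::complex_banach"
  assumes f: "strongly_integrable M (f :: _ \<Rightarrow> 'a cdual)" and g: "strongly_measurable M g" "\<And>x. norm (g x) \<le> K"
  shows "integrable M (\<lambda>x. clinop_apply (f x) (g x))"
proof (rule Bochner_Integration.integrable_bound[where f = "\<lambda>x. norm (f x) * K"])
  show "integrable M (\<lambda>x. norm (f x) * K)" using f by (simp add: strongly_integrable_def)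
  show "(\<lambda>x. clinop_apply (f x) (g x)) \<in> borel_measurable M"
    using f g by (auto intro: clinop_apply_measurable simp: strongly_integrable_def)
  show "AE x in M. norm (clinop_apply (f x) (g x)) \<le> norm (norm (f x) * K)"
  proof (rule AE_I2)
    fix x
    have "norm (clinop_apply (f x) (g x)) \<le> norm (f x) * K"
      by (rule order_trans[OF norm_clinop_apply_le mult_left_mono[OF g(2)]]) simp
    then show "norm (clinop_apply (f x) (g x)) \<le> norm (norm (f x) * K)" by simp
  qed
qed

lemma norm_integral_clinop_apply_le:
  fixes g :: "_ \<Rightarrow> 'a::complex_banach"
  assumes f: "strongly_integrable M (f :: _ \<Rightarrow> 'a cdual)" and g: "strongly_measurable M g" "\<And>x. norm (g x) \<le> K"
  shows "cmod (\<integral>x. clinop_apply (f x) (g x) \<partial>M) \<le> K * (\<integral>x. norm (f x) \<partial>M)"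
proof -
  have "cmod (\<integral>x. clinop_apply (f x) (g x) \<partial>M) \<le> (\<integral>x. cmod (clinop_apply (f x) (g x)) \<partial>M)"
    by (rule integral_norm_bound)
  also have "\<dots> \<le> (\<integral>x. K * norm (f x) \<partial>M)"
  proof (rule integral_mono)
    show "integrable M (\<lambda>x. cmod (clinop_apply (f x) (g x)))"
      by (intro integrable_norm clinop_apply_integrable[OF f g])
    show "integrable M (\<lambda>x. K * norm (f x))" using f by (simp add: strongly_integrable_def)
    show "cmod (clinop_apply (f x) (g x)) \<le> K * norm (f x)" for x
      using order_trans[OF norm_clinop_apply_le mult_left_mono[OF g(2) norm_ge_zero]] by (simp add: mult.commute)
  qed
  finally show ?thesis by simp
qed

section \<open>Simple functions supported on sets of finite measure\<close>

definition finite_simple :: "'v measure \<Rightarrow> ('v \<Rightarrow> 'a::real_normed_vector) \<Rightarrow> bool" where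
  "finite_simple M f \<longleftrightarrow> simple_function M f \<and> emeasure M {x\<in>space M. f x \<noteq> 0} < \<infinity>"

text \<open>Finitely many values make any map \<open>h\<close> admissible: choices of functionals,
  negative powers of the norm, quadratic maps into operator spaces. The condition
  \<open>h 0 = 0\<close> preserves the finite support.\<close>

lemma finite_simple_compose:
  assumes "finite_simple M f" "h 0 = 0" shows "finite_simple M (\<lambda>x. h (f x))"
proof -
  have sf: "simple_function M f" using assms by (simp add: finite_simple_def)
  have m: "{x\<in>space M. f x \<noteq> 0} \<in> sets M"
    using simple_functionD(2)[OF sf, of "UNIV - {0}"] by (simp add: vimage_def Int_def conj_commute)
  have "emeasure M {x\<in>space M. h (f x) \<noteq> 0} \<le> emeasure M {x\<in>space M. f x \<noteq> 0}"
    using assms(2) by (intro emeasure_mono m) auto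
  then show ?thesis
    using assms simple_function_compose1[OF sf, of h] by (auto simp: finite_simple_def intro: le_less_trans)
qed

lemma finite_simple_integrable:
  assumes "finite_simple M f" shows "strongly_integrable M f"
proof -
  have f: "simple_function M f" "emeasure M {x\<in>space M. f x \<noteq> 0} < \<infinity>" using assms by (auto simp: finite_simple_def)
  have m: "{x\<in>space M. f x \<noteq> 0} \<in> sets M"
    using simple_functionD(2)[OF f(1), of "UNIV - {0}"] by (simp add: vimage_def Int_def conj_commute)
  have sm: "strongly_measurable M f" by (rule strongly_measurable_simple[OF f(1)])
  have fin: "finite (f ` space M)" using f(1) by (simp add: simple_function_def)
  define K where "K = (\<Sum>y\<in>f ` space M. norm y)"
  have "integrable M (\<lambda>x. K * indicator {x\<in>space M. f x \<noteq> 0} x)"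
    using f m by (intro integrable_mult_right) (simp add: integrable_indicator_iff)
  then have "integrable M (\<lambda>x. norm (f x))"
  proof (rule Bochner_Integration.integrable_bound[OF _ borel_measurable_norm_strong[OF sm]])
    show "AE x in M. norm (norm (f x)) \<le> norm (K * indicator {x\<in>space M. f x \<noteq> 0} x)"
    proof (rule AE_I2)
      fix x assume x: "x \<in> space M"
      have "norm (f x) \<le> K" unfolding K_def using x by (intro member_le_sum fin) auto
      then show "norm (norm (f x)) \<le> norm (K * indicator {x\<in>space M. f x \<noteq> 0} x)"
        using x by (auto simp: indicator_def)
    qed
  qed
  with sm show ?thesis by (simp add: strongly_integrable_def)
qed

lemma finite_simple_integrable_powr:
  assumes "finite_simple M f" shows "integrable M (\<lambda>x. norm (f x) powr s)"
  using finite_simple_integrable[OF finite_simple_compose[OF assms, of "\<lambda>y. norm y powr s"]]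
  by (simp add: strongly_integrable_def)

lemma finite_simple_bounded:
  assumes "finite_simple M f" obtains K where "\<And>x. x \<in> space M \<Longrightarrow> norm (f x) \<le> K"
proof -
  have fin: "finite (f ` space M)" using assms by (simp add: finite_simple_def simple_function_def)
  have "norm (f x) \<le> (\<Sum>y\<in>f ` space M. norm y)" if "x \<in> space M" for x
    using that by (intro member_le_sum fin) auto
  then show ?thesis using that by blast
qed

lemma finite_simple_strongly_measurable: "finite_simple M f \<Longrightarrow> strongly_measurable M f"
  by (simp add: finite_simple_def strongly_measurable_simple)

text \<open>The test functions are truncations of \<open>\<parallel>s\<^sub>i\<parallel>\<^sup>p\<^sup>'\<^sup>-\<^sup>1\<close> times a functional norming \<open>s\<^sub>i\<close>, where the simple functions
  \<open>s\<^sub>i\<close> approximate \<open>F\<close>.\<close>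

lemma duality_bound_ball:
  fixes F :: "real^'n::finite \<Rightarrow> 'a::complex_banach"
  assumes p: "1 < p" "p \<le> 2"
    and F: "strongly_measurable lborel F" "\<And>x. norm (F x) \<le> M"
    and test: "\<And>\<eta> :: real^'n \<Rightarrow> 'a cdual. finite_simple lborel \<eta> \<Longrightarrow> (LBINT x. norm (\<eta> x) powr p) \<le> 1/4
      \<Longrightarrow> cmod (LBINT x. clinop_apply (\<eta> x) (F x)) \<le> C"
  shows "(LBINT x. indicator (cball 0 R) x * norm (F x) powr (p / (p - 1))) \<le> (8 * C) powr (p / (p - 1))"
proof -
  \<comment> \<open>The exponent conjugate to \<open>p\<close>; the identity (r - 1) p = r turns the
    L^p size of the test function into the L^r size of \<open>s i\<close>.\<close>
  define r where "r = p / (p - 1)"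
  define B where "B = cball (0 :: real^'n) R"
  have r: "1 < r" "(r - 1) * p = r" "1 - 1 / p = 1 / r" using p by (auto simp: r_def field_simps)
  have M: "0 \<le> M" using F(2)[of 0] norm_ge_zero order_trans by blast
  have [measurable]: "B \<in> sets borel" by (simp add: B_def)
  have Bfin: "emeasure lborel B < \<infinity>" unfolding B_def by (rule emeasure_bounded_finite) simp
  then have intB: "integrable lborel (\<lambda>x. c * indicator B x :: real)" for c
    by (intro integrable_mult_right) (simp add: integrable_indicator_iff)
  obtain s where s: "\<And>i. simple_function lborel (s i)" "\<And>x. (\<lambda>i. s i x) \<longlonglongrightarrow> F x"
    "\<And>i x. norm (s i x) \<le> 4 * norm (F x)"
    using strongly_measurable_approx[OF F(1)] by auto
  have sM: "norm (s i x) \<le> 4 * M" for i x using s(3)[of i x] F(2)[of x] by simp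
  have sm: "strongly_measurable lborel (s i)" for i by (rule strongly_measurable_simple[OF s(1)])
  have nm [measurable]: "(\<lambda>x. norm (s i x)) \<in> borel_measurable lborel" "(\<lambda>x. norm (F x)) \<in> borel_measurable lborel"
     "(\<lambda>x. norm (F x - s i x)) \<in> borel_measurable lborel" for i
    by (intro borel_measurable_norm_strong strongly_measurable_diff sm F)+
  obtain \<phi> :: "'a \<Rightarrow> 'a cdual" where \<phi>: "\<And>y. norm (\<phi> y) \<le> 1" "\<And>y. clinop_apply (\<phi> y) y = of_real (norm y)"
    using norming_map by blast
  define A where "A = (LBINT x. indicator B x * norm (F x) powr r)"
  define a where "a i = (LBINT x. indicator B x * norm (s i x) powr r)" for i
  \<comment> \<open>The cost of evaluating at \<open>F x\<close> a functional that norms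
    \<open>s i x\<close>. It tends to 0, since all factors are bounded on the ball.\<close>
  define e where "e i = (LBINT x. indicator B x * (norm (s i x) powr (r - 1) * norm (F x - s i x)))" for i
  have sbd: "norm (s i x) powr t \<le> (4 * M) powr t" if "0 \<le> t" for i x t
    using that sM by (intro powr_mono2) auto
  have dbd: "norm (F x - s i x) \<le> 5 * M" for i x
    using norm_triangle_ineq4[of "F x" "s i x"] F(2)[of x] sM[of i x] by simp
  have a_int: "integrable lborel (\<lambda>x. indicator B x * norm (s i x) powr r)" for i
    by (rule Bochner_Integration.integrable_bound[OF intB[of "(4 * M) powr r"]])
       (use r sbd in \<open>auto simp: indicator_def intro!: AE_I2\<close>)
  have e_bd: "norm (s i x) powr (r - 1) * norm (F x - s i x) \<le> (4 * M) powr (r - 1) * (5 * M)" for i x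
    using r by (intro mult_mono sbd dbd) auto
  have e_int: "integrable lborel (\<lambda>x. indicator B x * (norm (s i x) powr (r - 1) * norm (F x - s i x)))" for i
    by (rule Bochner_Integration.integrable_bound[OF intB[of "(4 * M) powr (r - 1) * (5 * M)"]])
       (use M e_bd in \<open>auto simp: indicator_def abs_mult intro!: AE_I2\<close>)
  have a_lim: "a \<longlonglongrightarrow> A"
    unfolding a_def A_def
  proof (rule integral_dominated_convergence[OF _ _ intB[of "(4 * M) powr r"]])
    show "AE x in lborel. (\<lambda>i. indicator B x * norm (s i x) powr r) \<longlonglongrightarrow> indicator B x * norm (F x) powr r"
      using r by (intro AE_I2 tendsto_mult tendsto_const tendsto_powr2 tendsto_norm s) (auto intro: always_eventually)
    show "AE x in lborel. norm (indicator B x * norm (s i x) powr r) \<le> (4 * M) powr r * indicator B x" for i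
      using r sbd by (auto simp: indicator_def intro!: AE_I2)
  qed measurable
  have "e \<longlonglongrightarrow> (\<integral>x. 0 \<partial>(lborel :: (real^'n) measure))"
    unfolding e_def
  proof (rule integral_dominated_convergence[OF _ _ intB[of "(4 * M) powr (r - 1) * (5 * M)"]])
    show "AE x in lborel. (\<lambda>i. indicator B x * (norm (s i x) powr (r - 1) * norm (F x - s i x))) \<longlonglongrightarrow> 0"
    proof (rule AE_I2)
      fix x
      have "(\<lambda>i. norm (s i x) powr (r - 1)) \<longlonglongrightarrow> norm (F x) powr (r - 1)"
        using r by (intro tendsto_powr2 tendsto_norm s tendsto_const) (auto intro: always_eventually)
      moreover have "(\<lambda>i. norm (F x - s i x)) \<longlonglongrightarrow> norm (F x - F x)"
        by (intro tendsto_norm tendsto_diff tendsto_const s)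
      ultimately have "(\<lambda>i. indicator B x * (norm (s i x) powr (r - 1) * norm (F x - s i x)))
          \<longlonglongrightarrow> indicator B x * (norm (F x) powr (r - 1) * norm (F x - F x))"
        by (intro tendsto_mult tendsto_const)
      then show "(\<lambda>i. indicator B x * (norm (s i x) powr (r - 1) * norm (F x - s i x))) \<longlonglongrightarrow> 0" by simp
    qed
    show "AE x in lborel. norm (indicator B x * (norm (s i x) powr (r - 1) * norm (F x - s i x)))
        \<le> (4 * M) powr (r - 1) * (5 * M) * indicator B x" for i
      using e_bd by (auto simp: indicator_def intro!: AE_I2)
  qed measurable
  then have e_lim: "e \<longlonglongrightarrow> 0" by simp
  have C: "0 \<le> C"
    using test[of "\<lambda>_. 0"] p by (simp add: finite_simple_def clinop_apply_simps)
  have main: "l * a i \<le> C + l * e i" if l: "0 \<le> l" "l powr p * a i \<le> 1/4" for l i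
  proof -
    \<comment> \<open>The extremal function of Hoelder's inequality for \<open>s i\<close>: paired
      with \<open>F\<close> its integral has real part at least l (a_i - e_i), and its p-th power
      integrates to at most l^p a_i.\<close>
    define \<eta> where "\<eta> x = (indicator B x * l * norm (s i x) powr (r - 1)) *\<^sub>R \<phi> (s i x)" for x
    have n\<eta>: "norm (\<eta> x) \<le> indicator B x * l * norm (s i x) powr (r - 1)" for x
      using \<phi>(1)[of "s i x"] l by (auto simp: \<eta>_def indicator_def mult_left_le)
    have "simple_function lborel \<eta>"
      unfolding \<eta>_def
      by (rule simple_function_compose2[where h = "\<lambda>b y. (b * l * norm y powr (r - 1)) *\<^sub>R \<phi> y", OF _ s(1)])
         (intro simple_function_indicator; simp)
    moreover have "emeasure lborel {x \<in> space lborel. \<eta> x \<noteq> 0} \<le> emeasure lborel B"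
      by (rule emeasure_mono) (auto simp: \<eta>_def indicator_def)
    ultimately have fs: "finite_simple lborel \<eta>" using Bfin by (auto simp: finite_simple_def intro: le_less_trans)
    have "(LBINT x. norm (\<eta> x) powr p) \<le> (LBINT x. l powr p * (indicator B x * norm (s i x) powr r))"
    proof (rule integral_mono)
      show "integrable lborel (\<lambda>x. norm (\<eta> x) powr p)" by (rule finite_simple_integrable_powr[OF fs])
      show "integrable lborel (\<lambda>x. l powr p * (indicator B x * norm (s i x) powr r))" using a_int by simp
      show "norm (\<eta> x) powr p \<le> l powr p * (indicator B x * norm (s i x) powr r)" for x
      proof -
        have "norm (\<eta> x) powr p \<le> (indicator B x * l * norm (s i x) powr (r - 1)) powr p"
          using p by (intro powr_mono2 n\<eta>) auto
        also have "\<dots> = l powr p * (indicator B x * norm (s i x) powr r)"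
          using l p r by (auto simp: indicator_def powr_mult powr_powr)
        finally show ?thesis .
      qed
    qed
    also have "\<dots> \<le> 1/4" using l(2) by (simp add: a_def)
    finally have 1: "cmod (LBINT x. clinop_apply (\<eta> x) (F x)) \<le> C" by (rule test[OF fs])
    have \<eta>F: "integrable lborel (\<lambda>x. clinop_apply (\<eta> x) (F x))"
      by (rule clinop_apply_integrable[OF finite_simple_integrable[OF fs] F])
    have "l * a i - l * e i = (LBINT x. l * (indicator B x * norm (s i x) powr r)
         - l * (indicator B x * (norm (s i x) powr (r - 1) * norm (F x - s i x))))"
      using a_int e_int by (simp add: a_def e_def)
    also have "\<dots> \<le> (LBINT x. Re (clinop_apply (\<eta> x) (F x)))"
    proof (rule integral_mono)
      fix x
      have lin: "linear (clinop_apply (\<phi> (s i x)))" by (rule bounded_linear.linear[OF bounded_linear_clinop_apply])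
      have "clinop_apply (\<phi> (s i x)) (F x) = of_real (norm (s i x)) + clinop_apply (\<phi> (s i x)) (F x - s i x)"
        by (simp add: linear_diff[OF lin] \<phi>)
      moreover have "cmod (clinop_apply (\<phi> (s i x)) (F x - s i x)) \<le> norm (F x - s i x)"
        using norm_clinop_apply_le[of "\<phi> (s i x)" "F x - s i x"] mult_right_mono[OF \<phi>(1), of "norm (F x - s i x)" "s i x"] by simp
      ultimately have *: "norm (s i x) - norm (F x - s i x) \<le> Re (clinop_apply (\<phi> (s i x)) (F x))"
        using abs_Re_le_cmod[of "clinop_apply (\<phi> (s i x)) (F x - s i x)"] by simp
      have "norm (s i x) powr r = norm (s i x) powr (r - 1) * norm (s i x)"
        using powr_mult_base[of "norm (s i x)" "r - 1"] by (simp add: mult.commute)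
      then have "l * (indicator B x * norm (s i x) powr r)
         - l * (indicator B x * (norm (s i x) powr (r - 1) * norm (F x - s i x)))
         = (indicator B x * l * norm (s i x) powr (r - 1)) * (norm (s i x) - norm (F x - s i x))"
        by (simp add: algebra_simps)
      also have "\<dots> \<le> (indicator B x * l * norm (s i x) powr (r - 1)) * Re (clinop_apply (\<phi> (s i x)) (F x))"
        using l by (intro mult_left_mono *) auto
      also have "\<dots> = Re (clinop_apply (\<eta> x) (F x))" by (simp add: \<eta>_def clinop_apply_simps)
      finally show "l * (indicator B x * norm (s i x) powr r)
         - l * (indicator B x * (norm (s i x) powr (r - 1) * norm (F x - s i x))) \<le> Re (clinop_apply (\<eta> x) (F x))" .
    qed (use a_int e_int \<eta>F in auto)
    also have "\<dots> = Re (LBINT x. clinop_apply (\<eta> x) (F x))" using \<eta>F by simp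
    also have "\<dots> \<le> C" using 1 complex_Re_le_cmod order_trans by blast
    finally show ?thesis by simp
  qed
  have A0: "0 \<le> A" unfolding A_def by (intro Bochner_Integration.integral_nonneg) auto
  have "A \<le> (8 * C) powr r"
  proof (cases "A = 0")
    case False
    then have A: "0 < A" using A0 by simp
    \<comment> \<open>Normalised to l^p A = 1/8, strictly below 1/4, so that \<open>main\<close>
      applies to all late \<open>i\<close>. In the limit l A \<le> C, and l A equals A^(1/r) up to
      the factor 8^(1/p) \<le> 8.\<close>
    define l where "l = (1 / (8 * A)) powr (1 / p)"
    have l: "0 < l" "l powr p = 1 / (8 * A)" using A p by (auto simp: l_def powr_powr)
    have "(\<lambda>i. l powr p * a i) \<longlonglongrightarrow> l powr p * A" by (intro tendsto_intros a_lim)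
    then have "\<forall>\<^sub>F i in sequentially. l powr p * a i < 1/4"
      using A l by (intro order_tendstoD(2)) auto
    then have "\<forall>\<^sub>F i in sequentially. l * a i \<le> C + l * e i"
      by eventually_elim (use l in \<open>auto intro!: main\<close>)
    moreover have "(\<lambda>i. l * a i) \<longlonglongrightarrow> l * A" "(\<lambda>i. C + l * e i) \<longlonglongrightarrow> C + l * 0"
      by (intro tendsto_intros a_lim e_lim)+
    ultimately have lA: "l * A \<le> C" using tendsto_le[OF sequentially_bot] by fastforce
    have "l * A = A powr (1 / r) / 8 powr (1 / p)"
    proof -
      have "l = A powr (- (1 / p)) / 8 powr (1 / p)"
        using A by (simp add: l_def powr_divide powr_mult powr_minus_divide)
      then have "l * A = A powr (- (1 / p)) * A powr 1 / 8 powr (1 / p)" using A by simp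
      also have "A powr (- (1 / p)) * A powr 1 = A powr (1 / r)"
      proof -
        have "- (1 / p) + 1 = 1 / r" using r(3) by simp
        then show ?thesis by (simp only: powr_add[symmetric])
      qed
      finally show ?thesis .
    qed
    with lA have "A powr (1 / r) \<le> C * 8 powr (1 / p)" by (simp add: divide_le_eq)
    also have "\<dots> \<le> C * 8 powr 1" using p C by (intro mult_left_mono powr_mono) auto
    finally have "(A powr (1 / r)) powr r \<le> (C * 8) powr r" using r by (intro powr_mono2) auto
    then show ?thesis using A r by (simp add: powr_powr mult.commute)
  qed simp
  then show ?thesis unfolding A_def B_def r_def .
qed

text \<open>The bound on balls does not depend on the radius, so monotone convergence yields
  integrability on the whole space. The supremum \<open>M\<close> does not enter the
  estimate.\<close>

lemma duality_bound:
  fixes F :: "real^'n::finite \<Rightarrow> 'a::complex_banach"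
  assumes p: "1 < p" "p \<le> 2"
    and F: "strongly_measurable lborel F" "\<And>x. norm (F x) \<le> M"
    and test: "\<And>\<eta> :: real^'n \<Rightarrow> 'a cdual. finite_simple lborel \<eta> \<Longrightarrow> (LBINT x. norm (\<eta> x) powr p) \<le> 1/4
      \<Longrightarrow> cmod (LBINT x. clinop_apply (\<eta> x) (F x)) \<le> C"
  shows "integrable lborel (\<lambda>x. norm (F x) powr (p / (p - 1)))"
    and "(LBINT x. norm (F x) powr (p / (p - 1))) \<le> (8 * C) powr (p / (p - 1))"
proof -
  define r where "r = p / (p - 1)"
  have r: "0 \<le> r" using p by (auto simp: r_def)
  define f where "f n x = indicator (cball 0 (real n)) x * norm (F x) powr r" for n :: nat and x
  have bound: "(LBINT x. f n x) \<le> (8 * C) powr r" for n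
    unfolding f_def r_def by (rule duality_bound_ball[OF p F test])
  have [measurable]: "(\<lambda>x. norm (F x)) \<in> borel_measurable lborel" by (rule borel_measurable_norm_strong[OF F(1)])
  have [measurable]: "cball (0::real^'n) R \<in> sets borel" for R by simp
  have int: "integrable lborel (f n)" for n
  proof (rule Bochner_Integration.integrable_bound)
    show "integrable lborel (\<lambda>x. M powr r * indicator (cball (0::real^'n) (real n)) x :: real)"
      using emeasure_bounded_finite[of "cball (0::real^'n) (real n)"]
      by (intro integrable_mult_right) (simp add: integrable_indicator_iff)
    show "AE x in lborel. norm (f n x) \<le> norm (M powr r * indicator (cball (0::real^'n) (real n)) x :: real)"
      using r F(2) by (intro AE_I2) (auto simp: f_def indicator_def intro!: powr_mono2)
  qed (unfold f_def, measurable)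
  have mono: "mono (\<lambda>n. f n x)" for x by (intro monoI) (auto simp: f_def indicator_def)
  have lim: "(\<lambda>n. f n x) \<longlonglongrightarrow> norm (F x) powr r" for x
  proof (rule tendsto_eventually)
    obtain N :: nat where "norm x \<le> real N" using real_arch_simple by blast
    then show "\<forall>\<^sub>F n in sequentially. f n x = norm (F x) powr r"
      unfolding eventually_sequentially by (intro exI[of _ N]) (auto simp: f_def)
  qed
  have "incseq (\<lambda>n. LBINT x. f n x)"
    using mono int by (intro incseq_SucI integral_mono) (auto simp: mono_def)
  then obtain L where L: "(\<lambda>n. LBINT x. f n x) \<longlonglongrightarrow> L"
    using incseq_convergent[of _ "(8 * C) powr r"] bound by blast
  have "has_bochner_integral lborel (\<lambda>x. norm (F x) powr r) L"
    by (rule has_bochner_integral_monotone_convergence[OF int _ _ L]) (use mono lim in auto)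
  moreover have "L \<le> (8 * C) powr r" using LIMSEQ_le_const2[OF L] bound by blast
  ultimately show "integrable lborel (\<lambda>x. norm (F x) powr (p / (p - 1)))"
    "(LBINT x. norm (F x) powr (p / (p - 1))) \<le> (8 * C) powr (p / (p - 1))"
    by (auto simp: has_bochner_integral_iff r_def)
qed

text \<open>The transform is bounded by the L^1 norm and \<eta> is integrable, so the pairing is
  continuous in \<open>f\<close> for the L^1 norm. This serves both passages: from Gaussian sums to
  simple functions and from simple to integrable functions.\<close>

lemma fourier_pairing_limit:
  fixes f :: "real^'n::finite \<Rightarrow> 'a::complex_banach" and \<eta> :: "real^'n \<Rightarrow> 'a cdual"
  assumes \<eta>: "strongly_integrable lborel \<eta>" and f: "strongly_integrable lborel f"
    and ex: "\<And>e. 0 < e \<Longrightarrow> \<exists>g. strongly_integrable lborel g \<and> (LBINT t. norm (f t - g t)) \<le> e \<and>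
      cmod (LBINT \<xi>. clinop_apply (\<eta> \<xi>) (fourier g \<xi>)) \<le> C"
  shows "cmod (LBINT \<xi>. clinop_apply (\<eta> \<xi>) (fourier f \<xi>)) \<le> C"
proof (rule field_le_epsilon)
  fix e :: real assume e: "0 < e"
  define K where "K = 1 + (LBINT \<xi>. norm (\<eta> \<xi>))"
  have K: "0 < K" "(LBINT \<xi>. norm (\<eta> \<xi>)) \<le> K" by (auto simp: K_def intro!: add_pos_nonneg Bochner_Integration.integral_nonneg)
  obtain g where g: "strongly_integrable lborel g" "(LBINT t. norm (f t - g t)) \<le> e / K"
      "cmod (LBINT \<xi>. clinop_apply (\<eta> \<xi>) (fourier g \<xi>)) \<le> C"
    using ex[of "e / K"] e K by auto
  have d: "strongly_integrable lborel (\<lambda>t. f t - g t)" by (rule strongly_integrable_diff[OF f g(1)])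
  have int: "integrable lborel (\<lambda>\<xi>. clinop_apply (\<eta> \<xi>) (fourier h \<xi>))" if "strongly_integrable lborel h" for h
    by (rule clinop_apply_integrable[OF \<eta> strongly_measurable_fourier[OF that] norm_fourier_le[OF that]])
  have lin: "linear (clinop_apply (\<eta> \<xi>))" for \<xi> by (rule bounded_linear.linear[OF bounded_linear_clinop_apply])
  have "(LBINT \<xi>. clinop_apply (\<eta> \<xi>) (fourier f \<xi>)) - (LBINT \<xi>. clinop_apply (\<eta> \<xi>) (fourier g \<xi>))
      = (LBINT \<xi>. clinop_apply (\<eta> \<xi>) (fourier (\<lambda>t. f t - g t) \<xi>))"
    by (simp add: fourier_diff f g linear_diff[OF lin] int)
  also have "cmod \<dots> \<le> (e / K) * (LBINT \<xi>. norm (\<eta> \<xi>))"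
    by (rule norm_integral_clinop_apply_le[OF \<eta> strongly_measurable_fourier[OF d]])
       (rule order_trans[OF norm_fourier_le[OF d] g(2)])
  also have "\<dots> \<le> (e / K) * K" using e K by (intro mult_left_mono) auto
  finally have "cmod ((LBINT \<xi>. clinop_apply (\<eta> \<xi>) (fourier f \<xi>)) - (LBINT \<xi>. clinop_apply (\<eta> \<xi>) (fourier g \<xi>))) \<le> e"
    using K by simp
  then show "cmod (LBINT \<xi>. clinop_apply (\<eta> \<xi>) (fourier f \<xi>)) \<le> C + e"
    using g(3) norm_triangle_sub[of "LBINT \<xi>. clinop_apply (\<eta> \<xi>) (fourier f \<xi>)" "LBINT \<xi>. clinop_apply (\<eta> \<xi>) (fourier g \<xi>)"]
    by simp
qed

section \<open>Fourier type\<close>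

text \<open>Homogeneity: an estimate on small balls becomes a norm inequality after rescaling
  \<open>f\<close>. Approximants dominated by 4 |g| have p-th power at most 16 |g|^p, so mass 1/256
  leaves 1/16 for the simple functions.\<close>

lemma fourier_bound_Lp:
  fixes f :: "real^'n::finite \<Rightarrow> 'a::complex_banach"
  assumes p: "1 < p" "p \<le> 2"
    and test: "\<And>(f :: real^'n \<Rightarrow> 'a) (\<eta> :: real^'n \<Rightarrow> 'a cdual). finite_simple lborel f \<Longrightarrow> finite_simple lborel \<eta> \<Longrightarrow>
      (LBINT x. norm (f x) powr p) \<le> 1/16 \<Longrightarrow> (LBINT x. norm (\<eta> x) powr p) \<le> 1/4 \<Longrightarrow>
      cmod (LBINT x. clinop_apply (\<eta> x) (fourier f x)) \<le> C"
    and f: "strongly_integrable lborel f" "integrable lborel (\<lambda>x. norm (f x) powr p)"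
  shows "integrable lborel (\<lambda>x. norm (fourier f x) powr (p / (p - 1)))"
    and "(LBINT x. norm (fourier f x) powr (p / (p - 1))) powr (1 / (p / (p - 1)))
      \<le> 4096 * C * (LBINT x. norm (f x) powr p) powr (1 / p)"
proof -
  define r where "r = p / (p - 1)"
  have r: "1 < r" using p by (auto simp: r_def field_simps)
  define J where "J = (LBINT x. norm (f x) powr p)"
  have J0: "0 \<le> J" unfolding J_def by (intro Bochner_Integration.integral_nonneg) auto
  have C: "0 \<le> C"
    using test[of "\<lambda>_. 0" "\<lambda>_. 0"] p by (simp add: finite_simple_def clinop_apply_simps)
  have small: "cmod (LBINT x. clinop_apply (\<eta> x) (fourier g x)) \<le> C"
    if g: "strongly_integrable lborel g" "integrable lborel (\<lambda>x. norm (g x) powr p)" "(LBINT x. norm (g x) powr p) \<le> 1/256"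
    and \<eta>: "finite_simple lborel \<eta>" "(LBINT x. norm (\<eta> x) powr p) \<le> 1/4"
    for g :: "real^'n \<Rightarrow> 'a" and \<eta> :: "real^'n \<Rightarrow> 'a cdual"
  proof (rule fourier_pairing_limit[OF finite_simple_integrable[OF \<eta>(1)] g(1)])
    fix e :: real assume e: "0 < e"
    have gm: "strongly_measurable lborel g" "integrable lborel (\<lambda>x. norm (g x))" using g by (auto simp: strongly_integrable_def)
    obtain s where s: "\<And>i. simple_function lborel (s i)" "\<And>x. (\<lambda>i. s i x) \<longlonglongrightarrow> g x"
      "\<And>i x. norm (s i x) \<le> 4 * norm (g x)"
      using strongly_measurable_approx[OF gm(1)] by auto
    have sm: "strongly_measurable lborel (s i)" for i by (rule strongly_measurable_simple[OF s(1)])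
    have si: "strongly_integrable lborel (s i)" for i
      by (rule strongly_integrable_bound[OF sm, of "\<lambda>x. 4 * norm (g x)"]) (use gm s in auto)
    have nm: "(\<lambda>x. norm (g x - s i x)) \<in> borel_measurable lborel" "(\<lambda>x. norm (s i x)) \<in> borel_measurable lborel" for i
      by (intro borel_measurable_norm_strong strongly_measurable_diff sm gm)+
    have fs: "finite_simple lborel (s i)" for i
    proof -
      have "Bochner_Integration.simple_bochner_integrable lborel (s i)"
        using si[of i] s(1)[of i] by (intro simple_bochner_integrableI_bounded) (auto simp: strongly_integrable_def integrable_iff_bounded)
      then show ?thesis using s(1)[of i] by (auto simp: finite_simple_def simple_bochner_integrable.simps less_top)
    qed
    have "(\<lambda>i. LBINT x. norm (g x - s i x)) \<longlonglongrightarrow> (\<integral>x. 0 \<partial>(lborel :: (real^'n) measure))"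
    proof (rule integral_dominated_convergence[where w = "\<lambda>x. 5 * norm (g x)"])
      show "AE x in lborel. (\<lambda>i. norm (g x - s i x)) \<longlonglongrightarrow> 0"
      proof (rule AE_I2)
        fix x
        from tendsto_norm[OF tendsto_diff[OF tendsto_const s(2), of "g x" x]]
        show "(\<lambda>i. norm (g x - s i x)) \<longlonglongrightarrow> 0" by simp
      qed
      show "AE x in lborel. norm (norm (g x - s i x)) \<le> 5 * norm (g x)" for i
      proof (rule AE_I2)
        fix x show "norm (norm (g x - s i x)) \<le> 5 * norm (g x)"
          using norm_triangle_ineq4[of "g x" "s i x"] s(3)[of i x] by simp
      qed
    qed (use gm nm in auto)
    then have "\<forall>\<^sub>F i in sequentially. (LBINT x. norm (g x - s i x)) < e"
      using e by (intro order_tendstoD(2)) auto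
    then obtain i where i: "(LBINT x. norm (g x - s i x)) \<le> e"
      unfolding eventually_sequentially using less_imp_le by blast
    have "(LBINT x. norm (s i x) powr p) \<le> (LBINT x. 16 * norm (g x) powr p)"
    proof (rule integral_mono)
      show "integrable lborel (\<lambda>x. norm (s i x) powr p)" by (rule finite_simple_integrable_powr[OF fs])
      show "norm (s i x) powr p \<le> 16 * norm (g x) powr p" for x
      proof -
        have "norm (s i x) powr p \<le> (4 * norm (g x)) powr p" using p s(3) by (intro powr_mono2) auto
        also have "\<dots> = 4 powr p * norm (g x) powr p" by (simp add: powr_mult)
        also have "\<dots> \<le> 4 powr 2 * norm (g x) powr p" using p by (intro mult_right_mono powr_mono) auto
        finally show ?thesis by simp
      qed
    qed (use g in auto)
    also have "\<dots> \<le> 1/16" using g(3) by simp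
    finally have "cmod (LBINT x. clinop_apply (\<eta> x) (fourier (s i) x)) \<le> C"
      by (rule test[OF fs \<eta>(1) _ \<eta>(2)])
    then show "\<exists>h. strongly_integrable lborel h \<and> (LBINT t. norm (g t - h t)) \<le> e \<and>
        cmod (LBINT \<xi>. clinop_apply (\<eta> \<xi>) (fourier h \<xi>)) \<le> C"
      using si i by blast
  qed
  \<comment> \<open>Duality for l f gives the bound 8 C for l times the transform; what remains is
    to choose \<open>l\<close> as large as the constraint allows.\<close>
  have scaled: "integrable lborel (\<lambda>x. norm (fourier f x) powr r) \<and>
      (LBINT x. norm (fourier f x) powr r) powr (1 / r) \<le> 8 * C / l" if l: "0 < l" "l powr p * J \<le> 1/256" for l
  proof -
    define g where "g x = l *\<^sub>R f x" for x
    have g: "strongly_integrable lborel g" unfolding g_def by (rule strongly_integrable_scaleR[OF f(1)])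
    have ng: "norm (g x) powr p = l powr p * norm (f x) powr p" for x using l by (simp add: g_def powr_mult)
    have fg: "fourier g x = l *\<^sub>R fourier f x" for x
      unfolding g_def by (rule fourier_bounded_linear[OF bounded_linear_scaleR_right _ f(1)]) (simp add: scaleC_scaleR_commute)
    have "integrable lborel (\<lambda>x. norm (g x) powr p)" using f(2) by (simp add: ng)
    moreover have "(LBINT x. norm (g x) powr p) \<le> 1/256" using l(2) by (simp add: ng J_def)
    ultimately have *: "integrable lborel (\<lambda>x. norm (fourier g x) powr r)"
        "(LBINT x. norm (fourier g x) powr r) \<le> (8 * C) powr r"
      unfolding r_def using duality_bound[OF p strongly_measurable_fourier[OF g] norm_fourier_le[OF g] small[OF g]]
      by blast+
    have nfg: "norm (fourier g x) powr r = l powr r * norm (fourier f x) powr r" for x using l by (simp add: fg powr_mult)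
    have int: "integrable lborel (\<lambda>x. norm (fourier f x) powr r)"
      using *(1) l unfolding nfg by (simp add: integrable_mult_left_iff)
    have nn: "0 \<le> (LBINT x. norm (fourier f x) powr r)" by (intro Bochner_Integration.integral_nonneg) auto
    have "l powr r * (LBINT x. norm (fourier f x) powr r) \<le> (8 * C) powr r" using *(2) unfolding nfg by simp
    then have "(LBINT x. norm (fourier f x) powr r) \<le> (8 * C / l) powr r"
      using l C by (simp add: powr_divide divide_simps mult.commute)
    then have "(LBINT x. norm (fourier f x) powr r) powr (1 / r) \<le> ((8 * C / l) powr r) powr (1 / r)"
      using nn r by (intro powr_mono2) auto
    also have "\<dots> = 8 * C / l" using l C r by (simp add: powr_powr)
    finally show ?thesis using int by simp
  qed
  show "integrable lborel (\<lambda>x. norm (fourier f x) powr (p / (p - 1)))" 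
    and "(LBINT x. norm (fourier f x) powr (p / (p - 1))) powr (1 / (p / (p - 1)))
      \<le> 4096 * C * (LBINT x. norm (f x) powr p) powr (1 / p)"
    unfolding r_def[symmetric] J_def[symmetric]
  proof -
    show "integrable lborel (\<lambda>x. norm (fourier f x) powr r)"
    proof (cases "J = 0")
      case True then show ?thesis using scaled[of 1] by simp
    next
      case False
      then show ?thesis using scaled[of "(1 / (256 * J)) powr (1 / p)"] J0 p by (simp add: powr_powr)
    qed
    show "(LBINT x. norm (fourier f x) powr r) powr (1 / r) \<le> 4096 * C * J powr (1 / p)"
    proof (cases "J = 0")
      \<comment> \<open>For vanishing L^p norm every \<open>l\<close> is admissible, so the left
        side is below 8 C / n for all n.\<close>
      case True
      define N where "N = (LBINT x. norm (fourier f x) powr r) powr (1 / r)"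
      have le: "N \<le> 8 * C / real n" if "0 < n" for n :: nat
        using scaled[of "real n"] that True by (simp add: N_def)
      have "(\<lambda>n. 8 * C / real n) \<longlonglongrightarrow> 0" by (rule lim_const_over_n)
      then have "N \<le> 0"
        by (rule LIMSEQ_le_const) (use le in \<open>auto intro!: exI[of _ 1]\<close>)
      then show ?thesis using True by (simp add: N_def)
    next
      case False
      then have J: "0 < J" using J0 by simp
      \<comment> \<open>The largest admissible scaling, l^p J = 1/256. Since 256^(1/p) \<le> 256,
        the constant is at most 8 * 256 = 2048 times C; 4096 leaves room.\<close>
      define l where "l = (1 / (256 * J)) powr (1 / p)"
      have l: "0 < l" "l powr p * J \<le> 1/256" using J p by (auto simp: l_def powr_powr)
      have "1 / l = (256 * J) powr (1 / p)" using J by (simp add: l_def powr_divide)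
      also have "\<dots> = 256 powr (1 / p) * J powr (1 / p)" using J by (simp add: powr_mult)
      also have "\<dots> \<le> 256 powr 1 * J powr (1 / p)" using p by (intro mult_right_mono powr_mono) auto
      finally have "8 * C * (1 / l) \<le> 8 * C * (256 * J powr (1 / p))" using C by (intro mult_left_mono) auto
      moreover have "8 * C * (256 * J powr (1 / p)) \<le> 4096 * C * J powr (1 / p)" using C by (simp add: mult_right_mono)
      ultimately show ?thesis using scaled[OF l] by simp
    qed
  qed
qed

subsection \<open>Identification of the product measure with Lebesgue measure\<close>

text \<open>Reduced to the scalar change of variables by functionals.\<close>

lemma strong_integral_distr:
  fixes f :: "_ \<Rightarrow> 'a::complex_banach"
  assumes S: "S \<in> measurable M N" and f: "strongly_integrable (distr M N S) f"
  shows "strongly_integrable M (\<lambda>x. f (S x))"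
    and "strong_integral (distr M N S) f = strong_integral M (\<lambda>x. f (S x))"
proof -
  have S': "S \<in> measurable M (distr M N S)" using S by simp
  have "(\<lambda>x. norm (f x)) \<in> borel_measurable N"
    using borel_measurable_norm_strong[of "distr M N S" f] f by (simp add: strongly_integrable_def)
  then show *: "strongly_integrable M (\<lambda>x. f (S x))"
    using f strongly_measurable_compose[OF _ S', of f] by (auto simp: strongly_integrable_def integrable_distr_eq[OF S])
  show "strong_integral (distr M N S) f = strong_integral M (\<lambda>x. f (S x))"
  proof (rule cdual_eqI)
    fix F :: "'a cdual"
    have "(\<lambda>x. clinop_apply F (f x)) \<in> borel_measurable N"
      using integrable_clinop_apply[OF f, of F, THEN borel_measurable_integrable] by simp
    then show "clinop_apply F (strong_integral (distr M N S) f) = clinop_apply F (strong_integral M (\<lambda>x. f (S x)))"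
      by (simp add: clinop_apply_strong_integral f * integral_distr[OF S])
  qed
qed

text \<open>A product measure is determined by its values on boxes, and the preimage of a box under
  \<open>S\<close> is a box whose sides are permuted by the enumeration \<open>e\<close>.\<close>

lemma lebesgue_power_eq_distr:
  fixes e :: "nat \<Rightarrow> 'n::finite"
  assumes e: "bij_betw e {..<CARD('n)} UNIV"
  defines "S \<equiv> \<lambda>x::real^'n. \<lambda>k\<in>{..<CARD('n)}. x $ e k"
  shows "S \<in> measurable lborel (lebesgue_power CARD('n))"
    and "lebesgue_power CARD('n) = distr lborel (lebesgue_power CARD('n)) S"
proof -
  interpret product_sigma_finite "\<lambda>_::nat. lborel :: real measure" ..
  have comp: "(\<lambda>x::real^'n. x $ i) \<in> borel_measurable borel" for i
    by (intro borel_measurable_continuous_onI continuous_intros)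
  show S: "S \<in> measurable lborel (lebesgue_power CARD('n))"
    unfolding S_def lebesgue_power_def by (rule measurable_restrict) (use comp in simp)
  have "distr lborel (lebesgue_power CARD('n)) S = PiM {..<CARD('n)} (\<lambda>_. lborel)"
  proof (rule PiM_eqI)
    fix A :: "nat \<Rightarrow> real set"
    assume A: "\<And>k. k \<in> {..<CARD('n)} \<Longrightarrow> A k \<in> sets lborel"
    define g where "g = the_inv_into {..<CARD('n)} e"
    have g: "g i < CARD('n)" "e (g i) = i" "k < CARD('n) \<Longrightarrow> g (e k) = k" for i k
      using e bij_betwE[OF bij_betw_the_inv_into[OF e]] f_the_inv_into_f_bij_betw[OF e, of i]
        the_inv_into_f_f[of e "{..<CARD('n)}" k]
      by (auto simp: g_def bij_betw_def)
    have bg: "bij_betw g UNIV {..<CARD('n)}" unfolding g_def by (rule bij_betw_the_inv_into[OF e])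
    define A' where "A' b = A (g (axis_index b))" for b :: "real^'n"
    have A': "A' b \<in> sets borel" for b using A g(1) by (auto simp: A'_def)
    have pre: "S -` PiE {..<CARD('n)} A = {x. \<forall>b\<in>Basis. x \<bullet> b \<in> A' b}"
    proof -
      have "S x \<in> PiE {..<CARD('n)} A \<longleftrightarrow> (\<forall>k<CARD('n). x $ e k \<in> A k)" for x by (auto simp: S_def)
      also have "(\<forall>k<CARD('n). x $ e k \<in> A k) \<longleftrightarrow> (\<forall>i. x $ i \<in> A (g i))" for x
        by (metis g)
      also have "(\<forall>i. x $ i \<in> A (g i)) \<longleftrightarrow> (\<forall>b\<in>Basis. x \<bullet> b \<in> A' b)" for x
        by (auto simp: Basis_vec_def A'_def inner_axis)
      finally show ?thesis by auto
    qed
    have PiE_sets: "PiE {..<CARD('n)} A \<in> sets (lebesgue_power CARD('n))"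
      unfolding lebesgue_power_def using A by (intro sets_PiM_I_finite) auto
    have "emeasure (distr lborel (lebesgue_power CARD('n)) S) (PiE {..<CARD('n)} A) = emeasure lborel (S -` PiE {..<CARD('n)} A)"
      by (subst emeasure_distr[OF S PiE_sets]) simp
    also have "\<dots> = (\<integral>\<^sup>+x. indicator (S -` PiE {..<CARD('n)} A) x \<partial>lborel)"
      using measurable_sets[OF S PiE_sets] by simp
    also have "\<dots> = (\<integral>\<^sup>+x. (\<Prod>b\<in>Basis. indicator (A' b) (x \<bullet> b)) \<partial>lborel)"
    proof (rule nn_integral_cong)
      fix x :: "real^'n"
      show "indicator (S -` PiE {..<CARD('n)} A) x = (\<Prod>b\<in>Basis. indicator (A' b) (x \<bullet> b) :: ennreal)"
        unfolding pre by (cases "\<forall>b\<in>Basis. x \<bullet> b \<in> A' b") (auto simp: indicator_def)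
    qed
    also have "\<dots> = (\<Prod>b\<in>(Basis :: (real^'n) set). \<integral>\<^sup>+x. indicator (A' b) x \<partial>lborel)"
      using A' by (intro nn_integral_lborel_prod) auto
    also have "\<dots> = (\<Prod>b\<in>(Basis :: (real^'n) set). emeasure lborel (A' b))"
      using A' by simp
    also have "\<dots> = (\<Prod>i\<in>UNIV. emeasure lborel (A (g i)))"
    proof -
      have "bij_betw (\<lambda>i::'n. axis i (1::real)) UNIV Basis"
        by (auto simp: bij_betw_def inj_on_def axis_eq_axis Basis_vec_def)
      from prod.reindex_bij_betw[OF this, of "\<lambda>b. emeasure lborel (A' b)"] show ?thesis
        by (simp add: A'_def)
    qed
    also have "\<dots> = (\<Prod>k\<in>{..<CARD('n)}. emeasure lborel (A k))"
      by (rule prod.reindex_bij_betw[OF bg])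
    finally show "emeasure (distr lborel (lebesgue_power CARD('n)) S) (PiE {..<CARD('n)} A) = (\<Prod>k\<in>{..<CARD('n)}. emeasure lborel (A k))" .
  qed (simp_all add: lebesgue_power_def)
  then show "lebesgue_power CARD('n) = distr lborel (lebesgue_power CARD('n)) S"
    by (simp add: lebesgue_power_def)
qed

text \<open>Carries the estimate from \<open>real^'n\<close>, where the analysis takes place, to the
  functions on indices in \<open>fourier_type\<close>, with d = \<open>CARD('n)\<close>.
  \<open>S\<close> and \<open>T\<close> are mutually inverse measurable maps, and \<open>S\<close>
  preserves inner products and hence the Fourier kernel.\<close>

lemma fourier_type_transfer:
  fixes p :: real
  assumes p: "1 \<le> p" "p \<le> 2"
    and bound: "\<And>f :: real^'n::finite \<Rightarrow> 'a::complex_banach. strongly_integrable lborel f \<Longrightarrow> integrable lborel (\<lambda>x. norm (f x) powr p) \<Longrightarrow>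
       fourier f \<in> Lp_space (holder_conjugate (ereal p)) lborel \<and>
       Lp_norm (holder_conjugate (ereal p)) lborel (fourier f) \<le> C * (LBINT x. norm (f x) powr p) powr (1 / p)"
  shows "fourier_type TYPE('a) (ereal p)"
proof -
  define d where "d = CARD('n)"
  obtain e :: "nat \<Rightarrow> 'n" where e: "bij_betw e {..<CARD('n)} UNIV"
    using ex_bij_betw_nat_finite[of "UNIV :: 'n set"] by (auto simp: atLeast0LessThan)
  define S where "S = (\<lambda>x::real^'n. \<lambda>k\<in>{..<CARD('n)}. x $ e k)"
  define P where "P = lebesgue_power d"
  have S: "S \<in> measurable lborel P" and P: "P = distr lborel P S"
    using lebesgue_power_eq_distr[OF e] unfolding S_def P_def d_def by auto
  define g where "g = the_inv_into {..<d} e"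
  have g: "g i < d" "e (g i) = i" "k < d \<Longrightarrow> g (e k) = k" for i k
    using e bij_betwE[OF bij_betw_the_inv_into[OF e]] f_the_inv_into_f_bij_betw[OF e, of i]
      the_inv_into_f_f[of e "{..<CARD('n)}" k]
    by (auto simp: g_def bij_betw_def d_def)
  define T where "T y = (\<chi> i. y (g i))" for y :: "nat \<Rightarrow> real"
  have T: "T \<in> measurable P lborel"
  proof -
    have "(\<lambda>y. T y \<bullet> b) \<in> borel_measurable P" if "b \<in> Basis" for b
    proof -
      have "b \<in> range (\<lambda>i. axis i (1::real))" using that by (auto simp: Basis_vec_def)
      then obtain i where "b = axis i 1" by blast
      then have "(\<lambda>y. T y \<bullet> b) = (\<lambda>y. y (g i))" by (simp add: T_def inner_axis)
      moreover have "(\<lambda>y. y (g i)) \<in> measurable P lborel"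
        unfolding P_def lebesgue_power_def by (rule measurable_component_singleton) (simp add: g)
      ultimately show ?thesis by simp
    qed
    then have "T \<in> borel_measurable P" by (subst borel_measurable_euclidean_space) blast
    then show ?thesis by simp
  qed
  \<comment> \<open>Holds only on the product space, whose points are \<open>undefined\<close>
    outside the first \<open>d\<close> indices, as are the values of \<open>S\<close>.\<close>
  have ST: "S (T y) = y" if "y \<in> space P" for y
    using that by (auto simp: S_def T_def P_def lebesgue_power_def space_PiM d_def[symmetric] g fun_eq_iff restrict_def
       PiE_def extensional_def)
  have TS: "T (S x) = x" for x
    using g by (simp add: S_def T_def vec_eq_iff d_def)
  have sm: "strongly_measurable P f \<longleftrightarrow> strongly_measurable lborel (\<lambda>x. f (S x))" for f :: "_ \<Rightarrow> 'b::real_normed_vector"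
  proof
    show "strongly_measurable P f \<Longrightarrow> strongly_measurable lborel (\<lambda>x. f (S x))"
      by (rule strongly_measurable_compose[OF _ S])
    assume "strongly_measurable lborel (\<lambda>x. f (S x))"
    from strongly_measurable_compose[OF this T] show "strongly_measurable P f"
      by (rule iffD1[OF strongly_measurable_cong, rotated]) (simp add: ST)
  qed
  have int: "integrable P f \<longleftrightarrow> integrable lborel (\<lambda>x. f (S x))" "(\<integral>y. f y \<partial>P) = (LBINT x. f (S x))"
    if "f \<in> borel_measurable P" for f :: "_ \<Rightarrow> real"
    using integrable_distr_eq[OF S, of f] integral_distr[OF S, of f] that unfolding P[symmetric] by auto
  have ess: "esssup P f = esssup lborel (\<lambda>x. f (S x))" if f: "f \<in> borel_measurable P" for f :: "_ \<Rightarrow> ereal"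
  proof -
    have "(AE y in P. f y \<le> z) \<longleftrightarrow> (AE x in lborel. f (S x) \<le> z)" for z
    proof -
      have [measurable]: "f \<in> borel_measurable P" by (rule f)
      have "{y \<in> space P. f y \<le> z} \<in> sets P" by measurable
      from AE_distr_iff[OF S this] show ?thesis unfolding P[symmetric] .
    qed
    then show ?thesis
      using f S by (simp add: esssup_eq_AE)
  qed
  have powm: "(\<lambda>y. norm (f y) powr s) \<in> borel_measurable P" if "strongly_measurable P f" for f :: "_ \<Rightarrow> 'a" and s
    using borel_measurable_norm_strong[OF that] by measurable
  have Lp: "f \<in> Lp_space s P \<longleftrightarrow> (\<lambda>x. f (S x)) \<in> Lp_space s lborel"
     "strongly_measurable P f \<Longrightarrow> Lp_norm s P f = Lp_norm s lborel (\<lambda>x. f (S x))" for f :: "_ \<Rightarrow> 'a" and s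
  proof -
    have em: "(\<lambda>y. ereal (norm (f y))) \<in> borel_measurable P" if "strongly_measurable P f"
      using borel_measurable_norm_strong[OF that] by measurable
    show "f \<in> Lp_space s P \<longleftrightarrow> (\<lambda>x. f (S x)) \<in> Lp_space s lborel"
      unfolding Lp_space_def using int(1)[OF powm] ess[OF em] sm by (auto split: if_splits)
    show "Lp_norm s P f = Lp_norm s lborel (\<lambda>x. f (S x))" if "strongly_measurable P f"
      unfolding Lp_norm_def using int(2)[OF powm[OF that]] ess[OF em[OF that]] by simp
  qed
  have main: "fourier_power d f \<in> Lp_space (holder_conjugate (ereal p)) P \<and>
        Lp_norm (holder_conjugate (ereal p)) P (fourier_power d f) \<le> C * Lp_norm (ereal p) P f"
    if f: "f \<in> Lp_space 1 P \<inter> Lp_space (ereal p) P" for f :: "_ \<Rightarrow> 'a"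
  proof -
    define h where "h x = f (S x)" for x
    have fm: "strongly_measurable P f" using f by (simp add: Lp_space_def)
    have hL: "h \<in> Lp_space 1 lborel" "h \<in> Lp_space (ereal p) lborel"
      using f unfolding h_def by (auto simp: Lp(1)[symmetric])
    have h: "strongly_integrable lborel h" "integrable lborel (\<lambda>x. norm (h x) powr p)"
      using hL by (auto simp: Lp_space_def strongly_integrable_def one_ereal_def powr_one_gt_zero_iff cong: Bochner_Integration.integrable_cong)
    have fi: "strongly_integrable P f"
      using h(1) fm int(1)[OF borel_measurable_norm_strong[OF fm]] by (simp add: strongly_integrable_def h_def)
    have four: "fourier_power d f (S x) = fourier h x" for x
    proof -
      have inner: "(\<Sum>k<d. S x k * S t k) = x \<bullet> t" for t :: "real^'n"
      proof -
        have "(\<Sum>k<d. S x k * S t k) = (\<Sum>k\<in>{..<d}. x $ e k * t $ e k)" by (intro sum.cong) (auto simp: S_def d_def)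
        also have "\<dots> = (\<Sum>i\<in>UNIV. x $ i * t $ i)"
          using sum.reindex_bij_betw[OF e[folded d_def], of "\<lambda>i. x $ i * t $ i"] by simp
        finally show ?thesis by (simp add: inner_vec_def)
      qed
      define E where "E t = cis (- (2 * pi * (\<Sum>k<d. S x k * t k)))" for t :: "nat \<Rightarrow> real"
      have comp: "(\<lambda>t. t k) \<in> borel_measurable P" if "k < d" for k
        using measurable_component_singleton[of k "{..<d}" "\<lambda>_. lborel :: real measure"] that
        unfolding P_def lebesgue_power_def by simp
      have "(\<lambda>t. \<Sum>k<d. S x k * t k) \<in> borel_measurable P" using comp by auto
      then have "E \<in> borel_measurable P" unfolding E_def by measurable
      moreover have "cmod (E t) = 1" for t by (simp add: E_def)
      ultimately have Ef: "strongly_integrable P (\<lambda>t. E t *\<^sub>C f t)"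
        using fi by (auto simp: strongly_integrable_def norm_scaleC intro!: strongly_measurable_scaleC)
      have "fourier_power d f (S x) = strong_integral P (\<lambda>t. E t *\<^sub>C f t)"
        unfolding fourier_power_def exp_eq_cis P_def E_def ..
      also have "\<dots> = strong_integral lborel (\<lambda>t. E (S t) *\<^sub>C f (S t))"
        using strong_integral_distr(2)[OF S, of "\<lambda>t. E t *\<^sub>C f t"] Ef unfolding P[symmetric] by simp
      also have "\<dots> = fourier h x" unfolding fourier_eq E_def inner h_def ..
      finally show ?thesis .
    qed
    have b: "fourier h \<in> Lp_space (holder_conjugate (ereal p)) lborel"
       "Lp_norm (holder_conjugate (ereal p)) lborel (fourier h) \<le> C * (LBINT x. norm (h x) powr p) powr (1 / p)"
      using bound[OF h] by auto
    have "fourier_power d f \<in> Lp_space (holder_conjugate (ereal p)) P"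
      unfolding Lp(1) four using b by simp
    moreover from this have "strongly_measurable P (fourier_power d f)" by (simp add: Lp_space_def)
    from Lp(2)[OF this] have "Lp_norm (holder_conjugate (ereal p)) P (fourier_power d f) = Lp_norm (holder_conjugate (ereal p)) lborel (fourier h)"
      unfolding four .
    moreover have "Lp_norm (ereal p) P f = (LBINT x. norm (h x) powr p) powr (1 / p)"
      unfolding Lp(2)[OF fm] by (simp add: Lp_norm_def h_def)
    ultimately show ?thesis using b by simp
  qed
  have "1 \<le> d" by (simp add: d_def Suc_le_eq)
  then show ?thesis
    unfolding fourier_type_def using p main unfolding P_def
    by (auto simp: one_ereal_def numeral_eq_ereal intro!: exI[of _ d] exI[of _ C])
qed

text \<open>The transform is bounded by the L^1 norm; dimension 1 serves as witness.\<close>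

lemma fourier_type_one: "fourier_type TYPE('a::complex_banach) 1"
proof -
  have h: "holder_conjugate (ereal 1) = \<infinity>" by (simp add: holder_conjugate_def one_ereal_def[symmetric])
  have "fourier_type TYPE('a) (ereal 1)"
  proof (rule fourier_type_transfer[where 'n = 1 and C = 1])
    fix f :: "real^1 \<Rightarrow> 'a"
    assume f: "strongly_integrable lborel f"
    have m: "(\<lambda>x. ereal (norm (fourier f x))) \<in> borel_measurable lborel"
      using borel_measurable_norm_strong[OF strongly_measurable_fourier[OF f]] by measurable
    define K where "K = (LBINT t. norm (f t))"
    have K: "0 \<le> K" unfolding K_def by (intro Bochner_Integration.integral_nonneg) auto
    have le: "esssup lborel (\<lambda>x. ereal (norm (fourier f x))) \<le> ereal K"
      using norm_fourier_le[OF f] by (intro esssup_I m AE_I2) (simp add: K_def)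
    have "real_of_ereal (esssup lborel (\<lambda>x. ereal (norm (fourier f x)))) \<le> K"
      using le K by (cases "esssup lborel (\<lambda>x. ereal (norm (fourier f x)))") auto
    moreover have "esssup lborel (\<lambda>x. ereal (norm (fourier f x))) < \<infinity>" using le by (auto intro: le_less_trans)
    ultimately show "fourier f \<in> Lp_space (holder_conjugate (ereal 1)) lborel \<and>
       Lp_norm (holder_conjugate (ereal 1)) lborel (fourier f) \<le> 1 * (LBINT x. norm (f x) powr 1) powr (1 / 1)"
      unfolding h using strongly_measurable_fourier[OF f] K
      by (simp add: Lp_space_def Lp_norm_def K_def)
  qed auto
  then show ?thesis by (simp add: one_ereal_def)
qed

lemma holder_conjugate_ereal:
  assumes "1 < p" shows "holder_conjugate (ereal p) = ereal (p / (p - 1))"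
proof -
  have "1 - 1 / ereal p = ereal (1 - 1 / p)" using assms by (simp add: one_ereal_def)
  moreover have "1 - 1 / p \<noteq> 0" using assms by (simp add: field_simps)
  ultimately show ?thesis using assms by (simp add: holder_conjugate_def one_ereal_def field_simps)
qed

theorem fourier_typeI:
  fixes p :: real
  assumes p: "1 < p" "p \<le> 2"
    and test: "\<And>(f :: real^'n::finite \<Rightarrow> 'a::complex_banach) (\<eta> :: real^'n \<Rightarrow> 'a cdual). finite_simple lborel f \<Longrightarrow> finite_simple lborel \<eta> \<Longrightarrow>
      (LBINT x. norm (f x) powr p) \<le> 1/16 \<Longrightarrow> (LBINT x. norm (\<eta> x) powr p) \<le> 1/4 \<Longrightarrow>
      cmod (LBINT x. clinop_apply (\<eta> x) (fourier f x)) \<le> C"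
  shows "fourier_type TYPE('a) (ereal p)"
proof (rule fourier_type_transfer)
  fix f :: "real^'n \<Rightarrow> 'a"
  assume f: "strongly_integrable lborel f" "integrable lborel (\<lambda>x. norm (f x) powr p)"
  show "fourier f \<in> Lp_space (holder_conjugate (ereal p)) lborel \<and>
       Lp_norm (holder_conjugate (ereal p)) lborel (fourier f) \<le> 4096 * C * (LBINT x. norm (f x) powr p) powr (1 / p)"
    using fourier_bound_Lp[OF p test f] strongly_measurable_fourier[OF f(1)]
    unfolding holder_conjugate_ereal[OF p(1)] by (auto simp: Lp_space_def Lp_norm_def)
qed (use p in auto)

section \<open>Uniform boundedness\<close>

text \<open>Sokal's elementary argument, on the images of \<open>\<ell>\<^sup>1\<close> spanned by sequences in \<open>U\<close>.\<close>

lemma uniform_boundedness_series: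
  fixes T :: "'i \<Rightarrow> 'm \<Rightarrow> complex"
  assumes each: "\<And>i. i \<in> I \<Longrightarrow> \<exists>K. \<forall>m\<in>U. cmod (T i m) \<le> K"
    and series: "\<And>\<mu> a. (\<And>k. \<mu> k \<in> U) \<Longrightarrow> (\<And>k. \<bar>a k\<bar> \<le> (1/4) ^ Suc k) \<Longrightarrow>
      \<exists>C. \<forall>i\<in>I. cmod (\<Sum>k. of_real (a k) * T i (\<mu> k)) \<le> C"
  shows "\<exists>C. \<forall>i\<in>I. \<forall>m\<in>U. cmod (T i m) \<le> C"
proof (rule ccontr)
  assume neg: "\<not> ?thesis"
  define S where "S i = (SUP m\<in>U. cmod (T i m))" for i
  have le_S: "cmod (T i m) \<le> S i" if "i \<in> I" "m \<in> U" for i m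
    unfolding S_def using each[OF that(1)] by (intro cSUP_upper that) (auto simp: bdd_above_def)
  \<comment> \<open>5^n outgrows the weights 4^-(n+1) used below, and 2/3 exceeds by 1/3 the share
    that the tail of the series can cancel.\<close>
  have "\<exists>i m. i \<in> I \<and> m \<in> U \<and> 5 ^ n < S i \<and> 2/3 * S i \<le> cmod (T i m)" for n :: nat
  proof -
    obtain i m where im: "i \<in> I" "m \<in> U" "5 ^ n < cmod (T i m)" using neg by (meson not_le)
    then have pos: "5 ^ n < S i" using le_S[of i m] by linarith
    then have "0 < S i" by (rule less_trans[rotated]) simp
    then have "2/3 * S i < S i" by simp
    moreover have "bdd_above ((\<lambda>m. cmod (T i m)) ` U)" using each[OF im(1)] by (auto simp: bdd_above_def)
    ultimately obtain m' where "m' \<in> U" "2/3 * S i < cmod (T i m')"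
      using less_cSUP_iff[of U "\<lambda>m. cmod (T i m)" "2/3 * S i"] im(2) unfolding S_def by auto
    then show ?thesis using im pos by (intro exI[of _ i] exI[of _ m']) auto
  qed
  then obtain i \<mu> where i: "\<And>n. i n \<in> I" and \<mu>: "\<And>n. \<mu> n \<in> U" and big: "\<And>n. 5 ^ n < S (i n)"
    and near: "\<And>n. 2/3 * S (i n) \<le> cmod (T (i n) (\<mu> n))" by metis
  define t where "t n k = T (i n) (\<mu> k)" for n k
  define w :: "nat \<Rightarrow> real" where "w k = (1/4) ^ Suc k" for k
  have w: "0 < w k" for k by (simp add: w_def)
  define P where "P n f \<longleftrightarrow> (\<forall>k\<le>n. \<bar>f k\<bar> = w k \<and> w k * cmod (t k k) \<le> cmod (\<Sum>j\<le>k. of_real (f j) * t k j))"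
    for n and f :: "nat \<Rightarrow> real"
  \<comment> \<open>Two points \<open>y + w z\<close> and \<open>y - w z\<close> are 2 w |z| apart,
    so one of them has modulus at least w |z|: a sign can always be chosen that prevents
    cancellation with the earlier terms.\<close>
  have sgn: "\<exists>s. \<bar>s\<bar> = w k \<and> w k * cmod z \<le> cmod (y + of_real s * z)" for k and y z :: complex
  proof -
    have "(y + of_real (w k) * z) - (y + of_real (- w k) * z) = of_real (2 * w k) * z"
      by (simp add: algebra_simps)
    then have "2 * (w k * cmod z) = cmod ((y + of_real (w k) * z) - (y + of_real (- w k) * z))"
      using w[of k] by (simp add: norm_mult)
    also have "\<dots> \<le> cmod (y + of_real (w k) * z) + cmod (y + of_real (- w k) * z)"
      by (rule norm_triangle_ineq4)
    finally have "w k * cmod z \<le> cmod (y + of_real (w k) * z) \<or> w k * cmod z \<le> cmod (y + of_real (- w k) * z)"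
      by linarith
    then show ?thesis using w[of k] by (metis abs_minus_cancel abs_of_pos)
  qed
  \<comment> \<open>The sign at step n is chosen for the n-th functional and leaves the earlier
    signs unchanged, so the diagonal sequence satisfies every requirement.\<close>
  have "\<exists>F. \<forall>n. P n (F n) \<and> (\<forall>k\<le>n. F (Suc n) k = F n k)"
  proof (rule dependent_nat_choice)
    obtain s where "\<bar>s\<bar> = w 0" "w 0 * cmod (t 0 0) \<le> cmod (0 + of_real s * t 0 0)" using sgn by blast
    then show "\<exists>f. P 0 f" by (intro exI[of _ "\<lambda>_. s"]) (simp add: P_def)
    fix f n assume f: "P n f"
    obtain s where s: "\<bar>s\<bar> = w (Suc n)"
      "w (Suc n) * cmod (t (Suc n) (Suc n)) \<le> cmod ((\<Sum>j\<le>n. of_real (f j) * t (Suc n) j) + of_real s * t (Suc n) (Suc n))"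
      using sgn by blast
    define g where "g = f(Suc n := s)"
    have "(\<Sum>j\<le>k. of_real (g j) * t l j) = (\<Sum>j\<le>k. of_real (f j) * t l j)" if "k \<le> n" for k l
      using that by (intro sum.cong) (auto simp: g_def)
    then have "P (Suc n) g"
      using f s unfolding P_def by (auto simp: le_Suc_eq) (auto simp: g_def)
    then show "\<exists>g. P (Suc n) g \<and> (\<forall>k\<le>n. g k = f k)" by (intro exI[of _ g]) (auto simp: g_def)
  qed
  then obtain F where F: "\<And>n. P n (F n)" "\<And>n k. k \<le> n \<Longrightarrow> F (Suc n) k = F n k" by blast
  define a where "a n = F n n" for n
  have Fa: "F n k = a k" if "k \<le> n" for n k
    using that by (induction rule: dec_induct) (auto simp: a_def F(2))
  have a: "\<bar>a n\<bar> = w n" for n using F(1)[of n] by (simp add: P_def a_def)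
  have head: "w n * cmod (t n n) \<le> cmod (\<Sum>j\<le>n. of_real (a j) * t n j)" for n
    using F(1)[of n] Fa[of _ n] by (simp add: P_def)
  obtain C where C: "\<And>j. j \<in> I \<Longrightarrow> cmod (\<Sum>k. of_real (a k) * T j (\<mu> k)) \<le> C"
    using series[of \<mu> a] \<mu> a unfolding w_def by (metis order_refl)
  have low: "(5/4) ^ n / 12 \<le> C" for n
  proof -
    have tS: "cmod (t n k) \<le> S (i n)" for k unfolding t_def by (rule le_S[OF i \<mu>])
    have S0: "0 \<le> S (i n)" using tS[of 0] norm_ge_zero order_trans by blast
    have trm: "norm (of_real (a k) * t n k) \<le> w k * S (i n)" for k
      unfolding norm_mult using a[of k] tS[of k] w[of k] by (simp add: mult_left_mono)
    have ws: "summable (\<lambda>k. w k * S (i n))" unfolding w_def by (intro summable_mult2) (simp add: summable_geometric)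
    have sm: "summable (\<lambda>k. of_real (a k) * t n k)" by (rule summable_comparison_test'[OF ws trm])
    \<comment> \<open>The weights after the n-th sum to a third of \<open>w n\<close>. Against the
      head, at least 2/3 of \<open>w n\<close> times the supremum, one third survives; it exceeds
      5^n / (3 * 4^(n+1)), which is unbounded.\<close>
    have tail_eq: "(\<Sum>k. w (k + Suc n) * S (i n)) = w n / 3 * S (i n)"
    proof -
      have "(\<lambda>k. (1/4::real) ^ k) sums (4/3)" using geometric_sums[of "1/4::real"] by simp
      from sums_mult2[OF sums_mult[OF this, of "w n / 4"], of "S (i n)"]
      show ?thesis unfolding w_def by (intro sums_unique[symmetric]) (simp add: power_add mult_ac)
    qed
    have tail: "cmod (\<Sum>k. of_real (a (k + Suc n)) * t n (k + Suc n)) \<le> w n / 3 * S (i n)"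
      unfolding tail_eq[symmetric]
      by (rule norm_suminf_le[OF trm summable_ignore_initial_segment[OF ws]]) 
    have "w n * (2/3 * S (i n)) \<le> w n * cmod (t n n)"
      unfolding t_def using near w[of n] by (intro mult_left_mono) auto
    also have "\<dots> \<le> cmod (\<Sum>j\<le>n. of_real (a j) * t n j)" by (rule head)
    also have "(\<Sum>j\<le>n. of_real (a j) * t n j) = (\<Sum>k. of_real (a k) * t n k) - (\<Sum>k. of_real (a (k + Suc n)) * t n (k + Suc n))"
      using suminf_split_initial_segment[OF sm, of "Suc n"] by (simp add: lessThan_Suc_atMost)
    also have "cmod \<dots> \<le> C + w n / 3 * S (i n)"
      by (rule order_trans[OF norm_triangle_ineq4 add_mono[OF _ tail]]) (use C[OF i] in \<open>simp add: t_def\<close>)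
    finally have "w n / 3 * S (i n) \<le> C" by simp
    moreover have "w n / 3 * 5 ^ n \<le> w n / 3 * S (i n)" using big[of n] w[of n] by (intro mult_left_mono) auto
    moreover have "w n / 3 * 5 ^ n = (5/4) ^ n / 12" by (simp add: w_def power_divide)
    ultimately show ?thesis by simp
  qed
  obtain n where "12 * C < (5/4) ^ n" using real_arch_pow[of "5/4" "12 * C"] by auto
  then show False using low[of n] by simp
qed

section \<open>Multipliers tested on Gaussians\<close>

text \<open>With u = F f and v = F^-1 \<phi> this is the pairing of T_m f with \<phi>, where \<phi>
  takes values in the dual of Y.\<close>

definition mult_form ::
  "(real^'n::finite \<Rightarrow> ('x::complex_banach, 'y::complex_banach) clinop) \<Rightarrow> (real^'n \<Rightarrow> 'x) \<Rightarrow> (real^'n \<Rightarrow> 'y cdual) \<Rightarrow> complex"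
  where "mult_form m u v = (LBINT \<xi>. clinop_apply (v \<xi>) (clinop_apply (m \<xi>) (u \<xi>)))"

text \<open>Membership in the sum of L^\<infinity> and L^1, a common home for all L^s with s \<ge>
  1; such functions may be integrated against bounded integrable ones.\<close>

definition tame :: "(real^'n::finite \<Rightarrow> 'a::real_normed_vector) \<Rightarrow> bool" where
  "tame m \<longleftrightarrow> strongly_measurable lborel m \<and>
     (\<exists>K h. 0 \<le> K \<and> integrable lborel h \<and> (AE x in lborel. norm (m x) \<le> K + h x))"

lemma tame_mult_integrable:
  assumes m: "tame m" and w: "integrable lborel w" "\<And>x. 0 \<le> w x" "\<And>x. w x \<le> M"
  shows "integrable lborel (\<lambda>x. norm (m x) * w x)"
proof -
  obtain K h where K: "0 \<le> K" "integrable lborel h" "AE x in lborel. norm (m x) \<le> K + h x"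
    using m unfolding tame_def by blast
  have [measurable]: "(\<lambda>x. norm (m x)) \<in> borel_measurable lborel" by (rule borel_measurable_norm_strong) (use m in \<open>simp add: tame_def\<close>)
  have [measurable]: "w \<in> borel_measurable lborel" using w by auto
  show ?thesis
  proof (rule Bochner_Integration.integrable_bound[where f = "\<lambda>x. K * w x + M * \<bar>h x\<bar>"])
    show "integrable lborel (\<lambda>x. K * w x + M * \<bar>h x\<bar>)" using w K by auto
    show "AE x in lborel. norm (norm (m x) * w x) \<le> norm (K * w x + M * \<bar>h x\<bar>)"
      using K(3)
    proof eventually_elim
      case (elim x)
      have "norm (m x) * w x \<le> (K + \<bar>h x\<bar>) * w x" using elim w(2)[of x] by (intro mult_right_mono) auto
      also have "\<dots> \<le> K * w x + M * \<bar>h x\<bar>" using mult_right_mono[OF w(3)[of x], of "\<bar>h x\<bar>"] by (simp add: algebra_simps)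
      finally show ?case using w(2)[of x] by simp
    qed
  qed measurable
qed

lemma tame_Lp_real:
  assumes m: "strongly_measurable lborel m" "integrable lborel (\<lambda>x. norm (m x) powr s)" and s: "1 \<le> s"
  shows "tame m"
proof -
  have "norm (m x) \<le> 1 + norm (m x) powr s" for x
  proof (cases "norm (m x) \<le> 1")
    case False
    then have "norm (m x) powr 1 \<le> norm (m x) powr s" using s by (intro powr_mono) auto
    then show ?thesis by simp
  qed (auto intro: add_increasing2)
  then show ?thesis unfolding tame_def using m by (intro conjI exI[of _ 1] exI[of _ "\<lambda>x. norm (m x) powr s"]) auto
qed

lemma tame_Lp:
  assumes m: "m \<in> Lp_space s lborel" and s: "1 \<le> s"
  shows "tame m"
proof (cases "s = \<infinity>")
  case True
  then have sm: "strongly_measurable lborel m" and fin: "esssup lborel (\<lambda>x. ereal (norm (m x))) < \<infinity>"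
    using m by (auto simp: Lp_space_def)
  obtain K where K: "esssup lborel (\<lambda>x. ereal (norm (m x))) \<le> ereal K"
    using fin by (cases "esssup lborel (\<lambda>x. ereal (norm (m x)))") auto
  have "AE x in lborel. norm (m x) \<le> max 0 K + 0"
    using esssup_AE[of "\<lambda>x. ereal (norm (m x))" lborel]
  proof eventually_elim
    case (elim x)
    then have "ereal (norm (m x)) \<le> ereal K" using K order_trans by blast
    then show ?case by simp
  qed
  then show ?thesis
    unfolding tame_def using sm by (intro conjI exI[of _ "max 0 K"] exI[of _ "\<lambda>_. 0"]) auto
next
  case False
  then obtain s' where "s = ereal s'" using s by (cases s) auto
  then show ?thesis using m s by (intro tame_Lp_real[of m s']) (auto simp: Lp_space_def one_ereal_def)
qed

lemma gspan_norm_integrable: "f \<in> gspan \<Longrightarrow> integrable lborel (\<lambda>x. norm (f x))"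
  using gspan_integrable by (auto simp: strongly_integrable_def)

lemma gspan_norm_product:
  assumes u: "u \<in> gspan" and v: "v \<in> gspan"
  obtains M where "integrable lborel (\<lambda>x. norm (u x) * norm (v x))" "\<And>x. norm (u x) * norm (v x) \<le> M"
proof -
  obtain K where K: "\<And>x. norm (u x) \<le> K" using gspan_bounded[OF u] by blast
  obtain L where L: "\<And>x. norm (v x) \<le> L" using gspan_bounded[OF v] by blast
  have [measurable]: "(\<lambda>x. norm (u x)) \<in> borel_measurable lborel" "(\<lambda>x. norm (v x)) \<in> borel_measurable lborel"
    using gspan_norm_integrable[OF u] gspan_norm_integrable[OF v] by auto
  have K0: "0 \<le> K" using K[of 0] norm_ge_zero order_trans by blast
  show ?thesis
  proof
    show "norm (u x) * norm (v x) \<le> K * L" for x using K L K0 by (intro mult_mono) auto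
    show "integrable lborel (\<lambda>x. norm (u x) * norm (v x))"
    proof (rule Bochner_Integration.integrable_bound[where f = "\<lambda>x. K * norm (v x)"])
      show "integrable lborel (\<lambda>x. K * norm (v x))" using gspan_norm_integrable[OF v] by simp
      show "AE x in lborel. norm (norm (u x) * norm (v x)) \<le> norm (K * norm (v x))"
        using K K0 by (intro AE_I2) (simp add: abs_mult mult_right_mono)
    qed measurable
  qed
qed

lemma norm_mult_form_integrand:
  "cmod (clinop_apply v (clinop_apply m u)) \<le> norm m * (norm u * norm v)"
proof -
  have "cmod (clinop_apply v (clinop_apply m u)) \<le> norm v * (norm m * norm u)"
    by (rule order_trans[OF norm_clinop_apply_le mult_left_mono[OF norm_clinop_apply_le]]) simp
  then show ?thesis by (simp add: mult_ac)
qed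

lemma mult_form_measurable:
  assumes "strongly_measurable lborel m" "strongly_measurable lborel u" "strongly_measurable lborel v"
  shows "(\<lambda>\<xi>. clinop_apply (v \<xi> :: 'y::complex_banach cdual) (clinop_apply (m \<xi>) (u \<xi>))) \<in> borel_measurable lborel"
  by (rule clinop_apply_measurable[OF assms(3) strongly_measurable_bilinear[OF bounded_bilinear_clinop_apply assms(1,2)]])

lemma mult_form_integrable:
  fixes v :: "real^'n::finite \<Rightarrow> 'y::complex_banach cdual"
  assumes m: "tame m" and u: "u \<in> gspan" and v: "v \<in> gspan"
  shows "integrable lborel (\<lambda>\<xi>. clinop_apply (v \<xi>) (clinop_apply (m \<xi>) (u \<xi>)))"
proof -
  obtain M where M: "integrable lborel (\<lambda>x. norm (u x) * norm (v x))" "\<And>x. norm (u x) * norm (v x) \<le> M"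
    using gspan_norm_product[OF u v] by blast
  have mm: "strongly_measurable lborel m" using m by (simp add: tame_def)
  show ?thesis
    by (rule Bochner_Integration.integrable_bound[OF tame_mult_integrable[OF m M(1) _ M(2)]])
       (use mult_form_measurable[OF mm gspan_strongly_measurable[OF u] gspan_strongly_measurable[OF v]] in
         \<open>auto intro!: AE_I2 norm_mult_form_integrand\<close>)
qed

lemma tame_scaleC_integrable:
  assumes g: "tame (g :: real^'n::finite \<Rightarrow> 'a::complex_banach)" and G: "G \<in> gspan"
  shows "strongly_integrable lborel (\<lambda>x. G x *\<^sub>C g x)"
proof -
  obtain K where K: "\<And>x. norm (G x) \<le> K" using gspan_bounded[OF G] by blast
  have "integrable lborel (\<lambda>x. norm (g x) * cmod (G x))"
    by (rule tame_mult_integrable[OF g gspan_norm_integrable[OF G] _ K]) simp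
  moreover have "strongly_measurable lborel (\<lambda>x. G x *\<^sub>C g x)"
    using g gspan_strongly_measurable[OF G]
    by (intro strongly_measurable_scaleC) (auto simp: tame_def strongly_measurable_iff_borel)
  ultimately show ?thesis by (simp add: strongly_integrable_def norm_scaleC mult.commute)
qed

text \<open>Writing \<open>\<phi>\<close> as a sum of scalar Gaussians times functionals reduces the claim to the definition of
  the distribution \<open>T\<^sub>m f\<close>.\<close>

lemma mult_form_eq_pairing:
  fixes g :: "real^'n::finite \<Rightarrow> 'y::complex_banach" and m :: "real^'n \<Rightarrow> ('x::complex_banach, 'y) clinop"
  assumes m: "tame m" and g: "tame g" and f: "f \<in> gspan"
    and eq: "\<And>\<phi>. schwartz \<phi> \<Longrightarrow> fourier_multiplier m f \<phi> = distribution_of g \<phi>"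
    and \<phi>: "\<phi> \<in> gspan"
  shows "integrable lborel (\<lambda>t. clinop_apply (\<phi> t) (g t)) \<and>
    mult_form m (fourier f) (inverse_fourier \<phi>) = (LBINT t. clinop_apply (\<phi> t) (g t))"
  using \<phi>
proof induction
  case zero
  then show ?case by (simp add: mult_form_def inverse_fourier_eq fourier_zero clinop_apply_simps)
next
  case (add_gauss \<phi> b c y)
  define G where "G = (\<lambda>t. gauss b c t :: complex)"
  have G: "G \<in> gspan" using gspan_gauss[of b c "1::complex"] by (simp add: G_def scaleC_complex_def)
  have iG: "inverse_fourier G \<in> gspan" by (rule inverse_fourier_gspan[OF G])
  have ff: "fourier f \<in> gspan" by (rule fourier_gspan[OF f])
  define z where "z \<xi> = clinop_apply (m \<xi>) (fourier f \<xi>)" for \<xi>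
  \<comment> \<open>Makes the integral in \<open>distribution_of\<close> a genuine one instead of
    the default 0; tameness of \<open>g\<close> does the same for the other side.\<close>
  have tz: "tame z"
  proof -
    have "strongly_measurable lborel z"
      unfolding z_def using m gspan_strongly_measurable[OF ff]
      by (intro strongly_measurable_bilinear[OF bounded_bilinear_clinop_apply]) (auto simp: tame_def)
    moreover obtain K where "\<And>x. norm (fourier f x) \<le> K" using gspan_bounded[OF ff] by blast
    then have "integrable lborel (\<lambda>x. norm (m x) * norm (fourier f x))"
      by (rule tame_mult_integrable[OF m gspan_norm_integrable[OF ff] norm_ge_zero])
    ultimately show ?thesis
      unfolding tame_def z_def by (auto intro!: exI[of _ 0] exI[of _ "\<lambda>x. norm (m x) * norm (fourier f x)"] norm_clinop_apply_le)
  qed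
  have Gz: "strongly_integrable lborel (\<lambda>\<xi>. inverse_fourier G \<xi> *\<^sub>C z \<xi>)" by (rule tame_scaleC_integrable[OF tz iG])
  have Gg: "strongly_integrable lborel (\<lambda>t. G t *\<^sub>C g t)" by (rule tame_scaleC_integrable[OF g G])
  have "(LBINT \<xi>. clinop_apply y (inverse_fourier G \<xi> *\<^sub>C z \<xi>)) = clinop_apply y (fourier_multiplier m f G)"
    unfolding fourier_multiplier_def inverse_fourier_distribution_def distribution_of_def z_def[symmetric]
    by (rule clinop_apply_strong_integral[OF Gz, symmetric])
  also have "\<dots> = clinop_apply y (distribution_of g G)" by (simp add: eq schwartz_gspan[OF G])
  also have "\<dots> = (LBINT t. clinop_apply y (G t *\<^sub>C g t))"
    unfolding distribution_of_def by (rule clinop_apply_strong_integral[OF Gg])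
  finally have key: "(LBINT \<xi>. clinop_apply y (inverse_fourier G \<xi> *\<^sub>C z \<xi>)) = (LBINT t. clinop_apply y (G t *\<^sub>C g t))" .
  have split: "inverse_fourier (\<lambda>t. \<phi> t + gauss b c t *\<^sub>C y) \<xi> = inverse_fourier \<phi> \<xi> + inverse_fourier G \<xi> *\<^sub>C y" for \<xi>
  proof -
    have "fourier (\<lambda>t. gauss b c t *\<^sub>C y) \<xi>' = fourier G \<xi>' *\<^sub>C y" for \<xi>'
      unfolding G_def
      by (rule fourier_bounded_linear[OF bounded_bilinear.bounded_linear_left[OF bounded_bilinear_scaleC]])
         (auto simp: scaleC_scaleC scaleC_complex_def strongly_integrable_complex_iff integrable_gauss)
    then show ?thesis
      by (simp add: inverse_fourier_eq fourier_add gspan_integrable add_gauss.hyps gspan_gauss)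
  qed
  have i1: "integrable lborel (\<lambda>\<xi>. clinop_apply (inverse_fourier \<phi> \<xi>) (z \<xi>))"
    unfolding z_def by (rule mult_form_integrable[OF m ff inverse_fourier_gspan[OF add_gauss.hyps]])
  have i2: "integrable lborel (\<lambda>\<xi>. clinop_apply y (inverse_fourier G \<xi> *\<^sub>C z \<xi>))" by (rule integrable_clinop_apply[OF Gz])
  have i3: "integrable lborel (\<lambda>t. clinop_apply y (G t *\<^sub>C g t))" by (rule integrable_clinop_apply[OF Gg])
  have e1: "clinop_apply (inverse_fourier (\<lambda>t. \<phi> t + gauss b c t *\<^sub>C y) \<xi>) (z \<xi>)
      = clinop_apply (inverse_fourier \<phi> \<xi>) (z \<xi>) + clinop_apply y (inverse_fourier G \<xi> *\<^sub>C z \<xi>)" for \<xi>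
    by (simp add: split clinop_apply_simps clinop_apply_scaleC_right)
  have e2: "clinop_apply (\<phi> t + gauss b c t *\<^sub>C y) (g t) = clinop_apply (\<phi> t) (g t) + clinop_apply y (G t *\<^sub>C g t)" for t
    by (simp add: clinop_apply_simps clinop_apply_scaleC_right G_def)
  show ?case
    unfolding mult_form_def z_def[symmetric] e1 e2 using add_gauss.IH i1 i2 i3 key
    unfolding mult_form_def z_def[symmetric] by simp
qed

text \<open>For r = \<infinity> the bound is required everywhere rather than almost everywhere:
  series of multipliers then converge at every point, and the multipliers constructed later do
  satisfy it.\<close>

definition mult_unit :: "ereal \<Rightarrow> (real^'n::finite \<Rightarrow> 'a::real_normed_vector) \<Rightarrow> bool" where
  "mult_unit r m \<longleftrightarrow> strongly_measurable lborel m \<and>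
     (if r = \<infinity> then \<forall>x. norm (m x) \<le> 1
      else integrable lborel (\<lambda>x. norm (m x) powr real_of_ereal r) \<and> (LBINT x. norm (m x) powr real_of_ereal r) \<le> 1)"

definition gspan_unit :: "real \<Rightarrow> (real^'n::finite \<Rightarrow> 'a::complex_banach) set" where
  "gspan_unit p = {f \<in> gspan. integrable lborel (\<lambda>x. norm (f x) powr p) \<and> (LBINT x. norm (f x) powr p) \<le> 1}"

lemma mult_unit_Lp: "mult_unit r m \<Longrightarrow> m \<in> Lp_space r lborel"
proof -
  assume m: "mult_unit r m"
  show ?thesis
  proof (cases "r = \<infinity>")
    case True
    have "(\<lambda>x. ereal (norm (m x))) \<in> borel_measurable lborel"
      using m borel_measurable_norm_strong[of lborel m] by (auto simp: mult_unit_def)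
    then have "esssup lborel (\<lambda>x. ereal (norm (m x))) \<le> 1"
      using m True by (intro esssup_I) (auto simp: mult_unit_def one_ereal_def)
    then have "esssup lborel (\<lambda>x. ereal (norm (m x))) < \<infinity>" by (rule le_less_trans) simp
    then show ?thesis using m True by (simp add: mult_unit_def Lp_space_def)
  qed (use m in \<open>auto simp: mult_unit_def Lp_space_def\<close>)
qed

text \<open>The pointwise boundedness needed for the uniform boundedness principle, for a single
  multiplier. The constant \<open>C\<close> may be negative, hence the modulus.\<close>

lemma bounded_on_gspan_units:
  fixes m :: "real^'n::finite \<Rightarrow> ('x::complex_banach, 'y::complex_banach) clinop"
  assumes m: "m \<in> Lp_space r lborel" and r: "1 \<le> r" and p: "1 \<le> p" and q: "1 < q"
    and bdd: "fourier_multiplier_bounded (ereal p) (ereal q) m"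
  shows "\<exists>C. \<forall>f\<in>gspan_unit p. \<forall>\<phi>\<in>gspan_unit (q / (q - 1)). cmod (mult_form m (fourier f) (inverse_fourier \<phi>)) \<le> C"
proof -
  obtain C where C: "\<And>f. schwartz f \<Longrightarrow> \<exists>g\<in>Lp_space (ereal q) lborel.
      (\<forall>\<phi>. schwartz \<phi> \<longrightarrow> fourier_multiplier m f \<phi> = distribution_of g \<phi>) \<and>
      Lp_norm (ereal q) lborel g \<le> C * Lp_norm (ereal p) lborel f"
    using bdd unfolding fourier_multiplier_bounded_def by blast
  have "cmod (mult_form m (fourier f) (inverse_fourier \<phi>)) \<le> 1 + \<bar>C\<bar> powr q"
    if f: "f \<in> gspan_unit p" and \<phi>: "\<phi> \<in> gspan_unit (q / (q - 1))" for f :: "real^'n \<Rightarrow> 'x" and \<phi> :: "real^'n \<Rightarrow> 'y cdual"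
  proof -
    have fg: "f \<in> gspan" and \<phi>g: "\<phi> \<in> gspan" using f \<phi> by (auto simp: gspan_unit_def)
    obtain g where g: "g \<in> Lp_space (ereal q) lborel"
      "\<And>\<phi>. schwartz \<phi> \<Longrightarrow> fourier_multiplier m f \<phi> = distribution_of g \<phi>"
      "Lp_norm (ereal q) lborel g \<le> C * Lp_norm (ereal p) lborel f"
      using C[OF schwartz_gspan[OF fg]] by blast
    have gi: "integrable lborel (\<lambda>x. norm (g x) powr q)" using g(1) by (simp add: Lp_space_def)
    define Q where "Q = (LBINT x. norm (g x) powr q)"
    have Q0: "0 \<le> Q" unfolding Q_def by (intro Bochner_Integration.integral_nonneg) auto
    have J0: "0 \<le> (LBINT x. norm (f x) powr p)" by (intro Bochner_Integration.integral_nonneg) auto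
    have "Lp_norm (ereal p) lborel f \<le> 1"
      using f p powr_mono2[OF _ J0, of "1 / p" 1] by (simp add: gspan_unit_def Lp_norm_def)
    moreover have "0 \<le> Lp_norm (ereal p) lborel f" by (simp add: Lp_norm_def)
    ultimately have "C * Lp_norm (ereal p) lborel f \<le> \<bar>C\<bar> * 1"
      by (intro mult_mono) auto
    then have "Q powr (1 / q) \<le> \<bar>C\<bar>" using g(3) by (simp add: Lp_norm_def Q_def)
    then have "(Q powr (1 / q)) powr q \<le> \<bar>C\<bar> powr q" using q by (intro powr_mono2) auto
    then have Q: "Q \<le> \<bar>C\<bar> powr q" using Q0 q by (simp add: powr_powr)
    have tg: "tame g" using g(1) q by (intro tame_Lp) (auto simp: one_ereal_def)
    have eq: "integrable lborel (\<lambda>t. clinop_apply (\<phi> t) (g t))"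
      "mult_form m (fourier f) (inverse_fourier \<phi>) = (LBINT t. clinop_apply (\<phi> t) (g t))"
      using mult_form_eq_pairing[OF tame_Lp[OF m r] tg fg g(2) \<phi>g] by auto
    have \<phi>i: "integrable lborel (\<lambda>x. norm (\<phi> x) powr (q / (q - 1)))" "(LBINT x. norm (\<phi> x) powr (q / (q - 1))) \<le> 1"
      using \<phi> by (auto simp: gspan_unit_def)
    \<comment> \<open>Young's inequality with the weights 1/q and 1/q' enlarged to 1; on unit balls
      any finite bound will do.\<close>
    have pt: "cmod (clinop_apply (\<phi> t) (g t)) \<le> norm (\<phi> t) powr (q / (q - 1)) + norm (g t) powr q" for t
    proof -
      have q': "1 < q / (q - 1)" using q by (simp add: field_simps)
      have "cmod (clinop_apply (\<phi> t) (g t)) \<le> norm (\<phi> t) * norm (g t)" by (rule norm_clinop_apply_le)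
      also have "\<dots> \<le> norm (\<phi> t) powr (q / (q - 1)) / (q / (q - 1)) + norm (g t) powr q / q"
        using q q' by (intro Youngs_inequality) (auto simp: field_simps)
      also have "\<dots> \<le> norm (\<phi> t) powr (q / (q - 1)) / 1 + norm (g t) powr q / 1"
        using q q' by (intro add_mono divide_left_mono) auto
      finally show ?thesis by simp
    qed
    have "cmod (LBINT t. clinop_apply (\<phi> t) (g t)) \<le> (LBINT t. cmod (clinop_apply (\<phi> t) (g t)))"
      by (rule integral_norm_bound)
    also have "\<dots> \<le> (LBINT t. norm (\<phi> t) powr (q / (q - 1)) + norm (g t) powr q)"
      by (intro integral_mono pt integrable_norm eq(1) Bochner_Integration.integrable_add \<phi>i gi)
    also have "\<dots> \<le> 1 + \<bar>C\<bar> powr q" using \<phi>i gi Q by (simp add: Q_def)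
    finally show ?thesis using eq(2) by simp
  qed
  then show ?thesis by blast
qed

text \<open>\<open>A\<close> is a set of full measure on which the series converges absolutely;
  there \<open>H\<close> bounds the sum pointwise. All partial sums are dominated by
  \<open>1 + h\<close>, which is tame, so the form may be summed termwise by dominated
  convergence.\<close>

lemma mult_form_series:
  fixes \<mu> :: "nat \<Rightarrow> real^'n::finite \<Rightarrow> ('x::complex_banach, 'y::complex_banach) clinop"
  assumes \<mu>: "\<And>k. strongly_measurable lborel (\<mu> k)" and a: "\<And>k. \<bar>a k\<bar> \<le> w k"
    and A: "A \<in> sets borel" "AE x in lborel. x \<in> A"
    and sums: "\<And>x. x \<in> A \<Longrightarrow> summable (\<lambda>k. w k * norm (\<mu> k x))" "\<And>x. x \<in> A \<Longrightarrow> (\<Sum>k. w k * norm (\<mu> k x)) \<le> H x"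
    and H: "\<And>x. x \<in> A \<Longrightarrow> H x \<le> 1 + h x" "integrable lborel h" "\<And>x. 0 \<le> h x"
  defines "m \<equiv> \<lambda>x. if x \<in> A then \<Sum>k. a k *\<^sub>R \<mu> k x else 0"
  shows "strongly_measurable lborel m" and "\<And>x. x \<in> A \<Longrightarrow> norm (m x) \<le> H x" and "\<And>x. x \<notin> A \<Longrightarrow> m x = 0"
    and "\<And>u v. u \<in> gspan \<Longrightarrow> v \<in> gspan \<Longrightarrow> (\<And>k. tame (\<mu> k)) \<Longrightarrow>
      (\<lambda>k. of_real (a k) * mult_form (\<mu> k) u v) sums mult_form m u v"
proof -
  have trm: "norm (a k *\<^sub>R \<mu> k x) \<le> w k * norm (\<mu> k x)" for k x
    using a[of k] by (simp add: mult_right_mono)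
  have sm: "summable (\<lambda>k. a k *\<^sub>R \<mu> k x)" if "x \<in> A" for x
    by (rule summable_comparison_test'[OF sums(1)[OF that] trm])
  define s where "s n x = (if x \<in> A then \<Sum>k<n. a k *\<^sub>R \<mu> k x else 0)" for n x
  have s_lim: "(\<lambda>n. s n x) \<longlonglongrightarrow> m x" for x
    using summable_LIMSEQ[OF sm] by (cases "x \<in> A") (auto simp: s_def m_def)
  have sum_sm: "strongly_measurable lborel (\<lambda>x. \<Sum>k<n. a k *\<^sub>R \<mu> k x)" for n
  proof (induction n)
    case (Suc n)
    have "strongly_measurable lborel (\<lambda>x. a n *\<^sub>R \<mu> n x)" by (intro strongly_measurable_scaleR \<mu>) simp
    then show ?case using strongly_measurable_add[OF Suc] by simp
  qed (simp add: strongly_measurable_const)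
  have s_sm: "strongly_measurable lborel (s n)" for n
    unfolding s_def using A by (intro strongly_measurable_If sum_sm) auto
  show m_sm: "strongly_measurable lborel m" by (rule strongly_measurable_LIMSEQ[OF s_sm s_lim])
  show mH: "norm (m x) \<le> H x" if "x \<in> A" for x
    using order_trans[OF norm_suminf_le[OF trm sums(1)[OF that]] sums(2)[OF that]] that by (simp add: m_def)
  show "m x = 0" if "x \<notin> A" for x using that by (simp add: m_def)
  have w0: "0 \<le> w k" for k using a[of k] by simp
  have s_bd: "norm (s n x) \<le> 1 + h x" for n x
  proof (cases "x \<in> A")
    case True
    have "norm (s n x) \<le> (\<Sum>k<n. w k * norm (\<mu> k x))"
      unfolding s_def using True trm by (auto intro: sum_norm_le)
    also have "\<dots> \<le> (\<Sum>k. w k * norm (\<mu> k x))"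
      by (rule sum_le_suminf[OF sums(1)[OF True]]) (auto intro: mult_nonneg_nonneg w0)
    finally show ?thesis using sums(2)[OF True] H(1)[OF True] by simp
  next
    case False then show ?thesis using H(3)[of x] by (simp add: s_def)
  qed
  fix u :: "real^'n \<Rightarrow> 'x" and v :: "real^'n \<Rightarrow> 'y cdual"
  assume u: "u \<in> gspan" and v: "v \<in> gspan" and t: "\<And>k. tame (\<mu> k)"
  obtain M where M: "integrable lborel (\<lambda>x. norm (u x) * norm (v x))" "\<And>x. norm (u x) * norm (v x) \<le> M"
    using gspan_norm_product[OF u v] by blast
  have uv: "strongly_measurable lborel u" "strongly_measurable lborel v" using u v by (auto intro: gspan_strongly_measurable)
  have hm: "h \<in> borel_measurable lborel" using H(2) by simp
  have th: "tame (\<lambda>x. 1 + h x)"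
    unfolding tame_def using H hm
    by (intro conjI exI[of _ 1] exI[of _ h]) (auto simp: strongly_measurable_iff_borel)
  have dom: "integrable lborel (\<lambda>x. norm (1 + h x) * (norm (u x) * norm (v x)))"
    by (rule tame_mult_integrable[OF th M(1) _ M(2)]) simp
  have lim: "(\<lambda>n. LBINT x. clinop_apply (v x) (clinop_apply (s n x) (u x))) \<longlonglongrightarrow> mult_form m u v"
    unfolding mult_form_def
  proof (rule integral_dominated_convergence[OF mult_form_measurable[OF m_sm uv] mult_form_measurable[OF s_sm uv] dom])
    show "AE x in lborel. (\<lambda>n. clinop_apply (v x) (clinop_apply (s n x) (u x))) \<longlonglongrightarrow> clinop_apply (v x) (clinop_apply (m x) (u x))"
      by (intro AE_I2 bounded_bilinear.tendsto[OF bounded_bilinear_clinop_apply] tendsto_const s_lim)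
    show "AE x in lborel. norm (clinop_apply (v x) (clinop_apply (s n x) (u x))) \<le> norm (1 + h x) * (norm (u x) * norm (v x))" for n
    proof (rule AE_I2)
      fix x
      have "norm (s n x) * (norm (u x) * norm (v x)) \<le> norm (1 + h x) * (norm (u x) * norm (v x))"
        using s_bd[of n x] H(3)[of x] by (intro mult_right_mono) auto
      then show "norm (clinop_apply (v x) (clinop_apply (s n x) (u x))) \<le> norm (1 + h x) * (norm (u x) * norm (v x))"
        by (rule order_trans[OF norm_mult_form_integrand])
    qed
  qed
  have "(LBINT x. clinop_apply (v x) (clinop_apply (s n x) (u x))) = (\<Sum>k<n. of_real (a k) * mult_form (\<mu> k) u v)" for n
  proof -
    have lin: "linear (\<lambda>F. clinop_apply (v x) (clinop_apply F (u x)))" for x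
      by (intro linearI) (simp_all add: clinop_apply_simps)
    have "(LBINT x. clinop_apply (v x) (clinop_apply (s n x) (u x)))
       = (LBINT x. (\<Sum>k<n. of_real (a k) * clinop_apply (v x) (clinop_apply (\<mu> k x) (u x))))"
    proof (rule integral_cong_AE)
      show "AE x in lborel. clinop_apply (v x) (clinop_apply (s n x) (u x)) = (\<Sum>k<n. of_real (a k) * clinop_apply (v x) (clinop_apply (\<mu> k x) (u x)))"
        using A(2) by eventually_elim
          (simp add: s_def linear_sum[OF lin] linear_scale[OF lin] scaleR_conv_of_real)
    qed (intro mult_form_measurable s_sm uv borel_measurable_sum borel_measurable_times borel_measurable_const \<mu>)+
    also have "\<dots> = (\<Sum>k<n. of_real (a k) * mult_form (\<mu> k) u v)"
      using mult_form_integrable[OF t u v] by (simp add: mult_form_def)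
    finally show ?thesis .
  qed
  with lim show "(\<lambda>k. of_real (a k) * mult_form (\<mu> k) u v) sums mult_form m u v" by (simp add: sums_def)
qed

text \<open>A pointwise form of the completeness of L^r: the sum is again an admissible multiplier,
  to which the hypothesis of the theorem can be applied.\<close>

lemma series_in_Lp:
  fixes \<mu> :: "nat \<Rightarrow> real^'n::finite \<Rightarrow> ('x::complex_banach, 'y::complex_banach) clinop"
  assumes r: "1 \<le> r" and \<mu>: "\<And>k. mult_unit r (\<mu> k)" and a: "\<And>k. \<bar>a k\<bar> \<le> (1/4) ^ Suc k"
  shows "\<exists>m. m \<in> Lp_space r lborel \<and>
    (\<forall>u\<in>gspan. \<forall>v\<in>gspan. (\<lambda>k. of_real (a k) * mult_form (\<mu> k) u v) sums mult_form m u v)"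
proof -
  define w :: "nat \<Rightarrow> real" where "w k = (1/4) ^ Suc k" for k
  \<comment> \<open>The weights 4^-(k+1) split into two factors 2^-(k+1): one makes the majorant
    \<open>h\<close> integrable, the other sums the series against it.\<close>
  define b :: "nat \<Rightarrow> real" where "b k = (1/2) ^ Suc k" for k
  have wb: "w k = b k * b k" for k by (simp add: w_def b_def power_mult_distrib[symmetric])
  have b: "0 < b k" "b k \<le> 1" for k
    using power_le_one[of "1/2::real" "Suc k"] by (simp_all add: b_def)
  have bs: "b sums 1" unfolding b_def using power_half_series .
  have w: "0 < w k" "w k \<le> b k" for k using b[of k] by (auto simp: wb mult_left_le)
  have ws: "summable w" by (rule summable_comparison_test'[OF sums_summable[OF bs]]) (use w in \<open>auto simp: less_imp_le\<close>)
  have aw: "\<bar>a k\<bar> \<le> w k" for k using a by (simp add: w_def)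
  have \<mu>m: "strongly_measurable lborel (\<mu> k)" for k using \<mu> by (simp add: mult_unit_def)
  have tame: "tame (\<mu> k)" for k by (rule tame_Lp[OF mult_unit_Lp[OF \<mu>] r])
  show ?thesis
  proof (cases "r = \<infinity>")
    case True
    have n1: "norm (\<mu> k x) \<le> 1" for k x using \<mu>[of k] True by (simp add: mult_unit_def)
    have le: "w k * norm (\<mu> k x) \<le> b k" for k x
      using mult_mono[OF w(2)[of k] n1[of k x]] b[of k] by simp
    have sm: "summable (\<lambda>k. w k * norm (\<mu> k x))" for x
      by (rule summable_comparison_test'[OF sums_summable[OF bs]]) (use le w in \<open>auto simp: abs_mult less_imp_le\<close>)
    have sle: "(\<Sum>k. w k * norm (\<mu> k x)) \<le> 1" for x
      using suminf_le[OF le sm sums_summable[OF bs]] sums_unique[OF bs] by simp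
    have U: "(UNIV :: (real^'n) set) \<in> sets borel" "AE x in (lborel :: (real^'n) measure). x \<in> UNIV" by auto
    have Z: "(1::real) \<le> 1 + 0" "integrable (lborel :: (real^'n) measure) (\<lambda>_. 0 :: real)" "(0::real) \<le> 0" by auto
    note ms = mult_form_series[of \<mu> a w UNIV "\<lambda>_. 1" "\<lambda>_. 0", OF \<mu>m aw U sm sle Z]
    let ?m = "\<lambda>x. if x \<in> (UNIV :: (real^'n) set) then \<Sum>k. a k *\<^sub>R \<mu> k x else 0"
    have "mult_unit r ?m"
      unfolding mult_unit_def using ms(1) ms(2)[OF UNIV_I] True by (simp del: UNIV_I)
    then show ?thesis
      by (intro exI[of _ ?m] conjI ballI mult_unit_Lp ms(4) tame)
  next
    case False
    then obtain s where s: "r = ereal s" "1 \<le> s" using r by (cases r) (auto simp: one_ereal_def)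
    have \<mu>i: "integrable lborel (\<lambda>x. norm (\<mu> k x) powr s)" "(LBINT x. norm (\<mu> k x) powr s) \<le> 1" for k
      using \<mu>[of k] s by (auto simp: mult_unit_def)
    define h where "h x = (\<Sum>k. ennreal (b k * norm (\<mu> k x) powr s))" for x
    have bm: "(\<lambda>x. ennreal (b k * norm (\<mu> k x) powr s)) \<in> borel_measurable lborel" for k
      using borel_measurable_integrable[OF \<mu>i(1)[of k]] by measurable
    then have hm [measurable]: "h \<in> borel_measurable lborel" unfolding h_def by measurable
    have "(\<integral>\<^sup>+x. h x \<partial>lborel) = (\<Sum>k. \<integral>\<^sup>+x. ennreal (b k * norm (\<mu> k x) powr s) \<partial>lborel)"
      unfolding h_def by (rule nn_integral_suminf[OF bm])
    also have "\<dots> \<le> (\<Sum>k. ennreal (b k))"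
    proof (rule suminf_le)
      fix k
      have "(\<integral>\<^sup>+x. ennreal (b k * norm (\<mu> k x) powr s) \<partial>lborel) = ennreal (LBINT x. b k * norm (\<mu> k x) powr s)"
        using b[of k] by (intro nn_integral_eq_integral integrable_mult_right \<mu>i) (auto simp: less_imp_le)
      also have "\<dots> \<le> ennreal (b k)"
        using \<mu>i(2)[of k] b[of k] by (intro ennreal_leI) (simp add: mult_left_le)
      finally show "(\<integral>\<^sup>+x. ennreal (b k * norm (\<mu> k x) powr s) \<partial>lborel) \<le> ennreal (b k)" .
    qed auto
    also have "\<dots> = 1"
    proof -
      have "(\<Sum>k. ennreal (b k)) = ennreal (suminf b)"
        by (rule suminf_ennreal2[OF less_imp_le[OF b(1)] sums_summable[OF bs]])
      also have "suminf b = 1" by (rule sums_unique[OF bs, symmetric])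
      finally show ?thesis by simp
    qed
    finally have h1: "(\<integral>\<^sup>+x. h x \<partial>lborel) \<le> 1" .
    \<comment> \<open>\<open>h\<close> has integral at most 1, so it is finite almost
      everywhere.\<close>
    define A where "A = {x. h x \<noteq> \<infinity>}"
    have A: "A \<in> sets borel"
    proof -
      have "{x \<in> space lborel. h x \<noteq> \<infinity>} \<in> sets lborel" by measurable
      then show ?thesis by (simp add: A_def)
    qed
    have "(\<integral>\<^sup>+x. h x \<partial>lborel) \<noteq> \<infinity>" using h1 by (auto simp: top_unique)
    from nn_integral_PInf_AE[OF hm this] have AE: "AE x in lborel. x \<in> A" by (simp add: A_def)
    define H where "H x = (if x \<in> A then enn2real (h x) else 0)" for x
    have H0: "0 \<le> H x" for x by (simp add: H_def)
    have Hm: "H \<in> borel_measurable lborel"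
      unfolding H_def using A by measurable
    have "(\<integral>\<^sup>+x. ennreal (H x) \<partial>lborel) \<le> (\<integral>\<^sup>+x. h x \<partial>lborel)"
      by (intro nn_integral_mono) (auto simp: H_def A_def less_top)
    also note h1
    finally have "(\<integral>\<^sup>+x. ennreal (H x) \<partial>lborel) < \<infinity>" by (rule le_less_trans) simp
    then have Hi: "integrable lborel H" using Hm H0 by (intro integrableI_bounded) auto
    have sumH: "summable (\<lambda>k. b k * norm (\<mu> k x) powr s)" "(\<Sum>k. b k * norm (\<mu> k x) powr s) = H x" if "x \<in> A" for x
    proof -
      have nt: "(\<Sum>k. ennreal (b k * norm (\<mu> k x) powr s)) \<noteq> top" using that by (simp add: A_def h_def)
      show sm: "summable (\<lambda>k. b k * norm (\<mu> k x) powr s)"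
        by (rule summable_suminf_not_top[OF _ nt]) (use b in \<open>auto simp: less_imp_le\<close>)
      have "h x = ennreal (\<Sum>k. b k * norm (\<mu> k x) powr s)"
        unfolding h_def using b sm by (intro suminf_ennreal2) (auto simp: less_imp_le)
      moreover have "0 \<le> (\<Sum>k. b k * norm (\<mu> k x) powr s)"
        using b sm by (intro suminf_nonneg) (auto simp: less_imp_le)
      ultimately show "(\<Sum>k. b k * norm (\<mu> k x) powr s) = H x" using that by (simp add: H_def)
    qed
    \<comment> \<open>Since b \<le> 1 and s \<ge> 1, (b |\<mu>|)^s \<le> b |\<mu>|^s, a single term
      of the series for H. Taking roots bounds b |\<mu>| by H^(1/s); the second factor b remains for
      summation.\<close>
    have trm: "w k * norm (\<mu> k x) \<le> b k * H x powr (1 / s)" if "x \<in> A" for k x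
    proof -
      have "(b k * norm (\<mu> k x)) powr s = b k powr s * norm (\<mu> k x) powr s" using b[of k] by (simp add: powr_mult less_imp_le)
      also have "\<dots> \<le> b k powr 1 * norm (\<mu> k x) powr s"
        using b[of k] s(2) by (intro mult_right_mono powr_mono') (auto simp: less_imp_le)
      also have "\<dots> = b k * norm (\<mu> k x) powr s" using b[of k] by simp
      also have "\<dots> = (\<Sum>j\<in>{k}. b j * norm (\<mu> j x) powr s)" by simp
      also have "\<dots> \<le> H x"
        unfolding sumH(2)[OF that, symmetric] using b by (intro sum_le_suminf sumH[OF that]) (auto simp: less_imp_le)
      finally have "((b k * norm (\<mu> k x)) powr s) powr (1 / s) \<le> H x powr (1 / s)" using s by (intro powr_mono2) auto
      then have "b k * norm (\<mu> k x) \<le> H x powr (1 / s)" using b[of k] s by (simp add: powr_powr)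
      then show ?thesis unfolding wb mult.assoc using b[of k] by (intro mult_left_mono) auto
    qed
    have bH: "summable (\<lambda>k. b k * H x powr (1 / s))" for x by (intro summable_mult2 sums_summable[OF bs])
    have sm: "summable (\<lambda>k. w k * norm (\<mu> k x))" if "x \<in> A" for x
      by (rule summable_comparison_test'[OF bH[of x]]) (use trm[OF that] w in \<open>auto simp: abs_mult less_imp_le\<close>)
    have sle: "(\<Sum>k. w k * norm (\<mu> k x)) \<le> H x powr (1 / s)" if "x \<in> A" for x
      using suminf_le[OF trm[OF that] sm[OF that] bH[of x]] sums_unique[OF sums_mult2[OF bs, of "H x powr (1 / s)"]] by simp
    have H1: "H x powr (1 / s) \<le> 1 + H x" for x
    proof (cases "H x \<le> 1")
      case True
      then have "H x powr (1 / s) \<le> 1 powr (1 / s)" using s H0 by (intro powr_mono2) auto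
      then show ?thesis using H0[of x] by simp
    next
      case False
      then have "H x powr (1 / s) \<le> H x powr 1" using s by (intro powr_mono) auto
      then show ?thesis using False by simp
    qed
    note ms = mult_form_series[of \<mu> a w A "\<lambda>x. H x powr (1 / s)" H, OF \<mu>m aw A AE sm sle H1 Hi H0]
    let ?m = "\<lambda>x. if x \<in> A then \<Sum>k. a k *\<^sub>R \<mu> k x else 0"
    have m: "strongly_measurable lborel ?m" by (rule ms(1))
    have le: "norm (?m x) powr s \<le> H x" for x
    proof (cases "x \<in> A")
      case True
      have "norm (?m x) \<le> H x powr (1 / s)" by (rule ms(2)[OF _ _ True])
      then have "norm (?m x) powr s \<le> (H x powr (1 / s)) powr s" using s by (intro powr_mono2) auto
      also have "\<dots> = H x" using s H0[of x] by (simp add: powr_powr)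
      finally show ?thesis .
    qed (use H0 in simp)
    have "integrable lborel (\<lambda>x. norm (?m x) powr s)"
      by (rule Bochner_Integration.integrable_bound[OF Hi])
         (use borel_measurable_norm_strong[OF m] le H0 in \<open>auto intro!: AE_I2 simp del: if_split\<close>)
    then have "?m \<in> Lp_space r lborel" using m s by (simp add: Lp_space_def)
    then show ?thesis by (intro exI[of _ ?m] conjI ballI ms(4) tame)
  qed
qed

lemma mult_unit_dominated:
  assumes r: "1 \<le> r" and m: "mult_unit r m"
  obtains h where "integrable lborel h" "\<And>x. 0 \<le> h x" "(LBINT x. h x) \<le> 1" "\<And>x. norm (m x) \<le> 1 + h x"
proof (cases "r = \<infinity>")
  case True
  then show ?thesis using m by (intro that[of "\<lambda>_. 0"]) (auto simp: mult_unit_def)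
next
  case False
  then obtain s where s: "r = ereal s" "1 \<le> s" using r by (cases r) (auto simp: one_ereal_def)
  have "norm (m x) \<le> 1 + norm (m x) powr s" for x
  proof (cases "norm (m x) \<le> 1")
    case False
    then have "norm (m x) powr 1 \<le> norm (m x) powr s" using s by (intro powr_mono) auto
    then show ?thesis by simp
  qed (auto intro: add_increasing2)
  then show ?thesis using m s by (intro that[of "\<lambda>x. norm (m x) powr s"]) (auto simp: mult_unit_def)
qed

text \<open>Uniform boundedness with the pairs (f, \<phi>) as indices and the unit multipliers as
  arguments. A fixed pair gives a bounded functional because both transforms are Gaussian sums; a
  convergent series of multipliers is again a multiplier, for which the hypothesis gives a bound
  over all pairs.\<close>

theorem multiplier_uniform_bound:
  assumes r: "1 \<le> r" and p: "1 \<le> p" and q: "1 < q"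
    and bdd: "\<And>m :: real^'n::finite \<Rightarrow> ('x::complex_banach, 'y::complex_banach) clinop.
      m \<in> Lp_space r lborel \<Longrightarrow> fourier_multiplier_bounded (ereal p) (ereal q) m"
  obtains C where "\<And>(m :: real^'n \<Rightarrow> ('x, 'y) clinop) f \<phi>. mult_unit r m \<Longrightarrow> f \<in> gspan_unit p \<Longrightarrow>
      \<phi> \<in> gspan_unit (q / (q - 1)) \<Longrightarrow> cmod (mult_form m (fourier f) (inverse_fourier \<phi>)) \<le> C"
proof -
  define I where "I = (gspan_unit p :: (real^'n \<Rightarrow> 'x) set) \<times> (gspan_unit (q / (q - 1)) :: (real^'n \<Rightarrow> 'y cdual) set)"
  define T where "T i m = mult_form m (fourier (fst i)) (inverse_fourier (snd i))"
    for i :: "(real^'n \<Rightarrow> 'x) \<times> (real^'n \<Rightarrow> 'y cdual)" and m :: "real^'n \<Rightarrow> ('x, 'y) clinop"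
  have gs: "fourier (fst i) \<in> gspan" "inverse_fourier (snd i) \<in> gspan" if "i \<in> I" for i
    using that by (auto simp: I_def gspan_unit_def intro: fourier_gspan inverse_fourier_gspan)
  have "\<exists>C. \<forall>i\<in>I. \<forall>m\<in>Collect (mult_unit r). cmod (T i m) \<le> C"
  proof (rule uniform_boundedness_series)
    fix i assume i: "i \<in> I"
    define u where "u = fourier (fst i)"
    define v where "v = inverse_fourier (snd i)"
    have uv: "u \<in> gspan" "v \<in> gspan" using gs[OF i] by (auto simp: u_def v_def)
    obtain M where M: "integrable lborel (\<lambda>x. norm (u x) * norm (v x))" "\<And>x. norm (u x) * norm (v x) \<le> M"
      using gspan_norm_product[OF uv] by blast
    have M0: "0 \<le> M" using M(2)[of 0] by (rule order_trans[rotated]) simp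
    show "\<exists>K. \<forall>m\<in>Collect (mult_unit r). cmod (T i m) \<le> K"
    proof (intro exI ballI)
      fix m :: "real^'n \<Rightarrow> ('x, 'y) clinop"
      assume m: "m \<in> Collect (mult_unit r)"
      then obtain h where h: "integrable lborel h" "\<And>x. 0 \<le> h x" "(LBINT x. h x) \<le> 1" "\<And>x. norm (m x) \<le> 1 + h x"
        using mult_unit_dominated[OF r, of m] by auto
      have tm: "tame m" using m by (intro tame_Lp[OF mult_unit_Lp r]) auto
      have "cmod (T i m) \<le> (LBINT x. cmod (clinop_apply (v x) (clinop_apply (m x) (u x))))"
        unfolding T_def mult_form_def u_def v_def by (rule integral_norm_bound)
      also have "\<dots> \<le> (LBINT x. norm (u x) * norm (v x) + M * h x)"
      proof (rule integral_mono)
        show "integrable lborel (\<lambda>x. cmod (clinop_apply (v x) (clinop_apply (m x) (u x))))"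
          by (intro integrable_norm mult_form_integrable tm uv)
        show "integrable lborel (\<lambda>x. norm (u x) * norm (v x) + M * h x)" using M h by simp
        fix x
        have "cmod (clinop_apply (v x) (clinop_apply (m x) (u x))) \<le> norm (m x) * (norm (u x) * norm (v x))"
          by (rule norm_mult_form_integrand)
        also have "\<dots> \<le> (1 + h x) * (norm (u x) * norm (v x))" by (intro mult_right_mono h) simp
        also have "\<dots> \<le> norm (u x) * norm (v x) + M * h x"
          using mult_left_mono[OF M(2)[of x] h(2)[of x]] by (simp add: algebra_simps)
        finally show "cmod (clinop_apply (v x) (clinop_apply (m x) (u x))) \<le> norm (u x) * norm (v x) + M * h x" .
      qed
      also have "\<dots> = (LBINT x. norm (u x) * norm (v x)) + M * (LBINT x. h x)" using M h by simp
      also have "\<dots> \<le> (LBINT x. norm (u x) * norm (v x)) + M * 1" using h(3) M0 by (intro add_left_mono mult_left_mono)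
      finally show "cmod (T i m) \<le> (LBINT x. norm (u x) * norm (v x)) + M * 1" .
    qed
  next
    fix \<mu> :: "nat \<Rightarrow> real^'n \<Rightarrow> ('x, 'y) clinop" and a :: "nat \<Rightarrow> real"
    assume \<mu>: "\<And>k. \<mu> k \<in> Collect (mult_unit r)" and a: "\<And>k. \<bar>a k\<bar> \<le> (1/4) ^ Suc k"
    obtain m where m: "m \<in> Lp_space r lborel"
      "\<And>u v. u \<in> gspan \<Longrightarrow> v \<in> gspan \<Longrightarrow> (\<lambda>k. of_real (a k) * mult_form (\<mu> k) u v) sums mult_form m u v"
      using series_in_Lp[OF r _ a, of \<mu>] \<mu> by blast
    obtain C where C: "\<And>f \<phi>. f \<in> gspan_unit p \<Longrightarrow> \<phi> \<in> gspan_unit (q / (q - 1)) \<Longrightarrow> cmod (mult_form m (fourier f) (inverse_fourier \<phi>)) \<le> C"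
      using bounded_on_gspan_units[OF m(1) r p q bdd[OF m(1)]] by blast
    have "cmod (\<Sum>k. of_real (a k) * T i (\<mu> k)) \<le> C" if i: "i \<in> I" for i
      using sums_unique[OF m(2)[OF gs[OF i]]] C[of "fst i" "snd i"] i by (auto simp: T_def I_def)
    then show "\<exists>C. \<forall>i\<in>I. cmod (\<Sum>k. of_real (a k) * T i (\<mu> k)) \<le> C" by blast
  qed
  then obtain C where "\<And>i m. i \<in> I \<Longrightarrow> mult_unit r m \<Longrightarrow> cmod (T i m) \<le> C" by blast
  then show ?thesis
    by (intro that[of C]) (force simp: T_def I_def)
qed

section \<open>Reflections\<close>

text \<open>Testing with reflected functions replaces \<open>inverse_fourier\<close> by
  \<open>fourier\<close> in the multiplier bound, which is how the last two parts use it.\<close>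

lemma fourier_reflect_gspan:
  assumes "f \<in> gspan" shows "fourier (\<lambda>t. f (- t)) \<xi> = fourier f (- \<xi>)"
  using assms
proof (induction arbitrary: \<xi>)
  case zero then show ?case by (simp add: fourier_zero)
next
  case (add_gauss f b c x)
  then show ?case
    by (simp add: fourier_add gspan_integrable gspan_gauss gspan_reflect gauss_uminus fourier_gauss_scaleC)
qed

lemma inverse_fourier_reflect_gspan:
  "f \<in> gspan \<Longrightarrow> inverse_fourier (\<lambda>t. f (- t)) = fourier f"
  by (simp add: fun_eq_iff inverse_fourier_eq fourier_reflect_gspan)

lemma inverse_fourier_fourier_gspan:
  assumes f: "f \<in> gspan" shows "inverse_fourier (fourier f) = f"
proof -
  have "inverse_fourier (fourier f) = fourier (\<lambda>t. fourier f (- t))"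
    using fourier_reflect_gspan[OF fourier_gspan[OF f]] by (simp add: fun_eq_iff inverse_fourier_eq)
  also have "(\<lambda>t. fourier f (- t)) = inverse_fourier f" by (simp add: fun_eq_iff inverse_fourier_eq)
  finally show ?thesis by (simp add: fourier_inverse_fourier_gspan[OF f])
qed

lemma lborel_distr_uminus_euclidean: "distr lborel borel uminus = (lborel :: 'e::euclidean_space measure)"
  by (subst (2) lborel_affine[of "-1" 0]) (simp_all add: density_1)

lemma lborel_reflect:
  fixes f :: "'e::euclidean_space \<Rightarrow> real"
  assumes "f \<in> borel_measurable borel"
  shows "integrable lborel (\<lambda>x. f (- x)) \<longleftrightarrow> integrable lborel f" "(LBINT x. f (- x)) = (LBINT x. f x)"
proof -
  have m: "(uminus :: 'e \<Rightarrow> 'e) \<in> measurable lborel borel" by simp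
  show "integrable lborel (\<lambda>x. f (- x)) \<longleftrightarrow> integrable lborel f" "(LBINT x. f (- x)) = (LBINT x. f x)"
    using integrable_distr_eq[OF m assms] integral_distr[OF m assms] by (simp_all add: lborel_distr_uminus_euclidean)
qed

lemma gspan_unit_reflect:
  assumes "f \<in> gspan_unit p" shows "(\<lambda>t. f (- t)) \<in> gspan_unit p"
proof -
  have f: "f \<in> gspan" using assms by (simp add: gspan_unit_def)
  have "(\<lambda>x. norm (f x) powr p) \<in> borel_measurable borel"
    using assms by (auto simp: gspan_unit_def)
  from lborel_reflect[OF this] show ?thesis
    using assms gspan_reflect[OF f] by (simp add: gspan_unit_def)
qed

section \<open>From multipliers to Fourier type\<close>

text \<open>Origin of the normalisation 1/16: the approximant has p-th power mass at most 4 (1/16 +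
  1/16), which is below 1.\<close>

lemma gspan_unit_approximation:
  fixes f :: "real^'n::finite \<Rightarrow> 'a::complex_banach"
  assumes p: "1 \<le> p" "p \<le> 2" and f: "finite_simple lborel f" "(LBINT x. norm (f x) powr p) \<le> 1/16" and e: "0 < e"
  obtains g where "g \<in> gspan_unit p" "(LBINT x. norm (f x - g x)) \<le> e"
proof -
  obtain g where g: "g \<in> gspan" "(LBINT t. norm (f t - g t)) \<le> min e (1/16)"
    "integrable lborel (\<lambda>t. norm (g t) powr p)"
    "(LBINT t. norm (g t) powr p) \<le> 4 * ((LBINT t. norm (f t) powr p) + min e (1/16))"
    using gspan_approximation[OF p finite_simple_integrable[OF f(1)] finite_simple_integrable_powr[OF f(1)], of "min e (1/16)"] e
    by auto
  have "4 * ((LBINT t. norm (f t) powr p) + min e (1/16)) \<le> 1" using f(2) by (simp add: min_def)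
  then show ?thesis using g by (intro that[of g]) (auto simp: gspan_unit_def)
qed

lemma fourier_typeI_gspan:
  fixes p :: real
  assumes p: "1 < p" "p \<le> 2"
    and test: "\<And>(f :: real^'n::finite \<Rightarrow> 'a::complex_banach) (\<eta> :: real^'n \<Rightarrow> 'a cdual). f \<in> gspan_unit p \<Longrightarrow> finite_simple lborel \<eta> \<Longrightarrow>
      (LBINT x. norm (\<eta> x) powr p) \<le> 1/4 \<Longrightarrow>
      cmod (LBINT x. clinop_apply (\<eta> x) (fourier f x)) \<le> C"
  shows "fourier_type TYPE('a) (ereal p)"
proof (rule fourier_typeI[OF p])
  fix f :: "real^'n \<Rightarrow> 'a" and \<eta> :: "real^'n \<Rightarrow> 'a cdual"
  assume f: "finite_simple lborel f" "(LBINT x. norm (f x) powr p) \<le> 1/16"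
    and \<eta>: "finite_simple lborel \<eta>" "(LBINT x. norm (\<eta> x) powr p) \<le> 1/4"
  show "cmod (LBINT x. clinop_apply (\<eta> x) (fourier f x)) \<le> C"
  proof (rule fourier_pairing_limit[OF finite_simple_integrable[OF \<eta>(1)] finite_simple_integrable[OF f(1)]])
    fix e :: real assume e: "0 < e"
    obtain g where g: "g \<in> gspan_unit p" "(LBINT x. norm (f x - g x)) \<le> e"
      using gspan_unit_approximation[OF _ p(2) f e] p by auto
    then show "\<exists>g. strongly_integrable lborel g \<and> (LBINT t. norm (f t - g t)) \<le> e \<and>
      cmod (LBINT \<xi>. clinop_apply (\<eta> \<xi>) (fourier g \<xi>)) \<le> C"
      using test[OF g(1) \<eta>] by (intro exI[of _ g]) (auto simp: gspan_unit_def intro: gspan_integrable)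
  qed
qed

text \<open>Lets the scalar L^2 factor of the multiplier form be an arbitrary simple function, since
  \<open>k\<close> is bounded and Gaussian sums approximate in L^1 within the L^2 ball.\<close>

lemma norm_integral_limit:
  fixes k :: "real^'n::finite \<Rightarrow> complex"
  assumes u: "finite_simple lborel (u :: real^'n \<Rightarrow> complex)" "(LBINT x. norm (u x) powr 2) \<le> 1/16"
    and k: "k \<in> borel_measurable lborel" "\<And>x. cmod (k x) \<le> K"
    and bound: "\<And>h. h \<in> gspan_unit 2 \<Longrightarrow> cmod (LBINT x. h x * k x) \<le> C"
  shows "cmod (LBINT x. u x * k x) \<le> C"
proof (rule field_le_epsilon)
  fix e :: real assume e: "0 < e"
  have K: "0 \<le> K" using k(2)[of 0] norm_ge_zero order_trans by blast
  obtain h where h: "h \<in> gspan_unit 2" "(LBINT x. norm (u x - h x)) \<le> e / (K + 1)"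
    using gspan_unit_approximation[OF _ _ u, of "e / (K + 1)"] e K by auto
  have hi: "integrable lborel h"
    using h by (auto simp: gspan_unit_def strongly_integrable_complex_iff dest!: gspan_integrable)
  have ui: "integrable lborel u" using finite_simple_integrable[OF u(1)] by (simp add: strongly_integrable_complex_iff)
  have ki: "integrable lborel (\<lambda>x. g x * k x)" if "integrable lborel g" for g
  proof (rule Bochner_Integration.integrable_bound[where f = "\<lambda>x. K * norm (g x)"])
    show "AE x in lborel. norm (g x * k x) \<le> norm (K * norm (g x))"
    proof (rule AE_I2)
      fix x show "norm (g x * k x) \<le> norm (K * norm (g x))"
        using mult_left_mono[OF k(2)[of x], of "norm (g x)"] K by (simp add: norm_mult mult.commute)
    qed
  qed (use that k in auto)
  have "(LBINT x. u x * k x) - (LBINT x. h x * k x) = (LBINT x. (u x - h x) * k x)"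
    using ki[OF ui] ki[OF hi] by (simp add: left_diff_distrib)
  also have "cmod \<dots> \<le> (LBINT x. cmod ((u x - h x) * k x))" by (rule integral_norm_bound)
  also have "\<dots> \<le> (LBINT x. norm (u x - h x) * K)"
  proof (rule integral_mono)
    show "integrable lborel (\<lambda>x. cmod ((u x - h x) * k x))"
      by (intro integrable_norm ki Bochner_Integration.integrable_diff ui hi)
    show "integrable lborel (\<lambda>x. norm (u x - h x) * K)" using ui hi by simp
    show "cmod ((u x - h x) * k x) \<le> norm (u x - h x) * K" for x
      unfolding norm_mult by (intro mult_left_mono k) simp
  qed
  also have "\<dots> \<le> (e / (K + 1)) * K" using mult_right_mono[OF h(2) K] by simp
  also have "\<dots> \<le> e" using e K by (simp add: field_simps)
  finally have "cmod ((LBINT x. u x * k x) - (LBINT x. h x * k x)) \<le> e" .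
  then show "cmod (LBINT x. u x * k x) \<le> C + e"
    using bound[OF h(1)] norm_triangle_sub[of "LBINT x. u x * k x" "LBINT x. h x * k x"] by simp
qed

text \<open>The factorisation \<open>\<eta> = (\<parallel>\<eta>\<parallel>\<^sup>-\<^sup>s \<eta>) \<cdot> \<parallel>\<eta>\<parallel>\<^sup>s\<close> is the one saturating Hoelder's inequality.\<close>

lemma mult_unit_normalized:
  fixes \<eta> :: "real^'n::finite \<Rightarrow> 'a::real_normed_vector" and m :: "real^'n \<Rightarrow> 'b::real_normed_vector"
  assumes m: "strongly_measurable lborel m" "\<And>x. norm (m x) \<le> norm (\<eta> x) powr t"
    "\<And>x. \<eta> x = 0 \<Longrightarrow> m x = 0"
    and \<eta>: "finite_simple lborel \<eta>" "(LBINT x. norm (\<eta> x) powr p) \<le> 1"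
    and r: "r = \<infinity> \<and> t = 0 \<or> (\<exists>s\<ge>1. r = ereal s \<and> t * s = p)"
  shows "mult_unit r m"
proof (cases "r = \<infinity>")
  case True
  then have "norm (m x) \<le> 1" for x
    using m(2)[of x] r by (cases "\<eta> x = 0") auto
  then show ?thesis using m True by (simp add: mult_unit_def)
next
  case False
  then obtain s where s: "1 \<le> s" "r = ereal s" "t * s = p" using r by auto
  have le: "norm (m x) powr s \<le> norm (\<eta> x) powr p" for x
  proof -
    have "norm (m x) powr s \<le> (norm (\<eta> x) powr t) powr s" using s by (intro powr_mono2 m) auto
    then show ?thesis by (simp add: powr_powr s)
  qed
  have i: "integrable lborel (\<lambda>x. norm (\<eta> x) powr p)" by (rule finite_simple_integrable_powr[OF \<eta>(1)])
  have im: "integrable lborel (\<lambda>x. norm (m x) powr s)"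
    by (rule Bochner_Integration.integrable_bound[OF i])
       (use borel_measurable_norm_strong[OF m(1)] le in auto)
  have "(LBINT x. norm (m x) powr s) \<le> 1"
    by (rule order_trans[OF integral_mono[OF im i le] \<eta>(2)])
  then show ?thesis using m(1) im s by (simp add: mult_unit_def)
qed

lemma norm_powr_scaleR_le: "norm ((norm x powr (- s)) *\<^sub>R x) \<le> norm (x :: 'a::real_normed_vector) powr (1 - s)"
proof (cases "x = 0")
  case False
  then have "norm x powr (- s) * norm x powr 1 = norm x powr (1 - s)" by (simp only: powr_add[symmetric]) simp
  then show ?thesis by simp
qed simp

theorem fourier_type_of_functional_multipliers:
  fixes p :: real and r :: ereal
  assumes p: "1 < p" "p \<le> 2" and r: "p = 2 \<and> r = \<infinity> \<or> p < 2 \<and> r = ereal (2 * p / (2 - p))"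
    and bdd: "\<And>m :: real^'n::finite \<Rightarrow> ('x::complex_banach, complex) clinop.
      m \<in> Lp_space r lborel \<Longrightarrow> fourier_multiplier_bounded (ereal p) (ereal 2) m"
  shows "fourier_type TYPE('x) (ereal p)"
proof -
  have r1: "1 \<le> r" using r p by (auto simp: one_ereal_def field_simps)
  \<comment> \<open>The relation 1/p = 1/2 + 1/r, in the shape needed to place a function of size
    |\<eta>|^(1-p/2) in L^r.\<close>
  have rt: "r = \<infinity> \<and> 1 - p / 2 = 0 \<or> (\<exists>s\<ge>1. r = ereal s \<and> (1 - p / 2) * s = p)"
    using r p by (auto simp: field_simps intro!: exI[of _ "2 * p / (2 - p)"])
  obtain C where C: "\<And>(m :: real^'n \<Rightarrow> ('x, complex) clinop) f \<phi>. mult_unit r m \<Longrightarrow> f \<in> gspan_unit p \<Longrightarrow>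
      \<phi> \<in> gspan_unit 2 \<Longrightarrow> cmod (mult_form m (fourier f) (inverse_fourier \<phi>)) \<le> C"
    using multiplier_uniform_bound[OF r1 less_imp_le[OF p(1)] _ bdd] by auto
  \<comment> \<open>The identity functional, since the second argument of the form takes values in
    the dual of the complex numbers.\<close>
  obtain J :: "complex cdual" where J: "\<And>z. clinop_apply J z = z" "norm J \<le> 1"
    using clinop_make[of "\<lambda>z::complex. z" 1] by auto
  show ?thesis
  proof (rule fourier_typeI_gspan[OF p])
    fix f :: "real^'n \<Rightarrow> 'x" and \<eta> :: "real^'n \<Rightarrow> 'x cdual"
    assume f: "f \<in> gspan_unit p" and \<eta>: "finite_simple lborel \<eta>" "(LBINT x. norm (\<eta> x) powr p) \<le> 1/4"
    have fg: "f \<in> gspan" "fourier f \<in> gspan" using f by (auto simp: gspan_unit_def intro: fourier_gspan)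
    define m where "m x = (norm (\<eta> x) powr (- (p / 2))) *\<^sub>R \<eta> x" for x
    \<comment> \<open>Halving brings the square integral from 1/4 down to the 1/16 required by
      \<open>norm_integral_limit\<close>; the final constant 2 C pays for it.\<close>
    define u where "u x = complex_of_real (norm (\<eta> x) powr (p / 2) / 2)" for x
    have fm: "finite_simple lborel m" unfolding m_def by (rule finite_simple_compose[OF \<eta>(1)]) simp
    have fu: "finite_simple lborel u" unfolding u_def by (rule finite_simple_compose[OF \<eta>(1)]) simp
    have mu: "mult_unit r m"
      by (rule mult_unit_normalized[OF finite_simple_strongly_measurable[OF fm] _ _ \<eta>(1) _ rt])
         (use \<eta>(2) norm_powr_scaleR_le in \<open>auto simp: m_def\<close>)
    have "norm (u x) powr 2 = norm (\<eta> x) powr p / 4" for x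
    proof -
      have "norm (u x) powr 2 = (norm (\<eta> x) powr (p / 2) / 2) ^ 2" by (simp add: u_def norm_mult norm_divide)
      also have "\<dots> = (norm (\<eta> x) powr (p / 2)) powr 2 / 4" by (simp add: power_divide)
      finally show ?thesis by (simp add: powr_powr)
    qed
    then have "(LBINT x. norm (u x) powr 2) = (LBINT x. norm (\<eta> x) powr p / 4)" by (simp only:)
    then have u2: "(LBINT x. norm (u x) powr 2) \<le> 1/16" using \<eta>(2) by simp
    define k where "k x = clinop_apply (m x) (fourier f x)" for x
    have k_meas: "k \<in> borel_measurable lborel"
      unfolding k_def by (rule clinop_apply_measurable[OF finite_simple_strongly_measurable[OF fm] gspan_strongly_measurable[OF fg(2)]])
    obtain K1 where K1: "\<And>x. norm (m x) \<le> K1" using finite_simple_bounded[OF fm] by auto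
    obtain K2 where K2: "\<And>x. norm (fourier f x) \<le> K2" using gspan_bounded[OF fg(2)] by blast
    have K10: "0 \<le> K1" using K1[of 0] norm_ge_zero order_trans by blast
    have k_bd: "cmod (k x) \<le> K1 * K2" for x
      unfolding k_def by (rule order_trans[OF norm_clinop_apply_le]) (intro mult_mono K1 K2 K10 norm_ge_zero)
    have "cmod (LBINT x. u x * k x) \<le> C"
    proof (rule norm_integral_limit[OF fu u2 k_meas k_bd])
      fix h :: "real^'n \<Rightarrow> complex"
      assume h: "h \<in> gspan_unit 2"
      then have hg: "h \<in> gspan" by (simp add: gspan_unit_def)
      \<comment> \<open>Chosen so that its inverse transform is \<open>h\<close> times
        \<open>J\<close>; Plancherel keeps it in the unit ball of L^2.\<close>
      define \<phi> where "\<phi> t = fourier h t *\<^sub>C J" for t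
      have \<phi>g: "\<phi> \<in> gspan" unfolding \<phi>_def by (rule gspan_scaleC_left[OF fourier_gspan[OF hg]])
      have inv: "inverse_fourier \<phi> x = h x *\<^sub>C J" for x
      proof -
        have "inverse_fourier \<phi> x = inverse_fourier (fourier h) x *\<^sub>C J"
          unfolding inverse_fourier_eq \<phi>_def
          by (rule fourier_bounded_linear[OF bounded_bilinear.bounded_linear_left[OF bounded_bilinear_scaleC]])
             (auto simp: scaleC_scaleC scaleC_complex_def intro: gspan_integrable fourier_gspan hg)
        then show ?thesis by (simp add: inverse_fourier_fourier_gspan[OF hg])
      qed
      have le: "norm (\<phi> t) powr 2 \<le> (cmod (fourier h t))\<^sup>2" for t
        using J(2) by (auto simp: \<phi>_def norm_scaleC mult_left_le intro!: power_mono)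
      have h2: "(LBINT t. (cmod (h t))\<^sup>2) \<le> 1" using h by (simp add: gspan_unit_def)
      have fhi: "integrable lborel (\<lambda>t. (cmod (fourier h t))\<^sup>2)"
        by (rule gspan_square_integrable[OF fourier_gspan[OF hg]])
      have \<phi>i: "integrable lborel (\<lambda>t. norm (\<phi> t) powr 2)"
        by (rule Bochner_Integration.integrable_bound[OF fhi])
           (use gspan_strongly_measurable[OF \<phi>g, THEN borel_measurable_norm_strong] le in auto)
      have "(LBINT t. norm (\<phi> t) powr 2) \<le> (LBINT t. (cmod (fourier h t))\<^sup>2)"
        by (rule integral_mono[OF \<phi>i fhi le])
      also have "\<dots> = (LBINT t. (cmod (h t))\<^sup>2)"
        using plancherel_gspan[OF fourier_gspan[OF hg]] by (simp add: inverse_fourier_fourier_gspan[OF hg])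
      finally have "\<phi> \<in> gspan_unit 2" using h2 \<phi>g \<phi>i by (simp add: gspan_unit_def)
      from C[OF mu f this] show "cmod (LBINT x. h x * k x) \<le> C"
        by (simp add: mult_form_def inv clinop_apply_simps J k_def scaleC_complex_def)
    qed
    moreover have "clinop_apply (\<eta> x) (fourier f x) = 2 * (u x * k x)" for x
    proof (cases "\<eta> x = 0")
      case False
      then have "norm (\<eta> x) powr (p / 2) * norm (\<eta> x) powr (- (p / 2)) = 1" by (simp add: powr_minus)
      then have "complex_of_real (norm (\<eta> x) powr (p / 2)) * of_real (norm (\<eta> x) powr (- (p / 2))) = 1"
        by (metis of_real_1 of_real_mult)
      then show ?thesis
        by (simp add: u_def k_def m_def clinop_apply_simps scaleR_conv_of_real mult.assoc[symmetric])
    qed (simp add: k_def m_def clinop_apply_simps)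
    ultimately show "cmod (LBINT x. clinop_apply (\<eta> x) (fourier f x)) \<le> 2 * C"
      by (simp add: norm_mult)
  qed
qed

text \<open>The multiplier \<open>\<xi> \<mapsto> \<parallel>h(\<xi>)\<parallel>\<^sup>-\<^sup>s\<^sup>/\<^sup>2 h(\<xi>)\<close> absorbs \<open>h\<close>, and the pairing is moved to \<open>h\<close> by Fubini.\<close>

theorem fourier_type_of_vector_multipliers:
  fixes q :: real and r :: ereal
  assumes q: "2 \<le> q" and r: "q = 2 \<and> r = \<infinity> \<or> 2 < q \<and> r = ereal (2 * q / (q - 2))"
    and bdd: "\<And>m :: real^'n::finite \<Rightarrow> (complex, 'y::complex_banach) clinop.
      m \<in> Lp_space r lborel \<Longrightarrow> fourier_multiplier_bounded (ereal 2) (ereal q) m"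
  shows "fourier_type TYPE('y) (ereal (q / (q - 1)))"
proof -
  define s where "s = q / (q - 1)"
  have s: "1 < s" "s \<le> 2" using q by (auto simp: s_def field_simps)
  have r1: "1 \<le> r" using r q by (auto simp: one_ereal_def field_simps)
  \<comment> \<open>Here 1/s = 1/2 + 1/r, because 1/s = 1 - 1/q and 1/r = 1/2 - 1/q.\<close>
  have rt: "r = \<infinity> \<and> 1 - s / 2 = 0 \<or> (\<exists>t\<ge>1. r = ereal t \<and> (1 - s / 2) * t = s)"
  proof -
    have "1 - s / 2 = (q - 2) / (2 * (q - 1))" using q by (simp add: s_def field_simps)
    moreover have "(q - 2) / (2 * (q - 1)) * (2 * q / (q - 2)) = s" if "2 < q"
    proof -
      have "a / (2 * b) * (2 * q / a) = q / b" if "a \<noteq> 0" for a b :: real using that by simp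
      then show ?thesis unfolding s_def using that by (metis diff_gt_0_iff_gt less_irrefl)
    qed
    moreover have "1 \<le> 2 * q / (q - 2)" if "2 < q" using that by (simp add: field_simps)
    ultimately show ?thesis using r by (metis divide_eq_0_iff diff_self)
  qed
  obtain C where C: "\<And>(m :: real^'n \<Rightarrow> (complex, 'y) clinop) f \<phi>. mult_unit r m \<Longrightarrow> f \<in> gspan_unit 2 \<Longrightarrow>
      \<phi> \<in> gspan_unit s \<Longrightarrow> cmod (mult_form m (fourier f) (inverse_fourier \<phi>)) \<le> C"
    using multiplier_uniform_bound[OF r1 _ _ bdd] q unfolding s_def by auto
  \<comment> \<open>Operators from the complex numbers into Y are the vectors of Y; \<open>V\<close>
    is this identification.\<close>
  have "\<exists>V. \<forall>z. clinop_apply V z = z *\<^sub>C y \<and> norm V \<le> norm y" for y :: 'y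
    by (rule clinop_make[of "\<lambda>z. z *\<^sub>C y" "norm y"])
       (auto simp: scaleC_add_left scaleC_scaleC scaleC_complex_def norm_scaleC mult.commute)
  then obtain V :: "'y \<Rightarrow> (complex, 'y) clinop" where V: "\<And>y z. clinop_apply (V y) z = z *\<^sub>C y" "\<And>y. norm (V y) \<le> norm y"
    by metis
  have V0: "V 0 = 0" using V(2)[of 0] by simp
  show ?thesis
    unfolding s_def[symmetric]
  proof (rule fourier_typeI[OF s])
    fix h :: "real^'n \<Rightarrow> 'y" and \<eta> :: "real^'n \<Rightarrow> 'y cdual"
    assume h: "finite_simple lborel h" "(LBINT x. norm (h x) powr s) \<le> 1/16"
      and \<eta>: "finite_simple lborel \<eta>" "(LBINT x. norm (\<eta> x) powr s) \<le> 1/4"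
    have hi: "strongly_integrable lborel h" by (rule finite_simple_integrable[OF h(1)])
    define m where "m x = V ((norm (h x) powr (- (s / 2))) *\<^sub>R h x)" for x
    define u where "u x = complex_of_real (norm (h x) powr (s / 2))" for x
    have fm: "finite_simple lborel m" unfolding m_def by (rule finite_simple_compose[OF h(1)]) (simp add: V0)
    have fu: "finite_simple lborel u" unfolding u_def by (rule finite_simple_compose[OF h(1)]) simp
    have mu: "mult_unit r m"
      by (rule mult_unit_normalized[OF finite_simple_strongly_measurable[OF fm] _ _ h(1) _ rt])
         (use h(2) order_trans[OF V(2) norm_powr_scaleR_le] in \<open>auto simp: m_def V0\<close>)
    have u2: "(LBINT x. norm (u x) powr 2) \<le> 1/16"
    proof -
      have "norm (u x) powr 2 = norm (h x) powr s" for x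
        using powr_powr[of "norm (h x)" "s / 2" 2] by (simp add: u_def)
      then show ?thesis using h(2) by simp
    qed
    have muh: "clinop_apply (m x) (u x) = h x" for x
    proof (cases "h x = 0")
      case False
      then have "norm (h x) powr (s / 2) * norm (h x) powr (- (s / 2)) = 1" by (simp add: powr_minus)
      then show ?thesis by (simp add: m_def V u_def scaleR_scaleC[symmetric])
    qed (simp add: m_def V0 clinop_apply_simps)
    \<comment> \<open>The form is evaluated at the reflection of \<phi>, whose inverse transform is
      the transform of \<phi>. Its scalar factor runs over transforms of unit functions in L^2,
      hence approximates \<open>u\<close>, and the product of \<open>m\<close> and \<open>u\<close>
      is \<open>h\<close>.\<close>
    have key: "cmod (LBINT x. clinop_apply (\<phi> x) (fourier h x)) \<le> C" if \<phi>: "\<phi> \<in> gspan_unit s" for \<phi>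
    proof -
      have \<phi>g: "\<phi> \<in> gspan" "fourier \<phi> \<in> gspan" using \<phi> by (auto simp: gspan_unit_def intro: fourier_gspan)
      define k where "k x = clinop_apply (fourier \<phi> x) (clinop_apply (m x) 1)" for x
      have mk: "clinop_apply (fourier \<phi> x) (clinop_apply (m x) z) = z * k x" for x z
        using clinop_apply_scaleC_right[of "m x" z 1] clinop_apply_scaleC_right[of "fourier \<phi> x" z "clinop_apply (m x) 1"]
        by (simp add: k_def scaleC_complex_def)
      have k_meas: "k \<in> borel_measurable lborel"
        unfolding k_def
        by (rule mult_form_measurable[OF finite_simple_strongly_measurable[OF fm] strongly_measurable_const gspan_strongly_measurable[OF \<phi>g(2)]])
      obtain K1 where K1: "\<And>x. norm (m x) \<le> K1" using finite_simple_bounded[OF fm] by auto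
      obtain K2 where K2: "\<And>x. norm (fourier \<phi> x) \<le> K2" using gspan_bounded[OF \<phi>g(2)] by blast
      have K10: "0 \<le> K1" using K1[of 0] norm_ge_zero order_trans by blast
      have k_bd: "cmod (k x) \<le> K1 * K2" for x
        unfolding k_def using mult_mono[OF K1[of x] K2[of x] K10 norm_ge_zero]
        by (intro order_trans[OF norm_mult_form_integrand]) simp
      have "cmod (LBINT x. u x * k x) \<le> C"
      proof (rule norm_integral_limit[OF fu u2 k_meas k_bd])
        fix g :: "real^'n \<Rightarrow> complex"
        assume g: "g \<in> gspan_unit 2"
        then have gg: "g \<in> gspan" by (simp add: gspan_unit_def)
        \<comment> \<open>By Plancherel any \<open>g\<close> in the L^2 ball is the transform of an
          admissible first argument.\<close>
        define f where "f = inverse_fourier g"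
        have fg: "f \<in> gspan" and ff: "fourier f = g"
          unfolding f_def by (rule inverse_fourier_gspan[OF gg] fourier_inverse_fourier_gspan[OF gg])+
        have "(LBINT t. (cmod (f t))\<^sup>2) \<le> 1"
          using g plancherel_gspan[OF gg] by (simp add: gspan_unit_def f_def)
        then have "f \<in> gspan_unit 2" using fg gspan_square_integrable[OF fg] by (simp add: gspan_unit_def)
        from C[OF mu this gspan_unit_reflect[OF \<phi>]] show "cmod (LBINT x. g x * k x) \<le> C"
          by (simp add: mult_form_def inverse_fourier_reflect_gspan[OF \<phi>g(1)] ff mk)
      qed
      then have "cmod (LBINT x. clinop_apply (fourier \<phi> x) (h x)) \<le> C"
        unfolding mk[symmetric] muh .
      also have "(LBINT x. clinop_apply (fourier \<phi> x) (h x)) = (LBINT x. clinop_apply (\<phi> x) (fourier h x))"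
        by (rule integral_fourier_swap[OF bounded_bilinear_clinop_apply, symmetric])
           (simp_all add: clinop_apply_simps clinop_apply_scaleC_right scaleC_complex_def hi gspan_integrable[OF \<phi>g(1)])
      finally show ?thesis .
    qed
    \<comment> \<open>Since (1/4)^s \<le> 1/4, the mass drops from 1/4 to 1/16, as approximation by
      unit Gaussian sums requires; the final constant 4 C compensates.\<close>
    define \<zeta> where "\<zeta> x = (1/4) *\<^sub>R \<eta> x" for x
    have f\<zeta>: "finite_simple lborel \<zeta>" unfolding \<zeta>_def by (rule finite_simple_compose[OF \<eta>(1)]) simp
    have \<zeta>s: "(LBINT x. norm (\<zeta> x) powr s) \<le> 1/16"
    proof -
      have "(1/4) powr s \<le> (1/4::real) powr 1" using s by (intro powr_mono') auto
      then have q: "(1/4) powr s \<le> (1/4::real)" by simp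
      have "(LBINT x. norm (\<zeta> x) powr s) = (1/4) powr s * (LBINT x. norm (\<eta> x) powr s)"
      proof -
        have "norm (\<zeta> x) powr s = (1/4) powr s * norm (\<eta> x) powr s" for x
          using powr_mult[of "1/4" "norm (\<eta> x)" s] by (simp add: \<zeta>_def)
        then show ?thesis by (simp only: Bochner_Integration.integral_mult_right_zero)
      qed
      also have "\<dots> \<le> (1/4) * (1/4)"
        using q \<eta>(2) by (intro mult_mono) (auto intro!: Bochner_Integration.integral_nonneg)
      finally show ?thesis by simp
    qed
    define K where "K = (LBINT t. norm (h t))"
    have K: "0 \<le> K" "\<And>x. norm (fourier h x) \<le> K"
      unfolding K_def using norm_fourier_le[OF hi] by (auto intro!: Bochner_Integration.integral_nonneg)
    have fhm: "strongly_measurable lborel (fourier h)" by (rule strongly_measurable_fourier[OF hi])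
    \<comment> \<open>The transform of \<open>h\<close> is bounded by \<open>K\<close>, so the
      pairing is continuous in \<zeta> for the L^1 norm and \<open>key\<close> extends from the
      span.\<close>
    have "cmod (LBINT x. clinop_apply (\<zeta> x) (fourier h x)) \<le> C"
    proof (rule field_le_epsilon)
      fix e :: real assume e: "0 < e"
      obtain \<phi> where \<phi>: "\<phi> \<in> gspan_unit s" "(LBINT x. norm (\<zeta> x - \<phi> x)) \<le> e / (K + 1)"
        using gspan_unit_approximation[OF _ _ f\<zeta> \<zeta>s, of "e / (K + 1)"] e K s by auto
      have \<phi>i: "strongly_integrable lborel \<phi>" using \<phi> by (auto simp: gspan_unit_def intro: gspan_integrable)
      have \<zeta>i: "strongly_integrable lborel \<zeta>" by (rule finite_simple_integrable[OF f\<zeta>])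
      have di: "strongly_integrable lborel (\<lambda>x. \<zeta> x - \<phi> x)" by (rule strongly_integrable_diff[OF \<zeta>i \<phi>i])
      have "(LBINT x. clinop_apply (\<zeta> x) (fourier h x)) - (LBINT x. clinop_apply (\<phi> x) (fourier h x))
         = (LBINT x. clinop_apply (\<zeta> x - \<phi> x) (fourier h x))"
        using clinop_apply_integrable[OF \<zeta>i fhm K(2)] clinop_apply_integrable[OF \<phi>i fhm K(2)]
        by (simp add: bounded_bilinear.diff_left[OF bounded_bilinear_clinop_apply])
      also have "cmod \<dots> \<le> K * (LBINT x. norm (\<zeta> x - \<phi> x))"
        by (rule norm_integral_clinop_apply_le[OF di fhm K(2)])
      also have "\<dots> \<le> K * (e / (K + 1))" by (intro mult_left_mono \<phi> K)
      also have "\<dots> \<le> e" using e K by (simp add: field_simps)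
      finally show "cmod (LBINT x. clinop_apply (\<zeta> x) (fourier h x)) \<le> C + e"
        using key[OF \<phi>(1)] norm_triangle_sub[of "LBINT x. clinop_apply (\<zeta> x) (fourier h x)" "LBINT x. clinop_apply (\<phi> x) (fourier h x)"]
        by simp
    qed
    then show "cmod (LBINT x. clinop_apply (\<eta> x) (fourier h x)) \<le> 4 * C"
      by (simp add: \<zeta>_def clinop_apply_simps)
  qed
qed

text \<open>The rank-one multipliers \<open>w \<cdot> F \<otimes> F\<close> are tested against \<open>f\<close> and its reflection, which gives
  \<open>\<integral> w F(\<F> f)\<^sup>2\<close>; the weight \<open>w\<close> also cancels the phase.\<close>

theorem fourier_type_of_dual_multipliers:
  fixes p :: real and r :: ereal
  assumes p: "1 < p" "p \<le> 2" and r: "p = 2 \<and> r = \<infinity> \<or> p < 2 \<and> r = ereal (p / (2 - p))"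
    and bdd: "\<And>m :: real^'n::finite \<Rightarrow> ('x::complex_banach, 'x cdual) clinop.
      m \<in> Lp_space r lborel \<Longrightarrow> fourier_multiplier_bounded (ereal p) (ereal (p / (p - 1))) m"
  shows "fourier_type TYPE('x) (ereal p)"
proof -
  have r1: "1 \<le> r" using r p by (auto simp: one_ereal_def field_simps)
  \<comment> \<open>Here 1/r = 1/p - 1/p' = (2 - p)/p, the exponent for multipliers of size
    |\<eta>|^(2-p).\<close>
  have rt: "r = \<infinity> \<and> 2 - p = 0 \<or> (\<exists>t\<ge>1. r = ereal t \<and> (2 - p) * t = p)"
    using r p by (auto simp: field_simps intro!: exI[of _ "p / (2 - p)"])
  have q: "1 < p / (p - 1)" "p / (p - 1) / (p / (p - 1) - 1) = p" using p by (auto simp: field_simps)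
  obtain C where C: "\<And>(m :: real^'n \<Rightarrow> ('x, 'x cdual) clinop) f \<phi>. mult_unit r m \<Longrightarrow> f \<in> gspan_unit p \<Longrightarrow>
      \<phi> \<in> gspan_unit p \<Longrightarrow> cmod (mult_form m (fourier f) (inverse_fourier \<phi>)) \<le> C"
    using multiplier_uniform_bound[OF r1 less_imp_le[OF p(1)] q(1) bdd] unfolding q(2) by auto
  \<comment> \<open>The rank-one operator F \<otimes> F, quadratic in F; hence its norm is bounded
    by the square of that of F.\<close>
  have "\<exists>R. \<forall>x. clinop_apply R x = clinop_apply F x *\<^sub>C F \<and> norm R \<le> norm F * norm F" for F :: "'x cdual"
  proof (rule clinop_make[of "\<lambda>x. clinop_apply F x *\<^sub>C F" "norm F * norm F"])
    show "norm (clinop_apply F x *\<^sub>C F) \<le> norm F * norm F * norm x" for x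
      using mult_right_mono[OF norm_clinop_apply_le[of F x] norm_ge_zero[of F]] by (simp add: norm_scaleC mult_ac)
  qed (auto simp: clinop_apply_simps clinop_apply_scaleC_right scaleC_add_left scaleC_scaleC scaleC_complex_def)
  then obtain R :: "'x cdual \<Rightarrow> ('x, 'x cdual) clinop" where
    R: "\<And>F x. clinop_apply (R F) x = clinop_apply F x *\<^sub>C F" "\<And>F. norm (R F) \<le> norm F * norm F" by metis
  have R0: "R 0 = 0" using R(2)[of 0] by simp
  \<comment> \<open>The canonical embedding of X into its bidual: the target of the multipliers is
    X*, so \<phi> takes values in X**.\<close>
  have "\<exists>E. \<forall>F. clinop_apply E F = clinop_apply F x \<and> norm E \<le> norm x" for x :: 'x
    by (rule clinop_make[of "\<lambda>F. clinop_apply F x" "norm x"])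
       (auto simp: clinop_apply_simps mult.commute intro: order_trans[OF norm_clinop_apply_le])
  then obtain E :: "'x \<Rightarrow> 'x cdual cdual" where E: "\<And>x F. clinop_apply (E x) F = clinop_apply F x" "\<And>x. norm (E x) \<le> norm x"
    by metis
  have Eadd: "E (x + y) = E x + E y" for x y by (rule clinop_eqI) (simp add: E clinop_apply_simps)
  have EscC: "E (c *\<^sub>C x) = c *\<^sub>C E x" for c x by (rule clinop_eqI) (simp add: E clinop_apply_simps clinop_apply_scaleC_right)
  have Ebl: "bounded_linear E"
    by (rule bounded_linear_intro[where K = 1]) (auto simp: Eadd EscC scaleR_scaleC E)
  show ?thesis
  proof (rule fourier_typeI_gspan[OF p])
    fix f :: "real^'n \<Rightarrow> 'x" and \<eta> :: "real^'n \<Rightarrow> 'x cdual"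
    assume f: "f \<in> gspan_unit p" and \<eta>: "finite_simple lborel \<eta>" "(LBINT x. norm (\<eta> x) powr p) \<le> 1/4"
    have fg: "f \<in> gspan" "fourier f \<in> gspan" using f by (auto simp: gspan_unit_def intro: fourier_gspan)
    define z where "z x = clinop_apply (\<eta> x) (fourier f x)" for x
    have z_meas: "z \<in> borel_measurable lborel"
      unfolding z_def by (rule clinop_apply_measurable[OF finite_simple_strongly_measurable[OF \<eta>(1)] gspan_strongly_measurable[OF fg(2)]])
    \<comment> \<open>The square of the conjugate phase of \<open>z x\<close>, so that the form
      integrates |z|^2 instead of z^2. Where \<open>z x = 0\<close> the value is 0, as
      \<open>sgn 0 = 0\<close>.\<close>
    define ph where "ph x = (cnj (sgn (z x)))\<^sup>2" for x
    have ph: "cmod (ph x) \<le> 1" "ph x * (z x)\<^sup>2 = of_real ((cmod (z x))\<^sup>2)" for x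
    proof -
      show "cmod (ph x) \<le> 1" by (simp add: ph_def norm_power norm_sgn)
      have "cnj (sgn (z x)) * z x = of_real (cmod (z x))"
      proof -
        have f: "z x * cnj (z x) = of_real (cmod (z x)) * of_real (cmod (z x))"
          using complex_norm_square[of "z x"] by (simp add: power2_eq_square)
        have "cnj (sgn (z x)) * z x = (z x * cnj (z x)) / of_real (cmod (z x))" by (simp add: sgn_eq mult.commute)
        then show ?thesis unfolding f by simp
      qed
      then have "(cnj (sgn (z x)) * z x)\<^sup>2 = of_real ((cmod (z x))\<^sup>2)" by simp
      then show "ph x * (z x)\<^sup>2 = of_real ((cmod (z x))\<^sup>2)" by (simp add: ph_def power_mult_distrib)
    qed
    \<comment> \<open>The weight |\<eta>|^(-p) against the quadratic size of \<open>R\<close> leaves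
      |\<eta>|^(2-p), which \<open>rt\<close> places in L^r.\<close>
    define m where "m x = ph x *\<^sub>C ((norm (\<eta> x) powr (- p)) *\<^sub>R R (\<eta> x))" for x
    have m_meas: "strongly_measurable lborel m"
    proof -
      have "ph \<in> borel_measurable lborel"
      proof -
        have [measurable]: "cnj \<in> borel_measurable borel"
          by (intro borel_measurable_continuous_onI continuous_intros)
        have [measurable]: "z \<in> borel_measurable lborel" by (rule z_meas)
        have eq: "ph = (\<lambda>x. (cnj (z x) / of_real (cmod (z x)))\<^sup>2)" by (simp add: fun_eq_iff ph_def sgn_eq)
        show ?thesis unfolding eq by measurable
      qed
      moreover have "finite_simple lborel (\<lambda>x. (norm (\<eta> x) powr (- p)) *\<^sub>R R (\<eta> x))"
        by (rule finite_simple_compose[OF \<eta>(1)]) simp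
      ultimately show ?thesis
        unfolding m_def by (intro strongly_measurable_scaleC finite_simple_strongly_measurable)
    qed
    have mu: "mult_unit r m"
    proof (rule mult_unit_normalized[OF m_meas _ _ \<eta>(1) _ rt])
      fix x
      show "norm (m x) \<le> norm (\<eta> x) powr (2 - p)"
      proof (cases "\<eta> x = 0")
        case False
        have "norm (m x) = cmod (ph x) * (norm (\<eta> x) powr (- p) * norm (R (\<eta> x)))" by (simp add: m_def norm_scaleC)
        also have "\<dots> \<le> 1 * (norm (\<eta> x) powr (- p) * (norm (\<eta> x) * norm (\<eta> x)))"
          by (intro mult_mono ph R mult_left_mono) auto
        also have "\<dots> = norm (\<eta> x) powr (- p) * norm (\<eta> x) powr 2" by (simp add: power2_eq_square)
        also have "\<dots> = norm (\<eta> x) powr (2 - p)" by (simp only: powr_add[symmetric]) simp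
        finally show ?thesis .
      qed (simp add: m_def)
    qed (use \<eta>(2) in \<open>auto simp: m_def R0\<close>)
    \<comment> \<open>With the reflected \<open>f\<close> the inverse transform of \<phi> is the
      embedded transform of \<open>f\<close> itself, so both arguments of the form carry the same
      function.\<close>
    define \<phi> where "\<phi> t = E (f (- t))" for t
    have fr: "(\<lambda>t. f (- t)) \<in> gspan_unit p" by (rule gspan_unit_reflect[OF f])
    then have frg: "(\<lambda>t. f (- t)) \<in> gspan" by (simp add: gspan_unit_def)
    have \<phi>g: "\<phi> \<in> gspan" unfolding \<phi>_def by (rule gspan_linear[OF frg Eadd EscC])
    have le: "norm (\<phi> t) powr p \<le> norm (f (- t)) powr p" for t
      unfolding \<phi>_def using p by (intro powr_mono2 E) auto
    have fri: "integrable lborel (\<lambda>t. norm (f (- t)) powr p)" "(LBINT t. norm (f (- t)) powr p) \<le> 1"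
      using fr by (auto simp: gspan_unit_def)
    have \<phi>i: "integrable lborel (\<lambda>t. norm (\<phi> t) powr p)"
      by (rule Bochner_Integration.integrable_bound[OF fri(1)])
         (use gspan_strongly_measurable[OF \<phi>g, THEN borel_measurable_norm_strong] le in auto)
    have \<phi>: "\<phi> \<in> gspan_unit p"
      using order_trans[OF integral_mono[OF \<phi>i fri(1) le] fri(2)] \<phi>g \<phi>i by (simp add: gspan_unit_def)
    have inv: "inverse_fourier \<phi> x = E (fourier f x)" for x
    proof -
      have "inverse_fourier \<phi> x = E (fourier (\<lambda>t. f (- t)) (- x))"
        unfolding inverse_fourier_eq \<phi>_def by (rule fourier_bounded_linear[OF Ebl EscC gspan_integrable[OF frg]])
      then show ?thesis by (simp add: fourier_reflect_gspan[OF fg(1)])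
    qed
    define g where "g x = norm (\<eta> x) powr (- p) * (cmod (z x))\<^sup>2" for x
    have form: "clinop_apply (inverse_fourier \<phi> x) (clinop_apply (m x) (fourier f x)) = of_real (g x)" for x
    proof -
      have "clinop_apply (inverse_fourier \<phi> x) (clinop_apply (m x) (fourier f x))
          = of_real (norm (\<eta> x) powr (- p)) * (ph x * (z x)\<^sup>2)"
        by (simp add: inv E m_def clinop_apply_simps R z_def[symmetric] scaleC_complex_def scaleR_conv_of_real
            power2_eq_square mult_ac)
      then show ?thesis by (simp add: ph g_def)
    qed
    have gi: "integrable lborel g"
      using mult_form_integrable[OF tame_Lp[OF mult_unit_Lp[OF mu] r1] fg(2) inverse_fourier_gspan[OF \<phi>g]]
      unfolding form using integrable_Re by fastforce
    have g0: "0 \<le> g x" for x by (simp add: g_def)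
    have "(LBINT x. g x) \<le> C"
    proof -
      have "mult_form m (fourier f) (inverse_fourier \<phi>) = of_real (LBINT x. g x)"
        unfolding mult_form_def form by (rule integral_complex_of_real)
      then show ?thesis using C[OF mu f \<phi>] by simp
    qed
    have \<eta>i: "integrable lborel (\<lambda>x. norm (\<eta> x) powr p)" by (rule finite_simple_integrable_powr[OF \<eta>(1)])
    have le': "cmod (z x) \<le> norm (\<eta> x) powr p + g x" for x
    proof (cases "\<eta> x = 0")
      case True then show ?thesis by (simp add: z_def g_def clinop_apply_simps)
    next
      case False
      \<comment> \<open>Splits |z| into a times |z|/a. The inequality 2 a b \<le> a^2 + b^2 then
        gives the weighted Cauchy-Schwarz bound by |\<eta>|^p + |\<eta>|^(-p) |z|^2.\<close>
      define a where "a = norm (\<eta> x) powr (p / 2)"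
      have a: "0 < a" "norm (\<eta> x) powr p = a\<^sup>2" "norm (\<eta> x) powr (- p) = 1 / a\<^sup>2"
        using False powr_powr[of "norm (\<eta> x)" "p / 2" 2] by (simp_all add: a_def powr_minus_divide)
      have "cmod (z x) = a * (cmod (z x) / a)" using a by simp
      also have "\<dots> \<le> 2 * (a * (cmod (z x) / a))" using a by simp
      also have "\<dots> \<le> a\<^sup>2 + (cmod (z x) / a)\<^sup>2"
        using sum_squares_bound[of a "cmod (z x) / a"] by (simp only: mult.assoc)
      finally show ?thesis by (simp add: g_def a power_divide)
    qed
    have zi: "integrable lborel z"
      by (rule Bochner_Integration.integrable_bound[OF Bochner_Integration.integrable_add[OF \<eta>i gi] z_meas])
         (use le' g0 in \<open>auto intro!: AE_I2 order_trans[OF le']\<close>)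
    have "cmod (LBINT x. z x) \<le> (LBINT x. cmod (z x))" by (rule integral_norm_bound)
    also have "\<dots> \<le> (LBINT x. norm (\<eta> x) powr p + g x)"
      by (intro integral_mono le' integrable_norm zi Bochner_Integration.integrable_add \<eta>i gi)
    also have "\<dots> \<le> 1 + C" using \<eta>i gi \<eta>(2) \<open>(LBINT x. g x) \<le> C\<close> by simp
    finally show "cmod (LBINT x. clinop_apply (\<eta> x) (fourier f x)) \<le> 1 + C"
      unfolding z_def .
  qed
qed

section \<open>Passage from extended to real exponents\<close>

theorem proposition3p15:
  fixes p q r :: ereal
  assumes X_nonzero: "\<exists>x :: 'x::complex_banach. x \<noteq> 0"
    and Y_nonzero: "\<exists>y :: 'y::complex_banach. y \<noteq> 0"
    and p: "1 \<le> p" "p \<le> 2"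
    and q: "2 \<le> q" "q < \<infinity>"
    and r: "1 < r" "1 / r = 1 / p - 1 / q"
  shows
    "((\<forall>m :: real^'n::finite \<Rightarrow> ('x, complex) clinop.
          m \<in> Lp_space r lborel \<longrightarrow> fourier_multiplier_bounded p q m)
        \<and> q = 2 \<longrightarrow> fourier_type TYPE('x) p)
     \<and> ((\<forall>m :: real^'n \<Rightarrow> (complex, 'y) clinop.
          m \<in> Lp_space r lborel \<longrightarrow> fourier_multiplier_bounded p q m)
        \<and> p = 2 \<longrightarrow> fourier_type TYPE('y) (holder_conjugate q))
     \<and> ((\<forall>m :: real^'n \<Rightarrow> ('x, 'x cdual) clinop.
          m \<in> Lp_space r lborel \<longrightarrow> fourier_multiplier_bounded p q m)
        \<and> q = holder_conjugate p \<longrightarrow> fourier_type TYPE('x) p)"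
proof -
  obtain p' where p': "p = ereal p'" "1 \<le> p'" "p' \<le> 2"
    using p by (cases p) (auto simp: one_ereal_def numeral_eq_ereal)
  obtain q' where q': "q = ereal q'" "2 \<le> q'"
    using q by (cases q) (auto simp: numeral_eq_ereal)
  \<comment> \<open>The value r = \<infinity> corresponds to equality of the exponents, as 1 /
    \<infinity> = 0; otherwise the relation can be solved for \<open>r\<close>.\<close>
  have r': "r = \<infinity> \<and> 1 / p' = 1 / q' \<or> 1 / q' < 1 / p' \<and> r = ereal (1 / (1 / p' - 1 / q'))"
  proof (cases r)
    case (real s)
    then have s: "1 / s = 1 / p' - 1 / q'" "1 < s" using r p' q' by (auto simp: one_ereal_def)
    have "0 < 1 / p' - 1 / q'" unfolding s(1)[symmetric] using s(2) by simp
    moreover have "s = 1 / (1 / p' - 1 / q')" by (simp flip: s(1))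
    ultimately show ?thesis using real by simp
  next
    case PInf
    then show ?thesis using r p' q' by (auto simp: one_ereal_def zero_ereal_def)
  qed (use r in auto)
  show ?thesis
  proof (intro conjI impI; elim conjE)
    assume bdd: "\<forall>m :: real^'n \<Rightarrow> ('x, complex) clinop. m \<in> Lp_space r lborel \<longrightarrow> fourier_multiplier_bounded p q m"
      and q2: "q = 2"
    show "fourier_type TYPE('x) p"
    \<comment> \<open>Every space has Fourier type 1; above 1 the multiplier argument
      applies.\<close>
    proof (cases "p' = 1")
      case True
      then show ?thesis using fourier_type_one[where 'a = 'x] by (simp add: p' one_ereal_def)
    next
      case False
      have q2': "q' = 2" using q2 q' by simp
      have "p' = 2 \<and> r = \<infinity> \<or> p' < 2 \<and> r = ereal (2 * p' / (2 - p'))"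
        using r'
      proof
        assume "1 / q' < 1 / p' \<and> r = ereal (1 / (1 / p' - 1 / q'))"
        moreover from this have "p' < 2" using p' q2' by (simp add: field_simps)
        moreover from this have "1 / (1 / p' - 1 / q') = 2 * p' / (2 - p')" using p' q2' by (simp add: field_simps)
        ultimately show ?thesis by simp
      qed (use p' q2' in \<open>simp add: field_simps\<close>)
      then show ?thesis
        using bdd p' q' False unfolding q2'
        by (simp only: p'(1), intro fourier_type_of_functional_multipliers[where r = r and 'n = 'n]) auto
    qed
  next
    assume bdd: "\<forall>m :: real^'n \<Rightarrow> (complex, 'y) clinop. m \<in> Lp_space r lborel \<longrightarrow> fourier_multiplier_bounded p q m"
      and p2: "p = 2"
    have p2': "p' = 2" using p2 p' by simp
    have "q' = 2 \<and> r = \<infinity> \<or> 2 < q' \<and> r = ereal (2 * q' / (q' - 2))"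
      using r'
    proof
      assume "1 / q' < 1 / p' \<and> r = ereal (1 / (1 / p' - 1 / q'))"
      moreover from this have "2 < q'" using q' p2' by (simp add: field_simps)
      moreover from this have "1 / (1 / p' - 1 / q') = 2 * q' / (q' - 2)" using q' p2' by (simp add: field_simps)
      ultimately show ?thesis by simp
    qed (use q' p2' in \<open>simp add: field_simps\<close>)
    then have "fourier_type TYPE('y) (ereal (q' / (q' - 1)))"
      using bdd p' q' unfolding p2'
      by (intro fourier_type_of_vector_multipliers[where r = r and 'n = 'n]) auto
    then show "fourier_type TYPE('y) (holder_conjugate q)"
      using q' by (simp add: holder_conjugate_ereal)
  next
    assume bdd: "\<forall>m :: real^'n \<Rightarrow> ('x, 'x cdual) clinop. m \<in> Lp_space r lborel \<longrightarrow> fourier_multiplier_bounded p q m"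
      and qp: "q = holder_conjugate p"
    \<comment> \<open>The conjugate of 1 is \<infinity>, whereas \<open>q\<close> is finite.\<close>
    have p1: "1 < p'"
    proof (rule ccontr)
      assume "\<not> 1 < p'"
      then have "p = 1" using p' by (simp add: one_ereal_def)
      then show False using qp q by (simp add: holder_conjugate_def)
    qed
    then have qq: "q' = p' / (p' - 1)" using qp q' p' by (simp add: holder_conjugate_ereal)
    have "p' = 2 \<and> r = \<infinity> \<or> p' < 2 \<and> r = ereal (p' / (2 - p'))"
      using r'
    proof
      have e: "1 / p' - 1 / q' = (2 - p') / p'" using p1 by (simp add: qq field_simps)
      assume a: "1 / q' < 1 / p' \<and> r = ereal (1 / (1 / p' - 1 / q'))"
      then have "0 < (2 - p') / p'" using e by simp
      then have "p' < 2" using p1 by (simp add: zero_less_divide_iff)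
      then show ?thesis using a unfolding e by simp
    next
      have e: "1 / p' - 1 / q' = (2 - p') / p'" using p1 by (simp add: qq field_simps)
      assume a: "r = \<infinity> \<and> 1 / p' = 1 / q'"
      then have "(2 - p') / p' = 0" using e by simp
      then show ?thesis using a p1 by simp
    qed
    then show "fourier_type TYPE('x) p"
      using bdd p' q' p1 unfolding qq
      by (simp only: p'(1), intro fourier_type_of_dual_multipliers[where r = r and 'n = 'n]) auto
  qed
qed

end
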